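(* There is a universal constant $c>0$ such that the following holds for every integer $n\geq 3$ and every $\delta>0$. Let $K\subset\mathbb{R}^n$ be a centrally-symmetric convex body (that is, $K=-K$). Assume that $d_{BM}(K\cap E,K\cap F)<1+\delta$ for all linear $2$-dimensional subspaces $E,F\subset\mathbb{R}^n$. Then $$d_{BM}(K,B^n)<1+c\,n^2\delta^{1/3}.$$
   Context: A convex body in a finite-dimensional real vector space is a compact convex set with non-empty interior; $K\cap E$ is regarded as a convex body in the $2$-dimensional space $E$. $B^n$ is the Euclidean unit ball in $\mathbb{R}^n$. For convex bodies $K\subset V$, $L\subset W$ in real vector spaces of the same finite dimension, the (affine, multiplicative) Banach--Mazur distance is $$d_{BM}(K,L)=\inf\{\lambda>0:\ K\subset TL\subset\lambda K+z\ \text{for some affine map } T:W\to V \text{ and some } z\in V\}.$$ *)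

theory Defs
  imports "HOL-Analysis.Analysis" "HOL-Analysis.Finite_Function_Topology"
begin

text \<open>
  The constant of the theorem does not depend on the dimension, so the dimension is quantified
  inside the statement and cannot be a type. All spaces are therefore linear subspaces of
  the type of finitely supported real sequences, which contains every \<open>\<real>\<^sup>n\<close>. The library
  norm on that type is the 1-norm; it is only used for its topology, which is the usual one on
  every finite-dimensional subspace.
\<close>

definition Rn :: "nat \<Rightarrow> (nat \<Rightarrow>\<^sub>0 real) set" where
  "Rn n = {x. Poly_Mapping.keys x \<subseteq> {..<n}}"

definition euclidean_ball :: "nat \<Rightarrow> (nat \<Rightarrow>\<^sub>0 real) set" where
  "euclidean_ball n = {x \<in> Rn n. L2_set (Poly_Mapping.lookup x) {..<n} \<le> 1}"

text \<open>The interior is taken relative to the subspace \<open>V\<close>.\<close>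

definition convex_body_in :: "'a::real_normed_vector set \<Rightarrow> 'a set \<Rightarrow> bool" where
  "convex_body_in V K \<longleftrightarrow>
     K \<subseteq> V \<and> compact K \<and> convex K \<and> (top_of_set V) interior_of K \<noteq> {}"

definition affine_map_on ::
  "'b::real_vector set \<Rightarrow> 'a::real_vector set \<Rightarrow> ('b \<Rightarrow> 'a) \<Rightarrow> bool" where
  "affine_map_on W V T \<longleftrightarrow>
     T ` W \<subseteq> V \<and>
     (\<forall>x\<in>W. \<forall>y\<in>W. \<forall>u. T ((1 - u) *\<^sub>R x + u *\<^sub>R y) = (1 - u) *\<^sub>R T x + u *\<^sub>R T y)"

text \<open>
  Intended for convex bodies \<open>K\<close> in \<open>V\<close> and \<open>L\<close> in \<open>W\<close>, where \<open>V\<close> and \<open>W\<close> have the same finite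
  dimension; the set of admissible \<open>l\<close> is then non-empty.
\<close>

definition banach_mazur ::
  "'a::real_vector set \<Rightarrow> 'a set \<Rightarrow> 'b::real_vector set \<Rightarrow> 'b set \<Rightarrow> real" where
  "banach_mazur V K W L =
     Inf {l. l > 0 \<and> (\<exists>T z. affine_map_on W V T \<and> z \<in> V \<and>
                K \<subseteq> T ` L \<and> T ` L \<subseteq> (\<lambda>x. l *\<^sub>R x + z) ` K)}"

end

theory Submission
  imports Defs "Jordan_Normal_Form.Determinant"
begin

text \<open>
  Parametrize the plane sections of the gauge of \<open>K\<close> by \<open>\<complex>\<close>, in a frame for which the second moment
  of the section is isotropic; such a frame is unique up to conformal maps, and the polar function
  of the section is then determined up to rotation. For every \<open>k > 0\<close> the \<open>k\<close>-th Fourier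
  coefficient of the polar function vanishes on some plane: otherwise, over the frames of planes in a
  3-dimensional subspace, it would give a homotopy in \<open>\<complex> - {0}\<close> between loops of winding numbers
  \<open>- k\<close> and \<open>k\<close>. All sections being \<open>\<delta>\<close>-close to each other, and nearly isometric isotropic
  sections being nearly conformally equivalent, every coefficient of every section is \<open>O(\<delta>)\<close>.
  Smoothing with the kernel \<open>cos ^ (2 N)\<close>, \<open>N ~ 1 / \<delta>\<close>, shows that every section is
  \<open>O(sqrt \<delta>)\<close>-close to an ellipse. Finally, an inscribed ellipsoid of almost maximal volume is
  within \<open>1 + O(n sqrt \<delta>)\<close> of \<open>K\<close>, since otherwise a rank-one modification would enlarge it.
\<close>

section \<open>Inscribed ellipsoids of almost maximal volume\<close>

text \<open>Roundness of a section must be tested by quantities that do not depend on the frame. A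
  linear frame of a plane has four parameters; the condition \<open>mom2 = 0\<close> removes two,
  and the remaining conformal maps change a Fourier coefficient only by a factor, a phase or a
  conjugation. Vanishing of the \<open>k\<close>-th coefficient is thus a property of the plane and
  passes to every other section at a cost linear in delta. The second moment is preferred to an
  extremal ellipse because it is an explicit function of the norm: continuous in the plane, as the
  winding argument requires, and stable under small changes of the norm. Smoothing at scale
  \<open>1 / sqrt N\<close> costs a Lipschitz constant times that scale, and the coefficients
  contribute delta times \<open>sqrt N\<close>; \<open>N ~ 1 / delta\<close> balances the two at
  \<open>sqrt delta\<close>. The bound \<open>1 + O(n sqrt delta)\<close> so obtained covers only
  small \<open>n sqrt delta\<close>. In the other regime \<open>n^2 delta^(1/3)\<close> is at least
  of order \<open>n\<close>, and a bound by \<open>4 n\<close> that holds for every symmetric body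
  is enough.\<close>

abbreviation quad :: "real \<Rightarrow> real \<Rightarrow> real \<Rightarrow> real \<Rightarrow> real \<Rightarrow> real" where
  "quad P B R s t \<equiv> P * s\<^sup>2 + 2 * B * s * t + R * t\<^sup>2"

section \<open>Determinants of rank-one perturbations of the identity\<close>

lemma sylvester_det_rank_one:
  fixes U V :: "real Matrix.mat"
  assumes U: "U \<in> carrier_mat n 1" and V: "V \<in> carrier_mat 1 n"
  shows "Determinant.det (1\<^sub>m n + U * V) = Determinant.det (1\<^sub>m 1 + V * U)"
proof -
  have d: "dim_row U = n" "dim_col U = 1" "dim_row V = 1" "dim_col V = n"
    using U V by (simp_all only: carrier_matD)
  have V': "- V \<in> carrier_mat 1 n" using V by (rule uminus_carrier_mat)
  \<comment> \<open>\<open>?L'\<close> is the inverse of \<open>?L\<close>, and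
    \<open>?L ?X ?L' = ?Y\<close>: the two block triangular matrices are conjugate, and their
    determinants are the two sides of the claim.\<close>
  let ?L = "four_block_mat (1\<^sub>m n) (0\<^sub>m n 1) V (1\<^sub>m 1)"
  let ?L' = "four_block_mat (1\<^sub>m n) (0\<^sub>m n 1) (- V) (1\<^sub>m 1)"
  let ?X = "four_block_mat (1\<^sub>m n + U * V) U (0\<^sub>m 1 n) (1\<^sub>m 1)"
  let ?Y = "four_block_mat (1\<^sub>m n) U (0\<^sub>m 1 n) (1\<^sub>m 1 + V * U)"
  let ?Z = "four_block_mat (1\<^sub>m n) U (- V) (1\<^sub>m 1)"
  have I: "1\<^sub>m 1 \<in> carrier_mat 1 1" "1\<^sub>m n \<in> carrier_mat n n" "0\<^sub>m n 1 \<in> carrier_mat n 1"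
    "0\<^sub>m 1 n \<in> carrier_mat 1 n" for n by simp_all
  have UV: "U * V \<in> carrier_mat n n" using U V by (rule mult_carrier_mat)
  have VU: "V * U \<in> carrier_mat 1 1" using V U by (rule mult_carrier_mat)
  have P: "1\<^sub>m n + U * V \<in> carrier_mat n n" "1\<^sub>m 1 + V * U \<in> carrier_mat 1 1"
    using UV VU by simp_all
  have C: "?L \<in> carrier_mat (n+1) (n+1)" "?L' \<in> carrier_mat (n+1) (n+1)"
      "?X \<in> carrier_mat (n+1) (n+1)" "?Y \<in> carrier_mat (n+1) (n+1)"
    by (intro four_block_carrier_mat I P)+
  have UmV: "U * - V = - (U * V)" using U V by simp
  have cancel: "1\<^sub>m n + W + - W = 1\<^sub>m n" if "W \<in> carrier_mat n n" for W :: "real Matrix.mat"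
    using that by (intro eq_matI) auto
  have e1: "1\<^sub>m n + U * V + U * - V = 1\<^sub>m n"
    unfolding UmV using cancel[OF UV] .
  have "?X * ?L' = four_block_mat ((1\<^sub>m n + U * V) * 1\<^sub>m n + U * - V)
      ((1\<^sub>m n + U * V) * 0\<^sub>m n 1 + U * 1\<^sub>m 1) (0\<^sub>m 1 n * 1\<^sub>m n + 1\<^sub>m 1 * - V)
      (0\<^sub>m 1 n * 0\<^sub>m n 1 + 1\<^sub>m 1 * 1\<^sub>m 1)"
    by (rule mult_four_block_mat[OF P(1) U I(4) I(1) I(2) I(3) V' I(1)])
  also have "\<dots> = ?Z"
  proof (intro arg_cong4[where f = four_block_mat])
    show "(1\<^sub>m n + U * V) * 1\<^sub>m n + U * - V = 1\<^sub>m n"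
      unfolding right_mult_one_mat[OF P(1)] by (rule e1)
    show "(1\<^sub>m n + U * V) * 0\<^sub>m n 1 + U * 1\<^sub>m 1 = U"
      using right_mult_zero_mat[OF P(1), of 1] U by simp
    show "0\<^sub>m 1 n * 1\<^sub>m n + 1\<^sub>m 1 * - V = - V"
      using V' by simp
    show "(0\<^sub>m 1 n * 0\<^sub>m n 1 + 1\<^sub>m 1 * 1\<^sub>m 1 :: real Matrix.mat) = 1\<^sub>m 1"
      by simp
  qed
  finally have XL: "?X * ?L' = ?Z" .
  have "?L * ?Z = four_block_mat (1\<^sub>m n * 1\<^sub>m n + 0\<^sub>m n 1 * - V) (1\<^sub>m n * U + 0\<^sub>m n 1 * 1\<^sub>m 1)
      (V * 1\<^sub>m n + 1\<^sub>m 1 * - V) (V * U + 1\<^sub>m 1 * 1\<^sub>m 1)"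
    by (rule mult_four_block_mat[OF I(2) I(3) V I(1) I(2) U V' I(1)])
  also have "\<dots> = ?Y"
  proof (intro arg_cong4[where f = four_block_mat])
    show "1\<^sub>m n * 1\<^sub>m n + 0\<^sub>m n 1 * - V = 1\<^sub>m n"
      unfolding left_mult_zero_mat[OF V'] by simp
    show "1\<^sub>m n * U + 0\<^sub>m n 1 * 1\<^sub>m 1 = U"
      using U by simp
    show "V * 1\<^sub>m n + 1\<^sub>m 1 * - V = 0\<^sub>m 1 n"
      unfolding right_mult_one_mat[OF V] left_mult_one_mat[OF V'] using V by (intro eq_matI) auto
    show "V * U + 1\<^sub>m 1 * 1\<^sub>m 1 = 1\<^sub>m 1 + V * U"
      unfolding left_mult_one_mat[OF I(1)] by (rule comm_add_mat[OF VU I(1)])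
  qed
  finally have "?L * (?X * ?L') = ?Y"
    unfolding XL .
  then have "Determinant.det (?L * (?X * ?L')) = Determinant.det ?Y"
    by (rule arg_cong)
  then have "Determinant.det ?L * (Determinant.det ?X * Determinant.det ?L') = Determinant.det ?Y"
    unfolding det_mult[OF C(1) mult_carrier_mat[OF C(3) C(2)]] det_mult[OF C(3) C(2)] .
  then show ?thesis
    using det_four_block_mat_upper_right_zero[OF I(2) refl V I(1)]
      det_four_block_mat_upper_right_zero[OF I(2) refl V' I(1)]
      det_four_block_mat_lower_left_zero[OF P(1) U refl I(1)]
      det_four_block_mat_lower_left_zero[OF I(2) U refl P(2)]
    by (simp only: det_one mult_1_left mult_1_right)
qed

lemma det_one_plus_rank_one:
  fixes u v :: "real Matrix.vec"
  assumes u: "u \<in> carrier_vec n" and v: "v \<in> carrier_vec n"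
  shows "Determinant.det (1\<^sub>m n + Matrix.mat n n (\<lambda>(i,j). vec_index u i * vec_index v j))
    = 1 + scalar_prod v u"
proof -
  define U where "U = mat_of_cols n [u]"
  define V where "V = mat_of_rows n [v]"
  have U: "U \<in> carrier_mat n 1" and V: "V \<in> carrier_mat 1 n"
    by (auto simp: U_def V_def)
  have UV: "U * V = Matrix.mat n n (\<lambda>(i,j). vec_index u i * vec_index v j)"
    using u v by (auto intro!: eq_matI simp: U_def V_def scalar_prod_def mat_of_cols_def mat_of_rows_def)
  have VU: "V * U = Matrix.mat 1 1 (\<lambda>_. scalar_prod v u)"
    using u v by (auto intro!: eq_matI simp: U_def V_def scalar_prod_def mat_of_cols_def mat_of_rows_def)
  show ?thesis
    using sylvester_det_rank_one[OF U V] unfolding UV VU by (simp add: det_single)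
qed

lemma rank_one_mat_mult_vec:
  fixes x b :: "real Matrix.vec"
  assumes x: "x \<in> carrier_vec n" and b: "b \<in> carrier_vec n"
  shows "(1\<^sub>m n + Matrix.mat n n (\<lambda>(i,j). vec_index (c \<cdot>\<^sub>v x) i * vec_index x j)) *\<^sub>v b
    = b + (c * scalar_prod x b) \<cdot>\<^sub>v x"
proof (rule eq_vecI)
  fix i assume "i < dim_vec (b + (c * scalar_prod x b) \<cdot>\<^sub>v x)"
  then have i: "i < n" using x by simp
  have "(\<Sum>j\<in>{0..<n}. ((if j = i then 1 else 0) + c * vec_index x i * vec_index x j) * vec_index b j)
     = (\<Sum>j\<in>{0..<n}. (if j = i then vec_index b j else 0)) + (\<Sum>j\<in>{0..<n}. c * vec_index x i * (vec_index x j * vec_index b j))"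
    unfolding sum.distrib[symmetric] by (rule sum.cong) (auto simp: algebra_simps)
  also have "\<dots> = vec_index b i + c * vec_index x i * (\<Sum>j\<in>{0..<n}. vec_index x j * vec_index b j)"
    using i by (simp add: sum_distrib_left)
  finally show "vec_index ((1\<^sub>m n + Matrix.mat n n (\<lambda>(i,j). vec_index (c \<cdot>\<^sub>v x) i * vec_index x j)) *\<^sub>v b) i
    = vec_index (b + (c * scalar_prod x b) \<cdot>\<^sub>v x) i"
    using x b i by (simp add: scalar_prod_def algebra_simps eq_commute[of i])
qed (use x b in auto)

lemma scalar_prod_self_nonneg: "scalar_prod a a \<ge> (0::real)"
  by (simp add: scalar_prod_def sum_nonneg)

lemma vec_index_le_scalar_prod:
  fixes a :: "real Matrix.vec"
  assumes "a \<in> carrier_vec n" "i < n"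
  shows "(vec_index a i)\<^sup>2 \<le> scalar_prod a a"
  using assms member_le_sum[of i "{0..<n}" "\<lambda>i. vec_index a i * vec_index a i"]
  by (simp add: scalar_prod_def power2_eq_square)

text \<open>A norm on n-space in matrix coordinates, where determinants measure volume and the
  dimension is a value. The Euclidean comparison replaces continuity and compactness:
  \<open>kl\<close> bounds the entries of inscribed matrices, \<open>ku\<close> supplies one
  inscribed multiple of the identity.\<close>

locale vec_gauge =
  fixes n :: nat and f :: "real Matrix.vec \<Rightarrow> real" and kl ku :: real
  assumes n: "n > 0"
    and f_nonneg: "\<And>a. a \<in> carrier_vec n \<Longrightarrow> f a \<ge> 0"
    and f_hom: "\<And>a c. a \<in> carrier_vec n \<Longrightarrow> f (c \<cdot>\<^sub>v a) = \<bar>c\<bar> * f a"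
    and f_add: "\<And>a b. a \<in> carrier_vec n \<Longrightarrow> b \<in> carrier_vec n \<Longrightarrow> f (a + b) \<le> f a + f b"
    and kl: "kl > 0" and ku: "ku > 0"
    and f_ge: "\<And>a. a \<in> carrier_vec n \<Longrightarrow> kl * scalar_prod a a \<le> (f a)\<^sup>2"
    and f_le: "\<And>a. a \<in> carrier_vec n \<Longrightarrow> (f a)\<^sup>2 \<le> ku * scalar_prod a a"
begin

text \<open>The ellipsoid is the image of the Euclidean unit ball under \<open>A\<close>, required
  to lie in the unit ball of \<open>f\<close>; \<open>A\<close> may be singular, and the absolute
  value of its determinant is the relative volume.\<close>

definition inscribed :: "real Matrix.mat \<Rightarrow> bool" where
  "inscribed A \<longleftrightarrow> A \<in> carrier_mat n n \<and>
     (\<forall>a\<in>carrier_vec n. (f (A *\<^sub>v a))\<^sup>2 \<le> scalar_prod a a)"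

lemma inscribed_entry:
  assumes "inscribed A" "i < n" "j < n"
  shows "\<bar>A $$ (i,j)\<bar> \<le> 1 / sqrt kl"
proof -
  have A: "A \<in> carrier_mat n n" using assms by (simp add: inscribed_def)
  have "kl * (A $$ (i,j))\<^sup>2 \<le> kl * scalar_prod (Matrix.col A j) (Matrix.col A j)"
    using vec_index_le_scalar_prod[of "Matrix.col A j" n i] A assms kl by simp
  also have "\<dots> \<le> (f (Matrix.col A j))\<^sup>2"
    using A by (intro f_ge) auto
  also have "\<dots> = (f (A *\<^sub>v unit_vec n j))\<^sup>2"
    using A assms by (intro arg_cong[where f = "\<lambda>v. (f v)\<^sup>2"] eq_vecI) auto
  also have "\<dots> \<le> scalar_prod (unit_vec n j) (unit_vec n j)"
    using assms by (auto simp: inscribed_def simp del: scalar_prod_left_unit scalar_prod_right_unit)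
  also have "\<dots> = 1" using assms by simp
  finally have "(A $$ (i,j))\<^sup>2 \<le> (1 / sqrt kl)\<^sup>2"
    using kl by (simp add: field_simps power_divide)
  then show ?thesis using kl by (simp add: abs_le_square_iff[symmetric])
qed

lemma inscribed_det_bounded: "\<exists>C. \<forall>A. inscribed A \<longrightarrow> \<bar>Determinant.det A\<bar> \<le> C"
proof (intro exI allI impI)
  fix A assume A: "inscribed A"
  let ?P = "{p. p permutes {0..<n}}"
  have "\<bar>Determinant.det A\<bar> = \<bar>\<Sum>p\<in>?P. signof p * (\<Prod>i = 0..<n. A $$ (i, p i))\<bar>"
    using A det_def'[of A n] by (simp add: inscribed_def)
  also have "\<dots> \<le> (\<Sum>p\<in>?P. \<bar>signof p * (\<Prod>i = 0..<n. A $$ (i, p i))\<bar>)"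
    by (rule sum_abs)
  also have "\<dots> \<le> (\<Sum>p\<in>?P. (\<Prod>i = 0..<n. 1 / sqrt kl))"
  proof (rule sum_mono)
    fix p assume p: "p \<in> ?P"
    have "\<bar>signof p * (\<Prod>i = 0..<n. A $$ (i, p i))\<bar> = (\<Prod>i = 0..<n. \<bar>A $$ (i, p i)\<bar>)"
      by (simp add: abs_mult abs_prod sign_def)
    also have "\<dots> \<le> (\<Prod>i = 0..<n. 1 / sqrt kl)"
      using p A by (intro prod_mono) (auto intro!: inscribed_entry simp: permutes_in_image[of p "{0..<n}", simplified])
    finally show "\<bar>signof p * (\<Prod>i = 0..<n. A $$ (i, p i))\<bar> \<le> (\<Prod>i = 0..<n. 1 / sqrt kl)" .
  qed
  finally show "\<bar>Determinant.det A\<bar> \<le> (\<Sum>p\<in>?P. (\<Prod>i = 0..<n. 1 / sqrt kl))" .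
qed

text \<open>The determinants have a finite positive supremum, so a matrix within the factor
  \<open>th\<close> of it exists for any \<open>th < 1\<close>. No maximizer has to be produced; the
  loss \<open>th\<close> is absorbed in the later estimates.\<close>

lemma near_maximal_inscribed:
  assumes "0 < th" "th < 1"
  obtains A where "inscribed A" "Determinant.det A \<noteq> 0"
    "\<And>B. inscribed B \<Longrightarrow> th * \<bar>Determinant.det B\<bar> \<le> \<bar>Determinant.det A\<bar>"
proof -
  define S where "S = (\<lambda>A. \<bar>Determinant.det A\<bar>) ` Collect inscribed"
  obtain C where "\<And>A. inscribed A \<Longrightarrow> \<bar>Determinant.det A\<bar> \<le> C"
    using inscribed_det_bounded by blast
  then have bdd: "bdd_above S" unfolding S_def by (auto intro!: bdd_aboveI)
  define I where "I = (1 / sqrt ku) \<cdot>\<^sub>m (1\<^sub>m n :: real Matrix.mat)"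
  have Ia: "I *\<^sub>v a = (1 / sqrt ku) \<cdot>\<^sub>v a" if "a \<in> carrier_vec n" for a
    using that unfolding I_def by (auto intro!: eq_vecI)
  have "inscribed I"
    unfolding inscribed_def
  proof (intro conjI ballI)
    fix a :: "real Matrix.vec" assume a: "a \<in> carrier_vec n"
    have "(f (I *\<^sub>v a))\<^sup>2 = (1/ku) * (f a)\<^sup>2"
      using ku a by (simp add: Ia f_hom power_mult_distrib power_divide)
    also have "\<dots> \<le> (1/ku) * (ku * scalar_prod a a)"
      using f_le[OF a] ku by (intro mult_left_mono) auto
    finally show "(f (I *\<^sub>v a))\<^sup>2 \<le> scalar_prod a a" using ku by simp
  qed (simp add: I_def)
  moreover have "\<bar>Determinant.det I\<bar> > 0" using ku by (simp add: I_def)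
  ultimately have S0: "\<exists>s\<in>S. s > 0" unfolding S_def by blast
  then obtain s0 where "s0 \<in> S" "s0 > 0" by auto
  then have "Sup S > 0" using cSup_upper[OF _ bdd, of s0] by simp
  then have "th * Sup S < Sup S" using assms by simp
  then obtain s where s: "s \<in> S" "th * Sup S < s"
    using less_cSup_iff[of S "th * Sup S"] bdd S0 by blast
  then obtain A where A: "inscribed A" "s = \<bar>Determinant.det A\<bar>" unfolding S_def by auto
  show thesis
  proof
    show "inscribed A" by fact
    show "Determinant.det A \<noteq> 0" using s A mult_pos_pos[OF assms(1) \<open>Sup S > 0\<close>] by auto
    fix B assume "inscribed B"
    then have "\<bar>Determinant.det B\<bar> \<le> Sup S" using bdd by (intro cSup_upper) (auto simp: S_def)
    then have "th * \<bar>Determinant.det B\<bar> \<le> th * Sup S" using assms by simp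
    then show "th * \<bar>Determinant.det B\<bar> \<le> \<bar>Determinant.det A\<bar>" using s A by simp
  qed
qed

lemma mult_vec_eq_0:
  assumes "inscribed A" "Determinant.det A \<noteq> 0" "a \<in> carrier_vec n" "A *\<^sub>v a = 0\<^sub>v n"
  shows "a = 0\<^sub>v n"
  using assms det_0_iff_vec_prod_zero[of A n] unfolding inscribed_def by blast

lemma f_eq_0:
  assumes "a \<in> carrier_vec n" "f a = 0"
  shows "a = 0\<^sub>v n"
proof (rule eq_vecI)
  fix i assume "i < dim_vec (0\<^sub>v n :: real Matrix.vec)"
  then have i: "i < n" by simp
  have "kl * scalar_prod a a \<le> 0" using f_ge[OF assms(1)] assms(2) by simp
  then have "scalar_prod a a \<le> 0" using kl by (simp add: mult_le_0_iff)
  then have "(vec_index a i)\<^sup>2 \<le> 0" using vec_index_le_scalar_prod[OF assms(1) i] by linarith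
  then show "vec_index a i = vec_index (0\<^sub>v n) i" using i by simp
qed (use assms in simp)

text \<open>The only way in which near-maximality is used. If \<open>bd\<close> leaves room around
  the ellipsoid, it can be rescaled by \<open>1 / sqrt ga\<close> along \<open>x\<close> and
  \<open>1 / sqrt al\<close> across \<open>x\<close> and stays inscribed; the volume cannot grow by
  more than the factor \<open>1 / th\<close>.\<close>

lemma near_maximal_rank_one:
  assumes A: "inscribed A" "Determinant.det A \<noteq> 0"
    and mx: "\<And>B. inscribed B \<Longrightarrow> th * \<bar>Determinant.det B\<bar> \<le> \<bar>Determinant.det A\<bar>"
    and th: "0 < th" and x: "x \<in> carrier_vec n" "scalar_prod x x = 1"
    and al: "al > 0" and ga: "ga > 0"
    and bd: "\<And>a. a \<in> carrier_vec n \<Longrightarrow>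
        (f (A *\<^sub>v a))\<^sup>2 \<le> al * scalar_prod a a - (al - ga) * (scalar_prod x a)\<^sup>2"
  shows "th\<^sup>2 \<le> al ^ (n - 1) * ga"
proof -
  have Ac: "A \<in> carrier_mat n n" using A by (simp add: inscribed_def)
  \<comment> \<open>\<open>R\<close> multiplies \<open>x\<close> by \<open>1 + c\<close> and fixes
    the orthogonal complement, so \<open>k\<close> times \<open>R\<close> has exactly the two
    stretching factors \<open>1 / sqrt ga\<close> and \<open>1 / sqrt al\<close>.\<close>
  define c where "c = sqrt (al / ga) - 1"
  define R where "R = 1\<^sub>m n + Matrix.mat n n (\<lambda>(i,j). vec_index (c \<cdot>\<^sub>v x) i * vec_index x j)"
  define k where "k = 1 / sqrt al"
  define B where "B = A * (k \<cdot>\<^sub>m R)"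
  have Rc: "R \<in> carrier_mat n n" by (simp add: R_def)
  have kk: "k * k = 1 / al" "k > 0" using al by (simp_all add: k_def)
  have cc: "(1 + c) * (1 + c) = al / ga" using al ga by (simp add: c_def)
  have "inscribed B"
    unfolding inscribed_def
  proof (intro conjI ballI)
    show "B \<in> carrier_mat n n" using Ac Rc by (simp add: B_def)
    fix b :: "real Matrix.vec" assume b: "b \<in> carrier_vec n"
    define z where "z = b + (c * scalar_prod x b) \<cdot>\<^sub>v x"
    have z: "z \<in> carrier_vec n" using b x by (simp add: z_def)
    have "(k \<cdot>\<^sub>m R) *\<^sub>v b = k \<cdot>\<^sub>v (R *\<^sub>v b)"
      using Rc b by (intro eq_vecI) (auto simp: scalar_prod_def sum_distrib_left mult.assoc)
    also have "R *\<^sub>v b = z"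
      using rank_one_mat_mult_vec[OF x(1) b, of c] unfolding z_def R_def .
    finally have "B *\<^sub>v b = A *\<^sub>v (k \<cdot>\<^sub>v z)"
      using Ac Rc b unfolding B_def by (simp add: assoc_mult_mat_vec[of _ n n _ n])
    then have "(f (B *\<^sub>v b))\<^sup>2 \<le> al * scalar_prod (k \<cdot>\<^sub>v z) (k \<cdot>\<^sub>v z) - (al - ga) * (scalar_prod x (k \<cdot>\<^sub>v z))\<^sup>2"
      using bd[of "k \<cdot>\<^sub>v z"] z by simp
    also have "\<dots> = (k * k) * (al * scalar_prod z z - (al - ga) * (scalar_prod x z)\<^sup>2)"
      using z x by (simp add: algebra_simps power2_eq_square)
    also have "scalar_prod z z = scalar_prod b b + (2 * c + c * c) * (scalar_prod x b)\<^sup>2"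
      using b x comm_scalar_prod[OF b x(1)] unfolding z_def
      by (simp add: scalar_prod_add_distrib[of _ n] add_scalar_prod_distrib[of _ n] algebra_simps power2_eq_square)
    also have "scalar_prod x z = (1 + c) * scalar_prod x b"
      using b x unfolding z_def by (simp add: scalar_prod_add_distrib[of _ n] algebra_simps)
    also have "(k * k) * (al * (scalar_prod b b + (2 * c + c * c) * (scalar_prod x b)\<^sup>2)
        - (al - ga) * ((1 + c) * scalar_prod x b)\<^sup>2)
      = (k * k) * al * scalar_prod b b + (k * k) * (ga * ((1 + c) * (1 + c)) - al) * (scalar_prod x b)\<^sup>2"
      by (simp add: algebra_simps power2_eq_square)
    also have "\<dots> = scalar_prod b b"
      unfolding cc kk using al ga by simp
    finally show "(f (B *\<^sub>v b))\<^sup>2 \<le> scalar_prod b b" .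
  qed
  then have "th * \<bar>Determinant.det B\<bar> \<le> \<bar>Determinant.det A\<bar>" by (rule mx)
  moreover have "Determinant.det R = 1 + c"
    unfolding R_def using x by (subst det_one_plus_rank_one) simp_all
  then have "Determinant.det B = Determinant.det A * (k ^ n * (1 + c))"
    using Ac Rc unfolding B_def by (subst det_mult[of _ n]) auto
  ultimately have "th * (k ^ n * (1 + c)) * \<bar>Determinant.det A\<bar> \<le> 1 * \<bar>Determinant.det A\<bar>"
    using kk al ga by (simp add: abs_mult c_def mult_ac)
  then have "th * (k ^ n * (1 + c)) \<le> 1"
    using mult_right_le_imp_le[of _ "\<bar>Determinant.det A\<bar>" 1] A(2) by simp
  moreover have "0 \<le> th * (k ^ n * (1 + c))" using th kk al ga by (simp add: c_def)
  ultimately have "(th * (k ^ n * (1 + c)))\<^sup>2 \<le> 1" by (intro power_le_one)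
  also have "(th * (k ^ n * (1 + c)))\<^sup>2 = th\<^sup>2 * (k * k) ^ n * ((1 + c) * (1 + c))"
    by (simp add: power_mult_distrib power2_eq_square algebra_simps)
  finally have "th\<^sup>2 * (1 / al) ^ n * (al / ga) \<le> 1" unfolding kk cc .
  moreover have "(1 / al) ^ n * al = 1 / al ^ (n - 1)"
    using n al by (cases n) (simp_all add: power_divide)
  ultimately have "th\<^sup>2 * (1 / al ^ (n - 1)) / ga \<le> 1"
    by (metis times_divide_eq_right mult.assoc)
  then show ?thesis using al ga by (simp add: field_simps)
qed

lemma orthogonal_split:
  assumes "x \<in> carrier_vec n" "scalar_prod x x = (1::real)" "a \<in> carrier_vec n"
  obtains y where "y \<in> carrier_vec n" "a = scalar_prod x a \<cdot>\<^sub>v x + y"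
    "scalar_prod y y = scalar_prod a a - (scalar_prod x a)\<^sup>2" "scalar_prod x y = 0"
proof
  define y where "y = a + (- scalar_prod x a) \<cdot>\<^sub>v x"
  show "y \<in> carrier_vec n" using assms by (simp add: y_def)
  show "a = scalar_prod x a \<cdot>\<^sub>v x + y"
    using assms unfolding y_def by (intro eq_vecI) auto
  show "scalar_prod y y = scalar_prod a a - (scalar_prod x a)\<^sup>2"
    using assms comm_scalar_prod[OF assms(3,1)] unfolding y_def
    by (simp add: scalar_prod_add_distrib[of _ n] add_scalar_prod_distrib[of _ n] algebra_simps power2_eq_square)
  show "scalar_prod x y = 0"
    using assms unfolding y_def by (simp add: scalar_prod_add_distrib[of _ n])
qed

lemma scale_from_unit:
  assumes A: "inscribed A"
    and h: "\<And>x. x \<in> carrier_vec n \<Longrightarrow> scalar_prod x x = 1 \<Longrightarrow> C \<le> (f (A *\<^sub>v x))\<^sup>2"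
    and a: "a \<in> carrier_vec n"
  shows "C * scalar_prod a a \<le> (f (A *\<^sub>v a))\<^sup>2"
proof (cases "scalar_prod a a = 0")
  case False
  then have p: "scalar_prod a a > 0" using scalar_prod_self_nonneg[of a] by linarith
  define k where "k = 1 / sqrt (scalar_prod a a)"
  have k: "k * k = 1 / scalar_prod a a" using p by (simp add: k_def)
  have Ac: "A \<in> carrier_mat n n" using A by (simp add: inscribed_def)
  have "C \<le> (f (A *\<^sub>v (k \<cdot>\<^sub>v a)))\<^sup>2"
    using a p k by (intro h) (simp_all add: mult.assoc[symmetric])
  also have "\<dots> = (k * k) * (f (A *\<^sub>v a))\<^sup>2"
    using Ac a by (simp add: mult_mat_vec[of _ n n] f_hom power_mult_distrib power2_eq_square)
  finally show ?thesis using p unfolding k by (simp add: field_simps)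
qed simp

text \<open>A John-type bound with no assumption on plane sections, for the regime where the planar
  estimate is too weak. If \<open>f (A x)\<close> were very small for a unit vector
  \<open>x\<close>, stretching along \<open>x\<close> would gain volume.\<close>

theorem ellipsoid_sqrt_dim:
  obtains A where "inscribed A" "Determinant.det A \<noteq> 0"
    "\<And>a. a \<in> carrier_vec n \<Longrightarrow> scalar_prod a a \<le> 6 * (real n + 1) * (f (A *\<^sub>v a))\<^sup>2"
proof -
  obtain A where A: "inscribed A" "Determinant.det A \<noteq> 0"
    and mx: "\<And>B. inscribed B \<Longrightarrow> 3/4 * \<bar>Determinant.det B\<bar> \<le> \<bar>Determinant.det A\<bar>"
    using near_maximal_inscribed[of "3/4"] by auto
  have Ac: "A \<in> carrier_mat n n" using A by (simp add: inscribed_def)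
  have "1 / (6 * (real n + 1)) \<le> (f (A *\<^sub>v x))\<^sup>2" if x: "x \<in> carrier_vec n" "scalar_prod x x = 1" for x
  proof -
    define F where "F = f (A *\<^sub>v x)"
    have "F \<noteq> 0"
    proof
      assume "F = 0"
      then have "A *\<^sub>v x = 0\<^sub>v n" using Ac x by (intro f_eq_0) (auto simp: F_def)
      then have "x = 0\<^sub>v n" using mult_vec_eq_0 A x by blast
      then show False using x by simp
    qed
    then have F: "F > 0" using f_nonneg[of "A *\<^sub>v x"] Ac x by (simp add: F_def)
    have "(3/4)\<^sup>2 \<le> (1 + 1 / real n) ^ (n - 1) * ((1 + real n) * F\<^sup>2)"
    proof (rule near_maximal_rank_one[OF A mx _ x])
      fix a :: "real Matrix.vec" assume a: "a \<in> carrier_vec n"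
      obtain y where y: "y \<in> carrier_vec n" "a = scalar_prod x a \<cdot>\<^sub>v x + y"
        "scalar_prod y y = scalar_prod a a - (scalar_prod x a)\<^sup>2"
        using orthogonal_split[OF x a] by metis
      define c where "c = scalar_prod x a"
      define Y where "Y = f (A *\<^sub>v y)"
      have Y: "Y \<ge> 0" "Y\<^sup>2 \<le> scalar_prod a a - c\<^sup>2"
        using A y f_nonneg[of "A *\<^sub>v y"] unfolding Y_def inscribed_def c_def by auto
      have "A *\<^sub>v a = c \<cdot>\<^sub>v (A *\<^sub>v x) + A *\<^sub>v y"
        using Ac x y(1) by (subst y(2)) (simp add: c_def mult_add_distrib_mat_vec[of _ n n] mult_mat_vec[of _ n n])
      then have "f (A *\<^sub>v a) \<le> f (c \<cdot>\<^sub>v (A *\<^sub>v x)) + Y"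
        using f_add[of "c \<cdot>\<^sub>v (A *\<^sub>v x)" "A *\<^sub>v y"] Ac x y(1) by (simp add: Y_def)
      also have "\<dots> = \<bar>c\<bar> * F + Y"
        using f_hom[of "A *\<^sub>v x" c] Ac x by (simp add: F_def)
      finally have "(f (A *\<^sub>v a))\<^sup>2 \<le> (\<bar>c\<bar> * F + Y)\<^sup>2"
        using f_nonneg[of "A *\<^sub>v a"] Ac a by (intro power_mono) auto
      \<comment> \<open>Only the triangle inequality controls the cross term. The weight
        \<open>n\<close> makes the transverse factor \<open>1 + 1 / n\<close>, whose power
        \<open>n - 1\<close> stays below \<open>exp 1\<close>.\<close>
      also have "\<dots> \<le> (1 + real n) * (\<bar>c\<bar> * F)\<^sup>2 + (1 + 1 / real n) * Y\<^sup>2"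
      proof -
        have "0 \<le> (real n * (\<bar>c\<bar> * F) - Y)\<^sup>2 / real n" by simp
        also have "\<dots> = (1 + real n) * (\<bar>c\<bar> * F)\<^sup>2 + (1 + 1 / real n) * Y\<^sup>2 - (\<bar>c\<bar> * F + Y)\<^sup>2"
          using n by (simp add: power2_eq_square field_simps)
        finally show ?thesis by simp
      qed
      also have "\<dots> \<le> (1 + real n) * (\<bar>c\<bar> * F)\<^sup>2 + (1 + 1 / real n) * (scalar_prod a a - c\<^sup>2)"
        using Y by (intro add_left_mono mult_left_mono) auto
      finally show "(f (A *\<^sub>v a))\<^sup>2 \<le> (1 + 1 / real n) * scalar_prod a a
          - ((1 + 1 / real n) - (1 + real n) * F\<^sup>2) * (scalar_prod x a)\<^sup>2"
        unfolding c_def by (simp add: power_mult_distrib algebra_simps)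
    qed (use n F in \<open>auto intro!: add_pos_nonneg mult_pos_pos\<close>)
    also have "\<dots> \<le> 3 * ((1 + real n) * F\<^sup>2)"
    proof (rule mult_right_mono)
      have "(1 + 1 / real n) ^ (n - 1) \<le> (1 + 1 / real n) ^ n"
        by (intro power_increasing) auto
      also have "\<dots> \<le> exp (1 / real n) ^ n"
        using exp_ge_add_one_self[of "1 / real n"] by (intro power_mono) auto
      also have "\<dots> = exp 1" using n by (simp add: exp_of_nat_mult[symmetric])
      also have "\<dots> \<le> 3" by (rule exp_le)
      finally show "(1 + 1 / real n) ^ (n - 1) \<le> 3" .
    qed simp
    finally show ?thesis by (simp add: F_def field_simps power2_eq_square)
  qed
  from scale_from_unit[OF A(1) this]
  have "1 / (6 * (real n + 1)) * scalar_prod a a \<le> (f (A *\<^sub>v a))\<^sup>2" if "a \<in> carrier_vec n" for a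
    using that by blast
  then show thesis using A by (intro that[of A]) (auto simp: field_simps)
qed

text \<open>The form is evaluated at \<open>(sqrt k * c, - t / sqrt k)\<close>: a weighted
  arithmetic-geometric inequality for the cross term, with the weight \<open>k\<close> left
  free.\<close>

lemma two_mult_le_of_form_nonneg:
  fixes P B R :: real
  assumes "\<And>c t. 0 \<le> P * c\<^sup>2 + 2 * B * c * t + R * t\<^sup>2" and k: "k > 0"
  shows "2 * B * c * t \<le> P * k * c\<^sup>2 + R / k * t\<^sup>2"
proof -
  have "0 \<le> P * (sqrt k * c)\<^sup>2 + 2 * B * (sqrt k * c) * (- t / sqrt k) + R * (- t / sqrt k)\<^sup>2"
    by (rule assms)
  also have "\<dots> = P * k * c\<^sup>2 - 2 * B * c * t + R / k * t\<^sup>2"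
    using k by (simp add: power_mult_distrib power_divide)
  finally show ?thesis by simp
qed

text \<open>
  The direction with coefficient \<open>P\<close> almost minimizes the form, so the cross term \<open>B\<close> has size
  of order \<open>sqrt eta\<close> only; splitting it unevenly between the two squares costs \<open>O(eta)\<close> in the
  second coefficient and a fixed fraction of \<open>1 - mu\<close> in the first.
\<close>

lemma form_le_diagonal:
  fixes P B R mu eta w :: real
  assumes eta: "0 < eta" "eta \<le> 1/48" and mu: "0 \<le> mu" "mu \<le> 1" and w: "w > 0"
    and P: "(1 - eta) * P \<le> mu + eta" and R: "(1 - eta) * R \<le> w"
    and lo: "\<And>c t. mu * (c\<^sup>2 + w * t\<^sup>2) \<le> (1 + eta) * quad P B R c t"
  shows "(1 + eta) * quad P B R c t
    \<le> ((1 + mu) / 2 + 6 * eta) * c\<^sup>2 + (1 + 12 * eta) * (w * t\<^sup>2)"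
proof -
  have ee: "eta * eta \<le> eta / 48" using mult_left_mono[of eta "1/48" eta] eta by simp
  have em: "eta * mu \<le> eta" "0 \<le> eta * mu" using mult_left_mono[of mu 1 eta] eta mu by auto
  have "(1 - eta) * (mu + 3 * eta) = mu + 3 * eta - eta * mu - 3 * (eta * eta)" by (simp add: algebra_simps)
  then have "(1 - eta) * P \<le> (1 - eta) * (mu + 3 * eta)" using P ee em eta by linarith
  then have P3: "P \<le> mu + 3 * eta" using eta by (simp add: mult_le_cancel_left)
  have "(1 - eta) * (1 + 2 * eta) = 1 + eta - 2 * (eta * eta)" by (simp add: algebra_simps)
  then have "1 \<le> (1 - eta) * (1 + 2 * eta)" using ee eta by linarith
  then have "w \<le> (1 - eta) * (1 + 2 * eta) * w" using w by (simp add: mult_le_cancel_right)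
  then have "(1 - eta) * R \<le> (1 - eta) * ((1 + 2 * eta) * w)" using R by (simp add: mult.assoc)
  then have R3: "R \<le> (1 + 2 * eta) * w" using eta by (simp add: mult_le_cancel_left)
  \<comment> \<open>Since \<open>mu\<close> bounds the form from below, it stays nonnegative after
    \<open>mu - eta\<close> times the Euclidean form is removed. Its first coefficient is then at
    most \<open>4 * eta\<close>, which is what makes the cross term small.\<close>
  have low: "0 \<le> (P - (mu - eta)) * c\<^sup>2 + 2 * B * c * t + (R - (mu - eta) * w) * t\<^sup>2" for c t
  proof -
    have "(1 + eta) * (mu - eta) \<le> mu"
    proof -
      have "(1 + eta) * (mu - eta) = mu - eta + eta * mu - eta * eta" by (simp add: algebra_simps)
      then show ?thesis using em(1) zero_le_square[of eta] by linarith
    qed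
    then have "(1 + eta) * (mu - eta) * (c\<^sup>2 + w * t\<^sup>2) \<le> mu * (c\<^sup>2 + w * t\<^sup>2)"
      using w by (intro mult_right_mono) auto
    also note lo[of c t]
    finally have "(1 + eta) * ((mu - eta) * (c\<^sup>2 + w * t\<^sup>2)) \<le> (1 + eta) * quad P B R c t"
      by (simp only: mult.assoc)
    then have "(mu - eta) * (c\<^sup>2 + w * t\<^sup>2) \<le> P * c\<^sup>2 + 2 * B * c * t + R * t\<^sup>2"
      using eta by (simp add: mult_le_cancel_left)
    then show ?thesis by (simp add: algebra_simps)
  qed
  define g where "g = 1 - mu + 3 * eta"
  have g: "g > 0" using mu eta by (simp add: g_def)
  \<comment> \<open>The weight \<open>g / (8 * eta)\<close> turns the coefficient bound
    \<open>4 * eta\<close> into \<open>g / 2\<close> and the bound \<open>g * w\<close> into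
    \<open>8 * eta * w\<close>.\<close>
  have "2 * B * c * t \<le> (P - (mu - eta)) * (g / (8 * eta)) * c\<^sup>2 + (R - (mu - eta) * w) / (g / (8 * eta)) * t\<^sup>2"
    using g eta by (intro two_mult_le_of_form_nonneg low) auto
  also have "\<dots> \<le> (g / 2) * c\<^sup>2 + (8 * eta * w) * t\<^sup>2"
  proof (intro add_mono mult_right_mono)
    have "(P - (mu - eta)) * (g / (8 * eta)) \<le> 4 * eta * (g / (8 * eta))"
      using P3 g eta by (intro mult_right_mono) auto
    then show "(P - (mu - eta)) * (g / (8 * eta)) \<le> g / 2" using eta by simp
    have "R - (mu - eta) * w \<le> g * w" using R3 by (simp add: g_def algebra_simps)
    then have "(R - (mu - eta) * w) / (g / (8 * eta)) \<le> g * w / (g / (8 * eta))"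
      using g eta by (intro divide_right_mono) auto
    then show "(R - (mu - eta) * w) / (g / (8 * eta)) \<le> 8 * eta * w" using g by (simp add: mult_ac)
  qed auto
  finally have "P * c\<^sup>2 + 2 * B * c * t + R * t\<^sup>2 \<le> (mu + 3 * eta) * c\<^sup>2 + ((g / 2) * c\<^sup>2 + (8 * eta * w) * t\<^sup>2) + ((1 + 2 * eta) * w) * t\<^sup>2"
    using mult_right_mono[OF P3, of "c\<^sup>2"] mult_right_mono[OF R3, of "t\<^sup>2"] by (simp add: algebra_simps)
  also have "\<dots> = ((1 + mu) / 2 + 9/2 * eta) * c\<^sup>2 + (1 + 10 * eta) * (w * t\<^sup>2)"
    by (simp add: g_def field_simps)
  finally have "(1 + eta) * quad P B R c t
    \<le> (1 + eta) * (((1 + mu) / 2 + 9/2 * eta) * c\<^sup>2 + (1 + 10 * eta) * (w * t\<^sup>2))"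
    using eta by (intro mult_left_mono) auto
  also have "\<dots> = ((1 + eta) * ((1 + mu) / 2 + 9/2 * eta)) * c\<^sup>2 + ((1 + eta) * (1 + 10 * eta)) * (w * t\<^sup>2)"
    by (subst distrib_left) (simp only: mult.assoc)
  also have "\<dots> \<le> ((1 + mu) / 2 + 6 * eta) * c\<^sup>2 + (1 + 12 * eta) * (w * t\<^sup>2)"
  proof (intro add_mono mult_right_mono)
    have "(1 + eta) * ((1 + mu) / 2 + 9/2 * eta) = (1 + mu) / 2 + 5 * eta + eta * mu / 2 + 9/2 * (eta * eta)"
      by (simp add: field_simps)
    then show "(1 + eta) * ((1 + mu) / 2 + 9/2 * eta) \<le> (1 + mu) / 2 + 6 * eta"
      using ee em(1) eta(1) by linarith
    have "(1 + eta) * (1 + 10 * eta) = 1 + 11 * eta + 10 * (eta * eta)" by (simp add: algebra_simps)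
    then show "(1 + eta) * (1 + 10 * eta) \<le> 1 + 12 * eta" using ee eta(1) by linarith
  qed (use w in auto)
  finally show ?thesis .
qed

text \<open>With \<open>mu\<close> the infimum of \<open>(f (A x))^2\<close> over unit vectors and
  \<open>x\<close> almost attaining it, each vector lies in a plane through \<open>x\<close>, where
  the norm is nearly quadratic. This bounds the norm by the diagonal form with
  \<open>ga = (1 + mu) / 2 + 6 * eta\<close> along \<open>x\<close> and \<open>1 + 12 * eta\<close>
  across. For \<open>mu\<close> well below 1 the rank-one stretch would beat
  near-maximality.\<close>

theorem ellipsoid_of_planar_closeness:
  assumes eta: "0 < eta" "24 * real n * eta \<le> 1/2"
    and planes: "\<And>u v. u \<in> carrier_vec n \<Longrightarrow> v \<in> carrier_vec n \<Longrightarrow>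
      (\<And>s t. f (s \<cdot>\<^sub>v u + t \<cdot>\<^sub>v v) = 0 \<Longrightarrow> s = 0 \<and> t = 0) \<Longrightarrow>
      \<exists>P B R. \<forall>s t. (1 - eta) * quad P B R s t \<le> (f (s \<cdot>\<^sub>v u + t \<cdot>\<^sub>v v))\<^sup>2 \<and>
         (f (s \<cdot>\<^sub>v u + t \<cdot>\<^sub>v v))\<^sup>2 \<le> (1 + eta) * quad P B R s t"
  obtains A where "inscribed A" "Determinant.det A \<noteq> 0"
    "\<And>a. a \<in> carrier_vec n \<Longrightarrow> (1 - 24 * real n * eta) * scalar_prod a a \<le> (f (A *\<^sub>v a))\<^sup>2"
proof -
  have eta1: "eta \<le> 1/48"
  proof -
    have "1 * (24 * eta) \<le> real n * (24 * eta)" using n eta by (intro mult_right_mono) auto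
    then show ?thesis using eta by linarith
  qed
  obtain A where A: "inscribed A" "Determinant.det A \<noteq> 0"
    and mx: "\<And>B. inscribed B \<Longrightarrow> (1 - eta) * \<bar>Determinant.det B\<bar> \<le> \<bar>Determinant.det A\<bar>"
    using near_maximal_inscribed[of "1 - eta"] eta eta1 by auto
  have Ac: "A \<in> carrier_mat n n" using A by (simp add: inscribed_def)
  define S where "S = (\<lambda>x. (f (A *\<^sub>v x))\<^sup>2) ` {x \<in> carrier_vec n. scalar_prod x x = 1}"
  have "unit_vec n 0 \<in> {x \<in> carrier_vec n. scalar_prod x x = (1::real)}" using n by simp
  then have S: "S \<noteq> {}" "bdd_below S" unfolding S_def by (blast, auto intro!: bdd_belowI[of _ 0])
  define mu where "mu = Inf S"
  have mu_le: "mu \<le> (f (A *\<^sub>v x))\<^sup>2" if "x \<in> carrier_vec n" "scalar_prod x x = 1" for x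
    unfolding mu_def using that by (intro cInf_lower S) (auto simp: S_def)
  have mu_scaled: "mu * scalar_prod a a \<le> (f (A *\<^sub>v a))\<^sup>2" if "a \<in> carrier_vec n" for a
    using scale_from_unit[OF A(1) mu_le that] .
  have mu0: "mu \<ge> 0" unfolding mu_def using S by (intro cInf_greatest) (auto simp: S_def)
  have "Inf S < mu + eta" using eta by (simp add: mu_def)
  then obtain x where x: "x \<in> carrier_vec n" "scalar_prod x x = 1" and fx: "(f (A *\<^sub>v x))\<^sup>2 < mu + eta"
    using cInf_less_iff[OF S, of "mu + eta"] by (auto simp: S_def)
  have mu1: "mu \<le> 1" using mu_le[OF x] A x unfolding inscribed_def by fastforce
  define ga where "ga = (1 + mu) / 2 + 6 * eta"
  have ga0: "ga > 0" using eta(1) mu0 unfolding ga_def by argo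
  have vol: "(1 - eta)\<^sup>2 \<le> (1 + 12 * eta) ^ (n - 1) * ga"
  proof (rule near_maximal_rank_one[OF A mx _ x])
    fix a :: "real Matrix.vec" assume a: "a \<in> carrier_vec n"
    obtain y where y: "y \<in> carrier_vec n" "a = scalar_prod x a \<cdot>\<^sub>v x + y"
      "scalar_prod y y = scalar_prod a a - (scalar_prod x a)\<^sup>2" "scalar_prod x y = 0"
      using orthogonal_split[OF x a] by metis
    define c where "c = scalar_prod x a"
    have comb: "A *\<^sub>v (s \<cdot>\<^sub>v x + t \<cdot>\<^sub>v y) = s \<cdot>\<^sub>v (A *\<^sub>v x) + t \<cdot>\<^sub>v (A *\<^sub>v y)" for s t
      using Ac x y(1) by (simp add: mult_add_distrib_mat_vec[of _ n n] mult_mat_vec[of _ n n])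
    have sq: "scalar_prod (s \<cdot>\<^sub>v x + t \<cdot>\<^sub>v y) (s \<cdot>\<^sub>v x + t \<cdot>\<^sub>v y) = s\<^sup>2 + scalar_prod y y * t\<^sup>2" for s t
      using x y(1,4) comm_scalar_prod[OF x(1) y(1)]
      by (simp add: scalar_prod_add_distrib[of _ n] add_scalar_prod_distrib[of _ n] algebra_simps power2_eq_square)
    have ca: "A *\<^sub>v a = c \<cdot>\<^sub>v (A *\<^sub>v x) + 1 \<cdot>\<^sub>v (A *\<^sub>v y)"
      using comb[of c 1] y(1,2) by (simp add: c_def)
    have "(f (A *\<^sub>v a))\<^sup>2 \<le> ga * c\<^sup>2 + (1 + 12 * eta) * scalar_prod y y"
    \<comment> \<open>In the degenerate case \<open>a\<close> is a multiple of \<open>x\<close> and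
      spans no plane with it; the choice of \<open>x\<close> bounds the norm directly.\<close>
    proof (cases "scalar_prod y y = 0")
      case True
      have "(f (A *\<^sub>v y))\<^sup>2 \<le> 0" using A y(1) True unfolding inscribed_def by fastforce
      then have "A *\<^sub>v y = 0\<^sub>v n" using Ac y(1) by (intro f_eq_0) auto
      then have "f (A *\<^sub>v a) = \<bar>c\<bar> * f (A *\<^sub>v x)"
        using ca Ac x by (simp add: f_hom)
      then have "(f (A *\<^sub>v a))\<^sup>2 = (f (A *\<^sub>v x))\<^sup>2 * c\<^sup>2" by (simp add: power_mult_distrib)
      also have "(f (A *\<^sub>v x))\<^sup>2 \<le> ga" unfolding ga_def using fx mu1 eta(1) by argo
      then have "(f (A *\<^sub>v x))\<^sup>2 * c\<^sup>2 \<le> ga * c\<^sup>2" by (intro mult_right_mono) auto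
      finally show ?thesis using True by simp
    next
      case False
      then have w: "scalar_prod y y > 0" using scalar_prod_self_nonneg[of y] by linarith
      obtain P B R where q: "\<And>s t. (1 - eta) * quad P B R s t
            \<le> (f (s \<cdot>\<^sub>v (A *\<^sub>v x) + t \<cdot>\<^sub>v (A *\<^sub>v y)))\<^sup>2"
         "\<And>s t. (f (s \<cdot>\<^sub>v (A *\<^sub>v x) + t \<cdot>\<^sub>v (A *\<^sub>v y)))\<^sup>2 \<le> (1 + eta) * quad P B R s t"
      proof -
        have "\<exists>P B R. \<forall>s t. (1 - eta) * quad P B R s t
            \<le> (f (s \<cdot>\<^sub>v (A *\<^sub>v x) + t \<cdot>\<^sub>v (A *\<^sub>v y)))\<^sup>2 \<and>
         (f (s \<cdot>\<^sub>v (A *\<^sub>v x) + t \<cdot>\<^sub>v (A *\<^sub>v y)))\<^sup>2 \<le> (1 + eta) * quad P B R s t"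
        proof (rule planes)
          fix s t assume "f (s \<cdot>\<^sub>v (A *\<^sub>v x) + t \<cdot>\<^sub>v (A *\<^sub>v y)) = 0"
          then have "A *\<^sub>v (s \<cdot>\<^sub>v x + t \<cdot>\<^sub>v y) = 0\<^sub>v n"
            unfolding comb using Ac x y by (intro f_eq_0) auto
          then have "s \<cdot>\<^sub>v x + t \<cdot>\<^sub>v y = 0\<^sub>v n"
            using mult_vec_eq_0[OF A] x y by simp
          then have "s\<^sup>2 + scalar_prod y y * t\<^sup>2 = 0" using sq[of s t] by simp
          then show "s = 0 \<and> t = 0" using w
            by (metis add_nonneg_eq_0_iff mult_eq_0_iff mult_nonneg_nonneg less_imp_le zero_le_power2 zero_eq_power2 less_irrefl)
        qed (use Ac x y in auto)
        then show thesis using that by blast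
      qed
      have fq: "(f (A *\<^sub>v (s \<cdot>\<^sub>v x + t \<cdot>\<^sub>v y)))\<^sup>2 \<le> (1 + eta) * quad P B R s t" for s t
        unfolding comb by (rule q)
      have "(1 + eta) * quad P B R c 1
         \<le> ((1 + mu) / 2 + 6 * eta) * c\<^sup>2 + (1 + 12 * eta) * (scalar_prod y y * 1\<^sup>2)"
      proof (rule form_le_diagonal[OF eta(1) eta1 mu0 mu1 w])
        have "1 \<cdot>\<^sub>v (A *\<^sub>v x) + 0 \<cdot>\<^sub>v (A *\<^sub>v y) = A *\<^sub>v x"
          using Ac x y(1) by (intro eq_vecI) auto
        then show "(1 - eta) * P \<le> mu + eta" using q(1)[of 1 0] fx by simp
        have "0 \<cdot>\<^sub>v (A *\<^sub>v x) + 1 \<cdot>\<^sub>v (A *\<^sub>v y) = A *\<^sub>v y"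
          using Ac x y(1) by (intro eq_vecI) auto
        moreover have "(f (A *\<^sub>v y))\<^sup>2 \<le> scalar_prod y y"
          using A y(1) unfolding inscribed_def by blast
        ultimately show "(1 - eta) * R \<le> scalar_prod y y" using q(1)[of 0 1] by simp
        fix s t
        have "mu * (s\<^sup>2 + scalar_prod y y * t\<^sup>2) \<le> (f (A *\<^sub>v (s \<cdot>\<^sub>v x + t \<cdot>\<^sub>v y)))\<^sup>2"
          using mu_scaled[of "s \<cdot>\<^sub>v x + t \<cdot>\<^sub>v y"] x y(1) unfolding sq by simp
        with fq show "mu * (s\<^sup>2 + scalar_prod y y * t\<^sup>2) \<le> (1 + eta) * quad P B R s t"
          by (rule order_trans[rotated])
      qed
      then show ?thesis using q(2)[of c 1] unfolding ca ga_def by simp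
    qed
    then show "(f (A *\<^sub>v a))\<^sup>2 \<le> (1 + 12 * eta) * scalar_prod a a - ((1 + 12 * eta) - ga) * (scalar_prod x a)\<^sup>2"
      unfolding y(3) c_def by (simp add: algebra_simps)
  qed (use eta eta1 ga0 in auto)
  \<comment> \<open>The power is moved to the other side by Bernoulli's inequality for
    \<open>(1 - 12 * eta) ^ (n - 1)\<close>; this is where the loss becomes linear in
    \<open>n\<close>.\<close>
  have bern: "(1 + 12 * eta) ^ (n - 1) * (1 - 12 * eta * real (n - 1)) \<le> 1"
  proof -
    have "(1 + 12 * eta) ^ (n - 1) * (1 - 12 * eta * real (n - 1)) \<le> (1 + 12 * eta) ^ (n - 1) * (1 - 12 * eta) ^ (n - 1)"
      using Bernoulli_inequality[of "- (12 * eta)" "n - 1"] eta eta1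
      by (intro mult_left_mono) (auto simp: mult_ac)
    also have "\<dots> = (1 - (12 * eta)\<^sup>2) ^ (n - 1)"
      by (simp add: power_mult_distrib[symmetric] algebra_simps power2_eq_square)
    also have "\<dots> \<le> 1"
    proof (rule power_le_one)
      have "12 * eta \<le> 1" using eta1 by simp
      then show "0 \<le> 1 - (12 * eta)\<^sup>2" using power_le_one[of "12 * eta" 2] eta by simp
    qed simp
    finally show ?thesis .
  qed
  have rn: "real (n - 1) = real n - 1" using n by (simp add: of_nat_diff)
  have pos: "0 \<le> 1 - 12 * eta * real (n - 1)"
    using eta unfolding rn by (simp add: algebra_simps)
  have "(1 - eta)\<^sup>2 * (1 - 12 * eta * real (n - 1)) \<le> ga"
  proof -
    have "(1 - eta)\<^sup>2 * (1 - 12 * eta * real (n - 1)) \<le> (1 + 12 * eta) ^ (n - 1) * ga * (1 - 12 * eta * real (n - 1))"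
      using vol pos by (intro mult_right_mono) auto
    also have "\<dots> = ga * ((1 + 12 * eta) ^ (n - 1) * (1 - 12 * eta * real (n - 1)))" by simp
    also have "\<dots> \<le> ga * 1"
      using bern eta mu0 by (intro mult_left_mono) (auto simp: ga_def)
    finally show ?thesis by simp
  qed
  moreover have "(1 - eta)\<^sup>2 * (1 - 12 * eta * real (n - 1)) \<ge> (1 - 2 * eta) * (1 - 12 * eta * real (n - 1))"
    using pos by (intro mult_right_mono) (auto simp: power2_eq_square algebra_simps)
  moreover have "(1 - 2 * eta) * (1 - 12 * eta * real (n - 1)) \<ge> 1 - 12 * eta * real (n - 1) - 2 * eta"
  proof -
    have "0 \<le> 2 * eta * (12 * eta * real (n - 1))" using eta by (intro mult_nonneg_nonneg) auto
    then show ?thesis by (simp add: algebra_simps)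
  qed
  ultimately have "1 - 12 * eta * real (n - 1) - 2 * eta \<le> ga" by linarith
  moreover define z where "z = real n * eta"
  moreover have "12 * eta * real (n - 1) = 12 * z - 12 * eta"
    unfolding rn z_def by (simp add: algebra_simps)
  \<comment> \<open>The inequality reads \<open>1 - 12 * z + 4 * eta \<le> (1 + mu) / 2\<close>;
    doubling it gives the constant 24.\<close>
  ultimately have "1 - 24 * z \<le> mu"
    using eta(1) unfolding ga_def by argo
  then have "mu \<ge> 1 - 24 * real n * eta" by (simp add: z_def mult.assoc)
  then have "(1 - 24 * real n * eta) * scalar_prod a a \<le> (f (A *\<^sub>v a))\<^sup>2" if "a \<in> carrier_vec n" for a
    using mult_right_mono[OF _ scalar_prod_self_nonneg[of a]] mu_scaled[OF that] by (meson order_trans)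
  then show thesis using A by (intro that[of A])
qed

end

section \<open>Norms on the plane and integrals over the circle\<close>

text \<open>Norms are plain functions, so that the many sections of one body can all live on the
  single type \<open>complex\<close>.\<close>

definition rnorm :: "('a::euclidean_space \<Rightarrow> real) \<Rightarrow> bool" where
  "rnorm g \<longleftrightarrow> (\<forall>x. g x \<ge> 0) \<and> (\<forall>x. g x = 0 \<longrightarrow> x = 0) \<and>
     (\<forall>r x. g (r *\<^sub>R x) = \<bar>r\<bar> * g x) \<and> (\<forall>x y. g (x + y) \<le> g x + g y)"

lemma rnormD:
  assumes "rnorm g"
  shows "g x \<ge> 0" "g x = 0 \<Longrightarrow> x = 0" "g (r *\<^sub>R x) = \<bar>r\<bar> * g x" "g (x + y) \<le> g x + g y"
  using assms unfolding rnorm_def by blast+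

lemma rnorm_zero: "rnorm g \<Longrightarrow> g 0 = 0"
  using rnormD(3)[of g 0 0] by simp

lemma rnorm_minus: "rnorm g \<Longrightarrow> g (- x) = g x"
  using rnormD(3)[of g "-1" x] by simp

lemma rnorm_pos: "rnorm g \<Longrightarrow> x \<noteq> 0 \<Longrightarrow> g x > 0"
  using rnormD(1,2)[of g x] by force

lemma rnorm_diff:
  assumes "rnorm g" shows "\<bar>g x - g y\<bar> \<le> g (x - y)"
  using rnormD(4)[OF assms, of "x - y" y] rnormD(4)[OF assms, of "y - x" x]
    rnorm_minus[OF assms, of "x - y"] by simp

lemma rnorm_upper:
  assumes "rnorm g"
  obtains M where "M > 0" "\<And>x. g x \<le> M * norm x"
proof
  define M where "M = (\<Sum>b\<in>Basis. g b) + 1"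
  have "(\<Sum>b\<in>Basis. g b) \<ge> 0" using rnormD(1)[OF assms] by (simp add: sum_nonneg)
  then show "M > 0" by (simp add: M_def)
  fix x
  have *: "g (\<Sum>b\<in>S. (x \<bullet> b) *\<^sub>R b) \<le> (\<Sum>b\<in>S. norm x * g b)" if "finite S" "S \<subseteq> Basis" for S
    using that
  proof (induction S rule: finite_induct)
    case empty
    then show ?case by (simp add: rnorm_zero[OF assms])
  next
    case (insert b S)
    have "g ((x \<bullet> b) *\<^sub>R b) \<le> norm x * g b"
      using insert.prems rnormD(1)[OF assms, of b]
      by (simp add: rnormD(3)[OF assms] mult_right_mono Basis_le_norm)
    then show ?case
      using insert rnormD(4)[OF assms, of "(x \<bullet> b) *\<^sub>R b" "\<Sum>b\<in>S. (x \<bullet> b) *\<^sub>R b"] by simp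
  qed
  have "g x \<le> (\<Sum>b\<in>Basis. norm x * g b)"
    using *[of Basis] by (simp add: euclidean_representation)
  also have "\<dots> = norm x * (\<Sum>b\<in>Basis. g b)" by (simp add: sum_distrib_left)
  also have "\<dots> \<le> M * norm x" by (simp add: M_def algebra_simps)
  finally show "g x \<le> M * norm x" .
qed

lemma rnorm_continuous:
  assumes "rnorm g" shows "continuous_on S g"
proof -
  obtain M where M: "M > 0" "\<And>x. g x \<le> M * norm x" using rnorm_upper[OF assms] by blast
  have "M-lipschitz_on S g"
    using M rnorm_diff[OF assms] unfolding lipschitz_on_def dist_norm
    by (auto simp: real_norm_def intro: order_trans)
  then show ?thesis by (rule lipschitz_on_continuous_on)
qed

lemma rnorm_compose:
  assumes "rnorm g" "linear L" "\<And>x. L x = 0 \<Longrightarrow> x = 0"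
  shows "rnorm (\<lambda>x. g (L x))"
  using assms(3) rnormD[OF assms(1)] unfolding rnorm_def
  by (auto simp: linear_add[OF assms(2)] linear_scale[OF assms(2)])

section \<open>Unnormalized circle integrals and their invariance\<close>

definition circ :: "(complex \<Rightarrow> complex) \<Rightarrow> complex" where
  "circ F = integral {0..2*pi} (\<lambda>t. F (cis t))"

lemma continuous_on_circle:
  fixes F :: "complex \<Rightarrow> 'a::topological_space"
  assumes "continuous_on (- {0}) F"
  shows "continuous_on S (\<lambda>t. F (cis t))"
  by (rule continuous_on_compose2[OF assms continuous_on_cis]) (auto intro: continuous_intros)

lemma circ_integrable:
  fixes F :: "complex \<Rightarrow> 'a::banach"
  assumes "continuous_on (- {0}) F"
  shows "(\<lambda>t. F (cis t)) integrable_on {a..b}"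
  by (intro integrable_continuous_interval continuous_on_circle assms)

lemma integral_period:
  fixes H :: "real \<Rightarrow> complex"
  assumes H: "\<And>S. continuous_on S H" and per: "\<And>t. H (t + 2 * pi) = H t"
    and a: "0 \<le> a" "a \<le> 2 * pi"
  shows "integral {a..2*pi + a} H = integral {0..2*pi} H"
proof -
  note i = integrable_continuous_interval[OF H]
  have "integral {0..a} H = integral {0..a} (H \<circ> (\<lambda>x. x + 2 * pi))"
    by (simp add: o_def per)
  also have "\<dots> = integral {2*pi..2*pi + a} H"
    using integral_shift[OF H, where a = 0 and b = a and c = "2*pi"] by (simp add: add.commute)
  finally have "integral {0..a} H = integral {2*pi..2*pi + a} H" .
  moreover have "integral {a..2*pi} H + integral {2*pi..2*pi + a} H = integral {a..2*pi + a} H"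
    using a by (intro Henstock_Kurzweil_Integration.integral_combine i) auto
  moreover have "integral {0..a} H + integral {a..2*pi} H = integral {0..2*pi} H"
    using a by (intro Henstock_Kurzweil_Integration.integral_combine i) auto
  ultimately show ?thesis by (simp add: add.commute)
qed

lemma circ_rotate:
  assumes F: "continuous_on (- {0}) F"
  shows "circ (\<lambda>z. F (cis a * z)) = circ F"
proof -
  define b where "b = Arg2pi (cis a)"
  have b: "0 \<le> b" "b \<le> 2 * pi" "cis b = cis a"
    using Arg2pi[of "cis a"] by (auto simp: b_def is_Arg_def cis_conv_exp)
  have "circ (\<lambda>z. F (cis a * z)) = integral {0..2*pi} ((\<lambda>t. F (cis t)) \<circ> (\<lambda>t. t + b))"
    unfolding circ_def by (simp add: o_def cis_mult[symmetric] b(3) mult.commute)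
  also have "\<dots> = integral {b..2*pi + b} (\<lambda>t. F (cis t))"
    using integral_shift[OF continuous_on_circle[OF F], where a = 0 and c = b and b = "2*pi"] by simp
  also have "\<dots> = circ F"
    unfolding circ_def using b
    by (intro integral_period continuous_on_circle F) (auto simp: cis_mult[symmetric])
  finally show ?thesis .
qed

lemma circ_cnj_arg:
  assumes F: "continuous_on (- {0}) F"
  shows "circ (\<lambda>z. F (cnj z)) = circ F"
proof -
  have cis_per: "cis (t + - (2 * pi)) = cis t" for t
    by (simp add: complex_eq_iff cos_diff sin_diff)
  have "circ (\<lambda>z. F (cnj z)) = integral {- (2 * pi).. - 0} (\<lambda>t. F (cis t))"
    unfolding circ_def using Henstock_Kurzweil_Integration.integral_reflect_real[of "2*pi" 0 "\<lambda>t. F (cnj (cis t))"] by (simp add: cis_cnj)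
  also have "\<dots> = integral {0 - 2 * pi..2 * pi - 2 * pi} (\<lambda>t. F (cis t))" by simp
  also have "\<dots> = integral {0..2*pi} ((\<lambda>t. F (cis t)) \<circ> (\<lambda>t. t + (- (2 * pi))))"
    using integral_shift[OF continuous_on_circle[OF F], where a = 0 and c = "- (2*pi)" and b = "2*pi"] by simp
  also have "\<dots> = circ F"
    unfolding circ_def using cis_per by (simp add: o_def)
  finally show ?thesis .
qed

lemma circ_cong: "(\<And>z. norm z = 1 \<Longrightarrow> F z = G z) \<Longrightarrow> circ F = circ G"
  unfolding circ_def by (intro integral_cong) auto

lemma circ_mult: "circ (\<lambda>z. c * F z) = c * circ F"
  unfolding circ_def by (rule integral_mult_right)

lemma circ_add:
  assumes "continuous_on (- {0}) F" "continuous_on (- {0}) G"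
  shows "circ (\<lambda>z. F z + G z) = circ F + circ G"
  unfolding circ_def by (intro integral_add circ_integrable assms)

lemma circ_cnj: "circ (\<lambda>z. cnj (F z)) = cnj (circ F)"
  unfolding circ_def by (rule integral_cnj[symmetric])

lemma norm_circ_le:
  assumes F: "continuous_on (- {0}) F" and G: "continuous_on (- {0}) G"
    and le: "\<And>z. norm z = 1 \<Longrightarrow> norm (F z) \<le> G z"
  shows "norm (circ F) \<le> integral {0..2*pi} (\<lambda>t. G (cis t))"
  unfolding circ_def by (intro integral_norm_bound_integral circ_integrable F G) (auto intro: le)

text \<open>
  If \<open>z + q cnj z = r cis b\<close> for \<open>z = cis t\<close>, then \<open>db/dt = (1 - |q|^2) / r^2\<close>: the factor
  \<open>1 / r^2\<close> is absorbed by the homogeneity of \<open>h\<close>.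
\<close>

lemma circ_change_of_variables:
  assumes h: "continuous_on (- {0}) h"
    and hom: "\<And>r z. r > 0 \<Longrightarrow> z \<noteq> 0 \<Longrightarrow> h (of_real r * z) = h z / of_real (r\<^sup>2)"
    and q: "norm q < 1"
  shows "of_real (1 - (norm q)\<^sup>2) * circ (\<lambda>z. h (z + q * cnj z)) = circ h"
proof -
  \<comment> \<open>For \<open>z = cis t\<close>, \<open>z + q * cnj z = z * (1 + w t)\<close>, and
    \<open>1 + w t\<close> stays in the right half-plane because \<open>norm q < 1\<close>. The
    principal logarithm therefore gives a differentiable choice \<open>b\<close> of the
    angle.\<close>
  define w where "w t = q * cis (- 2 * t)" for t
  have nw: "norm (w t) = norm q" for t by (simp add: w_def norm_mult)
  have Re_pos: "Re (1 + w t) > 0" for t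
    using abs_Re_le_cmod[of "w t"] q nw[of t] by simp
  then have nz: "1 + w t \<noteq> 0" for t by (metis less_irrefl zero_complex.simps(1))
  define b where "b t = t + Im (Ln (1 + w t))" for t
  define b' where "b' t = (1 - (norm q)\<^sup>2) / (norm (1 + w t))\<^sup>2" for t
  have w': "(w has_vector_derivative (- 2 * \<i> * w t)) (at t within S)" for t S
  proof -
    have w_exp: "w t = q * exp (t *\<^sub>R (- 2 * \<i>))" for t
      by (simp add: w_def cis_conv_exp scaleR_conv_of_real mult_ac)
    have "((\<lambda>t. exp (t *\<^sub>R (- 2 * \<i>))) has_vector_derivative exp (t *\<^sub>R (- 2 * \<i>)) * (- 2 * \<i>)) (at t within S)"
      by (rule exp_scaleR_has_vector_derivative_right)
    from has_vector_derivative_mult_right[OF this, of q] show ?thesis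
      unfolding w_exp by (simp add: mult_ac)
  qed
  have b_deriv: "(b has_real_derivative b' t) (at t within S)" for t S
  proof -
    have "1 + w t \<notin> \<real>\<^sub>\<le>\<^sub>0" using Re_pos[of t] by (auto simp: complex_nonpos_Reals_iff)
    then have L: "((\<lambda>t. Ln (1 + w t)) has_vector_derivative ((- 2 * \<i> * w t) * (1 / (1 + w t)))) (at t within S)"
    proof -
      have "((\<lambda>t. 1 + w t) has_vector_derivative (- 2 * \<i> * w t)) (at t within S)"
        using has_vector_derivative_add[OF has_vector_derivative_const w', of 1 t S] by simp
      moreover have "(Ln has_field_derivative 1 / (1 + w t)) (at (1 + w t) within (\<lambda>t. 1 + w t) ` S)"
        using has_field_derivative_at_within[OF has_field_derivative_Ln[OF \<open>1 + w t \<notin> \<real>\<^sub>\<le>\<^sub>0\<close>]]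
        by (simp add: inverse_eq_divide)
      ultimately have "(Ln \<circ> (\<lambda>t. 1 + w t) has_vector_derivative (- 2 * \<i> * w t) * (1 / (1 + w t))) (at t within S)"
        by (rule field_vector_diff_chain_within)
      then show ?thesis by (simp add: o_def)
    qed
    have "((\<lambda>t. Im (Ln (1 + w t))) has_vector_derivative Im ((- 2 * \<i> * w t) * (1 / (1 + w t)))) (at t within S)"
      by (rule bounded_linear.has_vector_derivative[OF bounded_linear_Im L])
    then have "(b has_real_derivative (1 + Im ((- 2 * \<i> * w t) * (1 / (1 + w t))))) (at t within S)"
      unfolding b_def has_real_derivative_iff_has_vector_derivative
      by (auto intro!: derivative_eq_intros)
    moreover have "1 + Im ((- 2 * \<i> * w t) * (1 / (1 + w t))) = b' t"
    proof -
      define x y where "x = Re (w t)" and "y = Im (w t)"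
      have q2: "(norm q)\<^sup>2 = x\<^sup>2 + y\<^sup>2" unfolding nw[of t, symmetric] x_def y_def by (rule cmod_power2)
      have n2: "(norm (1 + w t))\<^sup>2 = (1 + x)\<^sup>2 + y\<^sup>2" unfolding cmod_power2 x_def y_def by simp
      have nz2: "(1 + x)\<^sup>2 + y\<^sup>2 \<noteq> 0" using nz[of t] unfolding n2[symmetric] by simp
      have "Im ((- 2 * \<i> * w t) * (1 / (1 + w t))) = Im ((- 2 * \<i> * w t) / (1 + w t))" by simp
      also have "\<dots> = (- 2 * x * (1 + x) - 2 * y * y) / ((1 + x)\<^sup>2 + y\<^sup>2)"
        unfolding Im_divide by (simp add: x_def y_def)
      finally have "1 + Im ((- 2 * \<i> * w t) * (1 / (1 + w t)))
          = ((1 + x)\<^sup>2 + y\<^sup>2 + (- 2 * x * (1 + x) - 2 * y * y)) / ((1 + x)\<^sup>2 + y\<^sup>2)"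
        using nz2 by (simp only: add_divide_distrib[of "(1 + x)\<^sup>2 + y\<^sup>2"] divide_self not_False_eq_True if_False)
      also have "(1 + x)\<^sup>2 + y\<^sup>2 + (- 2 * x * (1 + x) - 2 * y * y) = 1 - (x\<^sup>2 + y\<^sup>2)"
        by (simp add: power2_eq_square algebra_simps)
      finally show ?thesis unfolding b'_def q2 n2 .
    qed
    ultimately show ?thesis by simp
  qed
  have b'_pos: "b' t > 0" for t
    using nz[of t] q abs_square_less_1[of "norm q"] by (simp add: b'_def)
  have mono: "b s \<le> b t" if "s \<le> t" for s t
    using that by (intro DERIV_nonneg_imp_nondecreasing[of s t b]) (use b_deriv[where S = UNIV] b'_pos less_imp_le in blast)+
  have cisb: "of_real (norm (1 + w t)) * cis (b t) = cis t + q * cnj (cis t)" for t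
  proof -
    have "of_real (norm (1 + w t)) * cis (Im (Ln (1 + w t))) = 1 + w t"
      using nz[of t] by (simp add: Arg_eq_Im_Ln[symmetric] rcis_cmod_Arg flip: rcis_def)
    then have "of_real (norm (1 + w t)) * cis (b t) = cis t * (1 + w t)"
      unfolding b_def cis_mult[symmetric] by (simp only: mult.left_commute[of _ "cis t"])
    also have "\<dots> = cis t + q * (cis t * cis (- 2 * t))"
      by (simp add: w_def distrib_left)
    also have "cis t * cis (- 2 * t) = cnj (cis t)"
      by (simp only: cis_mult cis_cnj) simp
    finally show ?thesis .
  qed
  have hb: "b' t *\<^sub>R h (cis (b t)) = of_real (1 - (norm q)\<^sup>2) * h (cis t + q * cnj (cis t))" for t
    unfolding cisb[of t, symmetric] using nz[of t] by (subst hom) (auto simp: b'_def scaleR_conv_of_real)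
  have "((\<lambda>t. b' t *\<^sub>R h (cis (b t))) has_integral integral {b 0..b (2*pi)} (\<lambda>s. h (cis s))) {0..2*pi}"
    by (rule has_integral_substitution[where c = "b 0" and d = "b (2*pi)"])
       (auto intro!: mono b_deriv continuous_on_circle h)
  then have "integral {0..2*pi} (\<lambda>t. b' t *\<^sub>R h (cis (b t))) = integral {b 0..b (2*pi)} (\<lambda>s. h (cis s))"
    by (rule integral_unique)
  \<comment> \<open>\<open>w\<close> returns to its initial value, so the logarithm contributes
    nothing and \<open>b\<close> runs through exactly one full turn.\<close>
  also have "b (2*pi) = 2 * pi + b 0"
  proof -
    have "cis (- 2 * (2 * pi)) = cnj (cis (2 * pi) * cis (2 * pi))"
      by (simp only: cis_mult cis_cnj) simp
    then have "cis (- 2 * (2 * pi)) = 1" by (simp only: cis_2pi) simp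
    then show ?thesis unfolding b_def w_def by simp
  qed
  also have "integral {b 0..2 * pi + b 0} (\<lambda>s. h (cis s)) = integral {0..2*pi} ((\<lambda>s. h (cis s)) \<circ> (\<lambda>t. t + b 0))"
    using integral_shift[OF continuous_on_circle[OF h], where a = 0 and c = "b 0" and b = "2*pi"] by simp
  also have "\<dots> = circ (\<lambda>z. h (cis (b 0) * z))"
    unfolding circ_def by (simp add: o_def cis_mult[symmetric] mult.commute)
  also have "\<dots> = circ h" by (rule circ_rotate[OF h])
  finally show ?thesis
    unfolding hb circ_def by simp
qed

section \<open>Isotropic position\<close>

text \<open>In polar coordinates the integral of \<open>z^2\<close> over the ball
  \<open>g z \<le> 1\<close> is one quarter of this, since \<open>r^3\<close> integrates to
  \<open>1 / (4 g^4)\<close>. Likewise \<open>mom0\<close> is four times the integral of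
  \<open>norm z ^ 2\<close>. Hence \<open>mom2 g = 0\<close> says that the second moment matrix of
  the ball is a multiple of the identity.\<close>

definition mom2 :: "(complex \<Rightarrow> real) \<Rightarrow> complex" where
  "mom2 g = circ (\<lambda>z. z\<^sup>2 / of_real (g z ^ 4))"

definition mom0 :: "(complex \<Rightarrow> real) \<Rightarrow> real" where
  "mom0 g = integral {0..2*pi} (\<lambda>t. 1 / g (cis t) ^ 4)"

definition fourier :: "nat \<Rightarrow> (complex \<Rightarrow> real) \<Rightarrow> complex" where
  "fourier k g = circ (\<lambda>z. z ^ k * of_real (g z))"

text \<open>The normal form of a frame modulo conformal maps: an orientation-preserving linear map
  \<open>p z + q' cnj z\<close> has this shape up to a complex factor, with Beltrami coefficient
  \<open>q\<close> of modulus below 1. Up to the real factor \<open>1 - (norm q)^2\<close>, its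
  inverse is \<open>conf (- q)\<close>.\<close>

definition conf :: "complex \<Rightarrow> complex \<Rightarrow> complex" where
  "conf q z = z + q * cnj z"

lemma continuous_inverse_pow4:
  assumes "rnorm g"
  shows "continuous_on (- {0}) (\<lambda>z. 1 / g z ^ 4)"
  using rnorm_pos[OF assms] by (intro continuous_intros rnorm_continuous assms) force

lemma continuous_div_pow4:
  assumes "rnorm g" "continuous_on (- {0}) F"
  shows "continuous_on (- {0}) (\<lambda>z. F z / of_real (g z ^ 4) :: complex)"
  using rnorm_pos[OF assms(1)]
  by (intro continuous_intros rnorm_continuous assms) force

lemma circ_of_real:
  assumes "continuous_on (- {0}) F"
  shows "circ (\<lambda>z. of_real (F z)) = of_real (integral {0..2*pi} (\<lambda>t. F (cis t)))"
  using integral_linear[OF circ_integrable[OF assms] bounded_linear_of_real, of 0 "2*pi"]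
  by (simp add: circ_def o_def)

lemma integral_Re_circ:
  assumes "continuous_on (- {0}) F"
  shows "integral {0..2*pi} (\<lambda>t. Re (F (cis t))) = Re (circ F)"
  using integral_linear[OF circ_integrable[OF assms] bounded_linear_Re, of 0 "2*pi"]
  by (simp add: circ_def o_def)

lemma circ_mom0:
  assumes "rnorm g" shows "circ (\<lambda>z. 1 / of_real (g z ^ 4)) = of_real (mom0 g)"
  using circ_of_real[OF continuous_inverse_pow4[OF assms]] by (simp add: mom0_def)

lemma conf_eq_0: "norm q < 1 \<Longrightarrow> conf q z = 0 \<Longrightarrow> z = 0"
proof (rule ccontr)
  assume q: "norm q < 1" and z: "conf q z = 0" "z \<noteq> 0"
  then have "norm z = norm q * norm z"
    unfolding conf_def by (metis add_eq_0_iff complex_mod_cnj norm_minus_cancel norm_mult)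
  then show False using q z by simp
qed

lemma linear_conf: "linear (conf q)"
  by (rule linearI) (simp_all add: conf_def algebra_simps scaleR_conv_of_real)

lemma rnorm_conf: "rnorm g \<Longrightarrow> norm q < 1 \<Longrightarrow> rnorm (\<lambda>z. g (conf q z))"
  by (rule rnorm_compose[OF _ linear_conf]) (auto intro: conf_eq_0)

lemma one_minus_norm_pos: "norm (q::complex) < 1 \<Longrightarrow> 1 - (norm q)\<^sup>2 > 0"
  using abs_square_less_1[of "norm q"] by simp

lemma conf_conf_inverse: "conf (- q) (conf q z) = of_real (1 - (norm q)\<^sup>2) * z"
proof -
  have "conf (- q) (conf q z) = z - (q * cnj q) * z" by (simp add: conf_def algebra_simps)
  then show ?thesis by (simp add: complex_norm_square[symmetric] algebra_simps)
qed

text \<open>The function \<open>F (conf (- q) w) / g w ^ 4\<close> is homogeneous of degree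
  \<open>2 - 4 = -2\<close>, as the change of variables demands. One factor \<open>D\<close> comes
  from the substitution and \<open>D^2\<close> from \<open>conf (- q)\<close> undoing
  \<open>conf q\<close> inside the degree 2 function \<open>F\<close>.\<close>

lemma circ_conf_quotient:
  assumes g: "rnorm g" and q: "norm q < 1" and F: "continuous_on UNIV F"
    and hom: "\<And>r z. r > 0 \<Longrightarrow> F (of_real r * z) = of_real (r\<^sup>2) * F z"
  shows "circ (\<lambda>z. F z / of_real (g (conf q z) ^ 4))
    = circ (\<lambda>z. F (conf (- q) z) / of_real (g z ^ 4)) / of_real ((1 - (norm q)\<^sup>2) ^ 3)"
proof -
  define D where "D = 1 - (norm q)\<^sup>2"
  have D: "D > 0" using one_minus_norm_pos[OF q] by (simp add: D_def)
  define h where "h w = F (conf (- q) w) / of_real (g w ^ 4)" for w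
  have cF: "continuous_on S (\<lambda>w. F (conf (- q) w))" for S
    by (rule continuous_on_compose2[OF F]) (auto intro!: linear_continuous_on linear_conf simp: linear_conv_bounded_linear[symmetric])
  have h: "continuous_on (- {0}) h"
    unfolding h_def by (rule continuous_div_pow4[OF g cF])
  have "of_real D * circ (\<lambda>z. h (z + q * cnj z)) = circ h"
    unfolding D_def
  proof (rule circ_change_of_variables[OF h _ q])
    fix r :: real and z :: complex assume r: "r > 0" "z \<noteq> 0"
    have "conf (- q) (of_real r * z) = of_real r * conf (- q) z"
      by (simp add: conf_def algebra_simps)
    moreover have "g (of_real r * z) = r * g z"
      using rnormD(3)[OF g, of r z] r by (simp add: scaleR_conv_of_real)
    ultimately show "h (of_real r * z) = h z / of_real (r\<^sup>2)"
      using r by (simp add: h_def hom power_mult_distrib power2_eq_square eval_nat_numeral divide_simps)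
  qed
  moreover have "h (z + q * cnj z) = of_real (D\<^sup>2) * (F z / of_real (g (conf q z) ^ 4))" for z
    using conf_conf_inverse[of q z] hom[OF D] unfolding h_def D_def conf_def by simp
  ultimately have "of_real D * (of_real (D\<^sup>2) * circ (\<lambda>z. F z / of_real (g (conf q z) ^ 4))) = circ h"
    by (simp only: circ_mult)
  then show ?thesis
    using D unfolding h_def D_def[symmetric] by (simp add: field_simps power3_eq_cube power2_eq_square)
qed

lemma circ_quadratic:
  assumes g: "rnorm g"
  shows "circ (\<lambda>z. (a * z\<^sup>2 + b + c * cnj (z\<^sup>2)) / of_real (g z ^ 4))
    = a * mom2 g + b * of_real (mom0 g) + c * cnj (mom2 g)"
proof -
  note c = continuous_div_pow4[OF g]
  have "circ (\<lambda>z. (a * z\<^sup>2 + b + c * cnj (z\<^sup>2)) / of_real (g z ^ 4))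
    = circ (\<lambda>z. (a * (z\<^sup>2 / of_real (g z ^ 4)) + b * (1 / of_real (g z ^ 4))) + c * cnj (z\<^sup>2 / of_real (g z ^ 4)))"
    by (simp add: add_divide_distrib)
  also have "\<dots> = circ (\<lambda>z. a * (z\<^sup>2 / of_real (g z ^ 4)) + b * (1 / of_real (g z ^ 4))) + circ (\<lambda>z. c * cnj (z\<^sup>2 / of_real (g z ^ 4)))"
    by (intro circ_add continuous_intros c)
  also have "circ (\<lambda>z. a * (z\<^sup>2 / of_real (g z ^ 4)) + b * (1 / of_real (g z ^ 4))) =
     circ (\<lambda>z. a * (z\<^sup>2 / of_real (g z ^ 4))) + circ (\<lambda>z. b * (1 / of_real (g z ^ 4)))"
    by (intro circ_add continuous_intros c)
  finally show ?thesis
    by (simp only: circ_mult circ_cnj mom2_def circ_mom0[OF g])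
qed

text \<open>On the circle \<open>z * cnj z = 1\<close>, so \<open>(conf (- q) z)^2\<close> contains
  only the frequencies 2, 0 and -2. The isotropy condition therefore becomes a quadratic equation
  for \<open>q\<close>.\<close>

lemma mom2_conf:
  assumes g: "rnorm g" and q: "norm q < 1"
  shows "mom2 (\<lambda>z. g (conf q z)) = (mom2 g - 2 * q * of_real (mom0 g) + q\<^sup>2 * cnj (mom2 g))
    / of_real ((1 - (norm q)\<^sup>2) ^ 3)"
proof -
  have "mom2 (\<lambda>z. g (conf q z)) = circ (\<lambda>z. (conf (- q) z)\<^sup>2 / of_real (g z ^ 4)) / of_real ((1 - (norm q)\<^sup>2) ^ 3)"
    unfolding mom2_def
    by (rule circ_conf_quotient[OF g q]) (auto intro!: continuous_intros simp: power_mult_distrib)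
  also have "circ (\<lambda>z. (conf (- q) z)\<^sup>2 / of_real (g z ^ 4)) = circ (\<lambda>z. (1 * z\<^sup>2 + (- 2 * q) + q\<^sup>2 * cnj (z\<^sup>2)) / of_real (g z ^ 4))"
  proof (rule circ_cong)
    fix z :: complex assume "norm z = 1"
    then have z: "z * cnj z = 1" by (simp add: complex_norm_square[symmetric])
    have "(conf (- q) z)\<^sup>2 = z\<^sup>2 - 2 * q * (z * cnj z) + q\<^sup>2 * (cnj z)\<^sup>2"
      by (simp add: conf_def power2_eq_square algebra_simps)
    then show "(conf (- q) z)\<^sup>2 / of_real (g z ^ 4) = (1 * z\<^sup>2 + (- 2 * q) + q\<^sup>2 * cnj (z\<^sup>2)) / of_real (g z ^ 4)"
      unfolding z by simp
  qed
  also have "\<dots> = mom2 g - 2 * q * of_real (mom0 g) + q\<^sup>2 * cnj (mom2 g)"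
    unfolding circ_quadratic[OF g] by simp
  finally show ?thesis .
qed

lemma mom0_conf:
  assumes g: "rnorm g" and q: "norm q < 1"
  shows "mom0 (\<lambda>z. g (conf q z)) = ((1 + (norm q)\<^sup>2) * mom0 g - 2 * Re (cnj q * mom2 g))
    / (1 - (norm q)\<^sup>2) ^ 3"
proof -
  have "of_real (mom0 (\<lambda>z. g (conf q z))) = circ (\<lambda>z. 1 / of_real (g (conf q z) ^ 4))"
    using circ_mom0[OF rnorm_conf[OF g q]] by simp
  also have "\<dots> = circ (\<lambda>z. (z * cnj z) / of_real (g (conf q z) ^ 4))"
    by (rule circ_cong) (simp add: complex_norm_square[symmetric])
  also have "\<dots> = circ (\<lambda>z. (conf (- q) z * cnj (conf (- q) z)) / of_real (g z ^ 4)) / of_real ((1 - (norm q)\<^sup>2) ^ 3)"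
    by (rule circ_conf_quotient[OF g q]) (auto intro!: continuous_intros simp: power2_eq_square)
  also have "circ (\<lambda>z. (conf (- q) z * cnj (conf (- q) z)) / of_real (g z ^ 4))
    = circ (\<lambda>z. (- cnj q * z\<^sup>2 + of_real (1 + (norm q)\<^sup>2) + (- q) * cnj (z\<^sup>2)) / of_real (g z ^ 4))"
  proof (rule circ_cong)
    fix z :: complex assume "norm z = 1"
    then have z: "z * cnj z = 1" by (simp add: complex_norm_square[symmetric])
    have "conf (- q) z * cnj (conf (- q) z) = - cnj q * z\<^sup>2 + (z * cnj z) * (1 + q * cnj q) - q * (cnj z)\<^sup>2"
      by (simp add: conf_def power2_eq_square algebra_simps)
    then show "(conf (- q) z * cnj (conf (- q) z)) / of_real (g z ^ 4) =
       (- cnj q * z\<^sup>2 + of_real (1 + (norm q)\<^sup>2) + (- q) * cnj (z\<^sup>2)) / of_real (g z ^ 4)"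
      unfolding z by (simp add: complex_norm_square[symmetric])
  qed
  also have "\<dots> = - cnj q * mom2 g + of_real (1 + (norm q)\<^sup>2) * of_real (mom0 g) + (- q) * cnj (mom2 g)"
    by (rule circ_quadratic[OF g])
  also have "\<dots> = of_real ((1 + (norm q)\<^sup>2) * mom0 g) - (cnj q * mom2 g + cnj (cnj q * mom2 g))"
    by simp
  also have "cnj q * mom2 g + cnj (cnj q * mom2 g) = of_real (2 * Re (cnj q * mom2 g))"
    by (rule complex_add_cnj)
  finally have "complex_of_real (mom0 (\<lambda>z. g (conf q z))) =
     of_real (((1 + (norm q)\<^sup>2) * mom0 g - 2 * Re (cnj q * mom2 g)) / (1 - (norm q)\<^sup>2) ^ 3)"
    by (simp only: of_real_diff[symmetric] of_real_divide[symmetric])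
  then show ?thesis by (simp only: of_real_eq_iff)
qed

lemma rnorm_mult_rotate:
  assumes "rnorm g" "r > 0"
  shows "g (of_real r * (cis a * z)) = r * g (cis a * z)"
  using rnormD(3)[OF assms(1), of r "cis a * z"] assms(2) by (simp add: scaleR_conv_of_real)

lemma cis_power_cancel: "cis (- (real k * a)) * (cis a * z) ^ k = z ^ k"
proof -
  have "cis (- (real k * a)) * (cis a * z) ^ k = cis (- (real k * a)) * cis (real k * a) * z ^ k"
    by (simp only: power_mult_distrib Complex.DeMoivre mult.assoc)
  then show ?thesis by (simp add: cis_mult)
qed

section \<open>Action of rotations, scalings and conjugation\<close>

lemma mom2_rotate:
  assumes g: "rnorm g" and r: "r > 0"
  shows "mom2 (\<lambda>z. g (of_real r * (cis a * z))) = cis (- (2 * a)) / of_real (r ^ 4) * mom2 g"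
proof -
  have "mom2 (\<lambda>z. g (of_real r * (cis a * z)))
    = circ (\<lambda>z. cis (- (2 * a)) / of_real (r ^ 4) * ((cis a * z)\<^sup>2 / of_real (g (cis a * z) ^ 4)))"
    unfolding mom2_def
  proof (rule circ_cong)
    fix z
    have "cis (- (2 * a)) / of_real (r ^ 4) * ((cis a * z)\<^sup>2 / of_real (g (cis a * z) ^ 4))
      = (cis (- (2 * a)) * (cis a * z)\<^sup>2) / of_real (r ^ 4 * g (cis a * z) ^ 4)" by simp
    also have "cis (- (2 * a)) * (cis a * z)\<^sup>2 = z\<^sup>2" using cis_power_cancel[of 2 a z] by (simp only: of_nat_numeral)
    finally show "z\<^sup>2 / of_real (g (of_real r * (cis a * z)) ^ 4)
      = cis (- (2 * a)) / of_real (r ^ 4) * ((cis a * z)\<^sup>2 / of_real (g (cis a * z) ^ 4))"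
      unfolding rnorm_mult_rotate[OF g r] power_mult_distrib by simp
  qed
  also have "\<dots> = cis (- (2 * a)) / of_real (r ^ 4) * mom2 g"
    unfolding circ_mult mom2_def
    by (subst circ_rotate[of "\<lambda>z. z\<^sup>2 / of_real (g z ^ 4)"]) (intro continuous_div_pow4[OF g] continuous_intros, simp)
  finally show ?thesis .
qed

lemma mom0_rotate:
  assumes g: "rnorm g"
  shows "mom0 (\<lambda>z. g (cis a * z)) = mom0 g"
proof -
  have "rnorm (\<lambda>z. g (cis a * z))"
    by (rule rnorm_compose[OF g]) (auto intro!: linearI simp: algebra_simps)
  then have "of_real (mom0 (\<lambda>z. g (cis a * z))) = circ (\<lambda>z. 1 / of_real (g (cis a * z) ^ 4))"
    by (rule circ_mom0[symmetric])
  also have "\<dots> = of_real (mom0 g)"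
    using circ_rotate[of "\<lambda>z. 1 / of_real (g z ^ 4)" a] continuous_div_pow4[OF g, of "\<lambda>_. 1"] circ_mom0[OF g]
    by simp
  finally show ?thesis by simp
qed

lemma fourier_rotate:
  assumes g: "rnorm g" and r: "r > 0"
  shows "fourier k (\<lambda>z. g (of_real r * (cis a * z))) = of_real r * cis (- (real k * a)) * fourier k g"
proof -
  have "fourier k (\<lambda>z. g (of_real r * (cis a * z)))
    = circ (\<lambda>z. (of_real r * cis (- (real k * a))) * ((cis a * z) ^ k * of_real (g (cis a * z))))"
    unfolding fourier_def
  proof (rule circ_cong)
    fix z
    have "of_real r * cis (- (real k * a)) * ((cis a * z) ^ k * of_real (g (cis a * z)))
      = (cis (- (real k * a)) * (cis a * z) ^ k) * of_real (r * g (cis a * z))" by simp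
    then show "z ^ k * of_real (g (of_real r * (cis a * z)))
      = of_real r * cis (- (real k * a)) * ((cis a * z) ^ k * of_real (g (cis a * z)))"
      unfolding cis_power_cancel rnorm_mult_rotate[OF g r] by (rule sym)
  qed
  also have "\<dots> = of_real r * cis (- (real k * a)) * fourier k g"
    unfolding circ_mult fourier_def
    by (subst circ_rotate[of "\<lambda>z. z ^ k * of_real (g z)"]) (auto intro!: continuous_intros rnorm_continuous g)
  finally show ?thesis .
qed

lemma mom2_cnj:
  assumes g: "rnorm g"
  shows "mom2 (\<lambda>z. g (cnj z)) = cnj (mom2 g)"
proof -
  have "mom2 (\<lambda>z. g (cnj z)) = circ (\<lambda>z. cnj ((cnj z)\<^sup>2 / of_real (g (cnj z) ^ 4)))"
    unfolding mom2_def by simp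
  also have "\<dots> = cnj (mom2 g)"
    unfolding circ_cnj mom2_def
    by (subst circ_cnj_arg[of "\<lambda>z. z\<^sup>2 / of_real (g z ^ 4)"]) (intro continuous_div_pow4[OF g] continuous_intros, simp)
  finally show ?thesis .
qed

lemma fourier_cnj:
  assumes g: "rnorm g"
  shows "fourier k (\<lambda>z. g (cnj z)) = cnj (fourier k g)"
proof -
  have "fourier k (\<lambda>z. g (cnj z)) = circ (\<lambda>z. cnj ((cnj z) ^ k * of_real (g (cnj z))))"
    unfolding fourier_def by simp
  also have "\<dots> = cnj (fourier k g)"
    unfolding circ_cnj fourier_def
    by (subst circ_cnj_arg[of "\<lambda>z. z ^ k * of_real (g z)"]) (auto intro!: rnorm_continuous g continuous_intros)
  finally show ?thesis .
qed

text \<open>After a rotation the gap is the integral of the nonnegative function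
  \<open>1 - Re (u z^2)\<close> against \<open>1 / g^4\<close>. Bounding \<open>g\<close> above by
  \<open>M\<close> leaves \<open>2 * pi / M ^ 4\<close>, because \<open>z^2\<close> has mean zero;
  this makes the inequality strict.\<close>

lemma norm_mom2_less:
  assumes g: "rnorm g"
  shows "norm (mom2 g) < mom0 g"
proof -
  obtain M where M: "M > 0" "\<And>x. g x \<le> M * norm x" using rnorm_upper[OF g] by blast
  obtain u where u: "norm u = 1" "u * mom2 g = of_real (norm (mom2 g))"
  proof (cases "mom2 g = 0")
    case False
    then show thesis
      using complex_norm_square[of "mom2 g"]
      by (intro that[of "cnj (mom2 g) / of_real (norm (mom2 g))"])
         (auto simp: norm_divide mult.commute power2_eq_square divide_eq_eq)
  qed (auto intro: that[of 1])
  have z2: "circ (\<lambda>z. z\<^sup>2) = 0"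
  proof -
    have "circ (\<lambda>z. (cis (pi/2) * z)\<^sup>2) = circ (\<lambda>z. z\<^sup>2)"
      by (rule circ_rotate) (intro continuous_intros)
    moreover have "circ (\<lambda>z. (cis (pi/2) * z)\<^sup>2) = circ (\<lambda>z. (-1) * z\<^sup>2)"
      by (simp add: power_mult_distrib)
    ultimately show ?thesis unfolding circ_mult by simp
  qed
  have c1: "continuous_on (- {0}) (\<lambda>z. Re ((1 - u * z\<^sup>2) / of_real (g z ^ 4)))"
    by (intro continuous_intros continuous_div_pow4 g)
  have c2: "continuous_on (- {0}) (\<lambda>z. Re ((1 - u * z\<^sup>2) / of_real (M ^ 4)))"
    using M by (intro continuous_intros) auto
  have le: "Re ((1 - u * z\<^sup>2) / of_real (M ^ 4)) \<le> Re ((1 - u * z\<^sup>2) / of_real (g z ^ 4))" if z: "norm z = 1" for z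
  proof -
    have "Re (u * z\<^sup>2) \<le> norm (u * z\<^sup>2)" by (rule complex_Re_le_cmod)
    then have "0 \<le> Re (1 - u * z\<^sup>2)" using z u by (simp add: norm_mult norm_power)
    moreover have "g z > 0" using z by (intro rnorm_pos[OF g]) auto
    moreover have "g z ^ 4 \<le> M ^ 4" using M(2)[of z] z \<open>g z > 0\<close> by (intro power_mono) auto
    ultimately have "Re (1 - u * z\<^sup>2) / M ^ 4 \<le> Re (1 - u * z\<^sup>2) / g z ^ 4"
      by (intro divide_left_mono) (auto intro!: mult_pos_pos M)
    then show ?thesis by (simp only: Re_divide_of_real)
  qed
  have "integral {0..2*pi} (\<lambda>t. Re ((1 - u * (cis t)\<^sup>2) / of_real (M ^ 4)))
    \<le> integral {0..2*pi} (\<lambda>t. Re ((1 - u * (cis t)\<^sup>2) / of_real (g (cis t) ^ 4)))"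
  proof (rule integral_le)
    fix t
    show "Re ((1 - u * (cis t)\<^sup>2) / of_real (M ^ 4)) \<le> Re ((1 - u * (cis t)\<^sup>2) / of_real (g (cis t) ^ 4))"
      by (rule le) simp
  qed (rule circ_integrable[OF c2], rule circ_integrable[OF c1])
  also have "\<dots> = Re (circ (\<lambda>z. (1 - u * z\<^sup>2) / of_real (g z ^ 4)))"
    by (intro integral_Re_circ[where F = "\<lambda>z. (1 - u * z\<^sup>2) / of_real (g z ^ 4)"] continuous_div_pow4 g continuous_intros)
  also have "circ (\<lambda>z. (1 - u * z\<^sup>2) / of_real (g z ^ 4)) = circ (\<lambda>z. ((- u) * z\<^sup>2 + 1 + 0 * cnj (z\<^sup>2)) / of_real (g z ^ 4))"
    by simp
  also have "\<dots> = of_real (mom0 g - norm (mom2 g))"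
    unfolding circ_quadratic[OF g] using u by simp
  also have "integral {0..2*pi} (\<lambda>t. Re ((1 - u * (cis t)\<^sup>2) / of_real (M ^ 4)))
     = Re (circ (\<lambda>z. (1 - u * z\<^sup>2) / of_real (M ^ 4)))"
    using M by (intro integral_Re_circ[where F = "\<lambda>z. (1 - u * z\<^sup>2) / of_real (M ^ 4)"] continuous_intros) auto
  also have "circ (\<lambda>z. (1 - u * z\<^sup>2) / of_real (M ^ 4)) = circ (\<lambda>z. 1 / of_real (M ^ 4) + (- u / of_real (M ^ 4)) * z\<^sup>2)"
    by (simp add: diff_divide_distrib)
  also have "\<dots> = of_real (2 * pi / M ^ 4)"
  proof -
    have "circ (\<lambda>z. 1 / of_real (M ^ 4) + (- u / of_real (M ^ 4)) * z\<^sup>2)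
      = circ (\<lambda>z. 1 / of_real (M ^ 4)) + circ (\<lambda>z. (- u / of_real (M ^ 4)) * z\<^sup>2)"
      using M by (intro circ_add continuous_intros) auto
    also have "circ (\<lambda>z. (- u / of_real (M ^ 4)) * z\<^sup>2) = 0" unfolding circ_mult z2 by simp
    also have "circ (\<lambda>z. 1 / of_real (M ^ 4)) = of_real (2 * pi / M ^ 4)"
      by (simp add: circ_def scaleR_conv_of_real)
    finally show ?thesis by simp
  qed
  finally have "2 * pi / M ^ 4 \<le> mom0 g - norm (mom2 g)" by simp
  moreover have "2 * pi / M ^ 4 > 0" using M by simp
  ultimately show ?thesis by linarith
qed

text \<open>With \<open>v = mom2 g / mom0 g\<close>, the isotropy equation is
  \<open>v - 2 q + q^2 cnj v = 0\<close>. This is its root inside the unit disc, written so that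
  nothing is divided by \<open>v\<close>: it is continuous also at \<open>v = 0\<close>.\<close>

definition isoq :: "(complex \<Rightarrow> real) \<Rightarrow> complex" where
  "isoq g = (mom2 g / of_real (mom0 g)) / of_real (1 + sqrt (1 - (norm (mom2 g) / mom0 g)\<^sup>2))"

lemma mom0_pos: "rnorm g \<Longrightarrow> mom0 g > 0"
  using norm_mom2_less[of g] norm_ge_zero[of "mom2 g"] by linarith

lemma
  assumes g: "rnorm g"
  shows norm_isoq: "norm (isoq g) < 1"
    and mom2_isoq: "mom2 (\<lambda>z. g (conf (isoq g) z)) = 0"
proof -
  define v where "v = mom2 g / of_real (mom0 g)"
  define s where "s = sqrt (1 - (norm v)\<^sup>2)"
  have m: "mom0 g > 0" by (rule mom0_pos[OF g])
  have nv: "norm v = norm (mom2 g) / mom0 g" using m by (simp add: v_def norm_divide)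
  have q: "isoq g = v / of_real (1 + s)" by (simp add: isoq_def v_def s_def norm_divide m less_imp_le)
  have v1: "norm v < 1" unfolding nv using norm_mom2_less[OF g] m by simp
  then have "(norm v)\<^sup>2 < 1" using abs_square_less_1[of "norm v"] by simp
  then have s: "s > 0" "s\<^sup>2 = 1 - (norm v)\<^sup>2" by (simp_all add: s_def)
  have "norm (isoq g) = norm v / (1 + s)"
    unfolding q norm_divide using s by (simp del: of_real_add)
  also have "\<dots> < 1" using s v1 by (simp add: divide_less_eq)
  finally show q1: "norm (isoq g) < 1" .
  define c where "c = complex_of_real (1 + s)"
  have c0: "c \<noteq> 0" using s unfolding c_def of_real_eq_0_iff by simp
  have vv: "v * cnj v = 1 - (c - 1)\<^sup>2"
    unfolding complex_norm_square[symmetric] c_def using s(2)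
    by (simp flip: of_real_power)
  have "v - 2 * isoq g + (isoq g)\<^sup>2 * cnj v = v * (c\<^sup>2 - 2 * c + v * cnj v) / c\<^sup>2"
    unfolding q c_def[symmetric] using c0 by (simp add: field_simps power2_eq_square)
  also have "c\<^sup>2 - 2 * c + v * cnj v = 0" unfolding vv by (simp add: power2_eq_square algebra_simps)
  finally have "v - 2 * isoq g + (isoq g)\<^sup>2 * cnj v = 0" by simp
  then have "0 = of_real (mom0 g) * (v - 2 * isoq g + (isoq g)\<^sup>2 * cnj v)" by simp
  also have "\<dots> = of_real (mom0 g) * v - 2 * isoq g * of_real (mom0 g) + (isoq g)\<^sup>2 * (of_real (mom0 g) * cnj v)"
    by (simp add: algebra_simps)
  also have "of_real (mom0 g) * v = mom2 g" using m by (simp add: v_def)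
  also have "of_real (mom0 g) * cnj v = cnj (mom2 g)" using m by (simp add: v_def)
  finally have "mom2 g - 2 * isoq g * of_real (mom0 g) + (isoq g)\<^sup>2 * cnj (mom2 g) = 0" by simp
  then show "mom2 (\<lambda>z. g (conf (isoq g) z)) = 0"
    unfolding mom2_conf[OF g q1] by simp
qed

lemma isoq_rotate:
  assumes g: "rnorm g"
  shows "isoq (\<lambda>z. g (cis a * z)) = cis (- (2 * a)) * isoq g"
  using mom2_rotate[OF g, of 1 a] by (simp add: isoq_def mom0_rotate[OF g] norm_mult)

text \<open>Rotating the parametrization by \<open>a\<close> multiplies \<open>isoq\<close> by
  \<open>cis (- 2 a)\<close>, which is exactly what makes the isotropic frame turn by
  \<open>a\<close> as a whole. This phase rule supplies the winding numbers.\<close>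

lemma fourier_isoq_rotate:
  assumes g: "rnorm g"
  shows "fourier k (\<lambda>z. g (cis a * conf (isoq (\<lambda>z. g (cis a * z))) z))
     = cis (- (real k * a)) * fourier k (\<lambda>z. g (conf (isoq g) z))"
proof -
  have "cis a * conf (isoq (\<lambda>z. g (cis a * z))) z = conf (isoq g) (cis a * z)" for z
  proof -
    have "cis a * conf (isoq (\<lambda>z. g (cis a * z))) z = cis a * z + isoq g * ((cis a * cis (- (2 * a))) * cnj z)"
      unfolding isoq_rotate[OF g] conf_def by (simp only: distrib_left mult.left_commute mult.assoc)
    also have "(cis a * cis (- (2 * a))) * cnj z = cnj (cis a * z)"
      by (simp add: cis_mult cis_cnj)
    finally show ?thesis by (simp add: conf_def)
  qed
  then show ?thesis
    using fourier_rotate[OF rnorm_conf[OF g norm_isoq[OF g]], of 1 k a] by simp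
qed

text \<open>
  Both norms are in isotropic position (\<open>mom2 = 0\<close>), so a map that nearly carries one unit ball
  to the other must nearly be conformal.
\<close>

lemma norm_conf_le_of_isotropic:
  assumes g: "rnorm g" "mom2 g = 0" and g': "rnorm g'" "mom2 g' = 0" and q: "norm q < 1"
    and d: "0 \<le> d" and lo: "\<And>z. g' z \<le> g (conf q z)" and hi: "\<And>z. g (conf q z) \<le> (1 + d) * g' z"
  shows "norm q \<le> (1 + d) ^ 4 - 1"
proof -
  define f where "f z = g (conf q z)" for z
  have f: "rnorm f" unfolding f_def by (rule rnorm_conf[OF g(1) q])
  define D where "D = 1 - (norm q)\<^sup>2"
  have D: "D > 0" using one_minus_norm_pos[OF q] by (simp add: D_def)
  have m: "mom0 g > 0" by (rule mom0_pos[OF g(1)])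
  \<comment> \<open>As \<open>mom2 g = 0\<close>, the quotient of \<open>norm (mom2 f)\<close> by
    \<open>mom0 f\<close> equals \<open>2 |q| / (1 + |q|^2)\<close>. Comparing \<open>f\<close> with
    \<open>g'\<close>, whose \<open>mom2\<close> vanishes, bounds the same quotient by
    \<open>(1 + d) ^ 4 - 1\<close>.\<close>
  have m2: "mom2 f = - (2 * q * of_real (mom0 g)) / of_real (D ^ 3)"
    unfolding f_def mom2_conf[OF g(1) q] g(2) D_def by simp
  have m0: "mom0 f = (1 + (norm q)\<^sup>2) * mom0 g / D ^ 3"
    unfolding f_def mom0_conf[OF g(1) q] g(2) D_def by simp
  have c: "continuous_on (- {0}) (\<lambda>z. 1 / g' z ^ 4)" "continuous_on (- {0}) (\<lambda>z. 1 / f z ^ 4)"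
    by (rule continuous_inverse_pow4[OF g'(1)], rule continuous_inverse_pow4[OF f])
  have c3: "continuous_on (- {0}) (\<lambda>z. 1 / g' z ^ 4 - 1 / f z ^ 4)"
    by (rule continuous_on_diff[OF c])
  have c4: "continuous_on (- {0}) (\<lambda>z. ((1 + d) ^ 4 - 1) * (1 / f z ^ 4))"
    by (rule continuous_on_mult_left[OF c(2)])
  have pow: "continuous_on (- {0}) (\<lambda>z::complex. z\<^sup>2)" by (intro continuous_intros)
  have c5: "continuous_on (- {0}) (\<lambda>z. z\<^sup>2 / of_real (f z ^ 4))"
    by (rule continuous_div_pow4[OF f pow])
  have c6: "continuous_on (- {0}) (\<lambda>z. (-1) * (z\<^sup>2 / of_real (g' z ^ 4)))"
    by (rule continuous_on_mult_left[OF continuous_div_pow4[OF g'(1) pow]])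
  have pos: "g' z > 0" "f z > 0" if "z \<noteq> 0" for z
    using rnorm_pos[OF g'(1) that] rnorm_pos[OF f that] by auto
  have "norm (mom2 f) = norm (mom2 f - mom2 g')" by (simp add: g'(2))
  also have "mom2 f - mom2 g' = mom2 f + (-1) * mom2 g'" by simp
  also have "\<dots> = circ (\<lambda>z. z\<^sup>2 / of_real (f z ^ 4) + (-1) * (z\<^sup>2 / of_real (g' z ^ 4)))"
    unfolding mom2_def circ_mult[symmetric]
    by (rule circ_add[OF c5 c6, symmetric])
  also have "norm \<dots> \<le> integral {0..2*pi} (\<lambda>t. 1 / g' (cis t) ^ 4 - 1 / f (cis t) ^ 4)"
  proof (rule norm_circ_le)
    fix z :: complex assume z: "norm z = 1"
    then have z0: "z \<noteq> 0" by auto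
    have "z\<^sup>2 / of_real (f z ^ 4) + (-1) * (z\<^sup>2 / of_real (g' z ^ 4)) = z\<^sup>2 * of_real (1 / f z ^ 4 - 1 / g' z ^ 4)"
      by (simp add: algebra_simps)
    then have "norm (z\<^sup>2 / of_real (f z ^ 4) + (-1) * (z\<^sup>2 / of_real (g' z ^ 4))) = \<bar>1 / f z ^ 4 - 1 / g' z ^ 4\<bar>"
      using z by (simp only: norm_mult norm_power norm_of_real) simp
    also have "1 / f z ^ 4 \<le> 1 / g' z ^ 4"
      using pos[OF z0] lo[of z] by (intro divide_left_mono power_mono) (auto simp: f_def)
    then have "\<bar>1 / f z ^ 4 - 1 / g' z ^ 4\<bar> = 1 / g' z ^ 4 - 1 / f z ^ 4" by simp
    finally show "norm (z\<^sup>2 / of_real (f z ^ 4) + (-1) * (z\<^sup>2 / of_real (g' z ^ 4))) \<le> 1 / g' z ^ 4 - 1 / f z ^ 4"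
      by simp
  qed (rule continuous_on_add[OF c5 c6], rule c3)
  also have "\<dots> \<le> integral {0..2*pi} (\<lambda>t. ((1 + d) ^ 4 - 1) * (1 / f (cis t) ^ 4))"
  proof (rule integral_le)
    fix t
    have z: "cis t \<noteq> 0" by simp
    have "f (cis t) ^ 4 \<le> ((1 + d) * g' (cis t)) ^ 4"
      using hi[of "cis t"] pos(2)[OF z] by (intro power_mono) (auto simp: f_def)
    then have "1 / g' (cis t) ^ 4 \<le> (1 + d) ^ 4 / f (cis t) ^ 4"
      using pos[OF z] by (simp add: power_mult_distrib divide_simps)
    then show "1 / g' (cis t) ^ 4 - 1 / f (cis t) ^ 4 \<le> ((1 + d) ^ 4 - 1) * (1 / f (cis t) ^ 4)"
      by (simp add: left_diff_distrib diff_divide_distrib)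
  qed (rule circ_integrable[OF c3], rule circ_integrable[OF c4])
  also have "\<dots> = ((1 + d) ^ 4 - 1) * mom0 f"
    unfolding mom0_def by (rule integral_mult_right)
  finally have "2 * norm q * mom0 g / D ^ 3 \<le> ((1 + d) ^ 4 - 1) * ((1 + (norm q)\<^sup>2) * mom0 g / D ^ 3)"
    unfolding m0 m2 using D m by (simp add: norm_mult norm_divide norm_power)
  then have "2 * norm q * (mom0 g / D ^ 3) \<le> ((1 + d) ^ 4 - 1) * (1 + (norm q)\<^sup>2) * (mom0 g / D ^ 3)"
    by simp
  moreover have "mom0 g / D ^ 3 > 0" using m D by simp
  ultimately have "2 * norm q \<le> ((1 + d) ^ 4 - 1) * (1 + (norm q)\<^sup>2)"
    by (rule mult_right_le_imp_le)
  also have "\<dots> \<le> ((1 + d) ^ 4 - 1) * 2"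
    using d one_minus_norm_pos[OF q] one_le_power[of "1 + d" 4] by (intro mult_left_mono) auto
  finally show ?thesis by simp
qed

text \<open>On the circle \<open>g\<close> and \<open>g'\<close> differ by at most
  \<open>17 * d * M\<close>: replacing \<open>conf q z\<close> by \<open>z\<close> costs
  \<open>15 * d * M\<close>, since \<open>norm q \<le> 15 * d\<close>, and the two-sided hypothesis
  costs \<open>2 * d * M\<close>. Integration over length \<open>2 * pi\<close> gives 34.\<close>

lemma fourier_le_of_isotropic:
  assumes g: "rnorm g" "mom2 g = 0" and g': "rnorm g'" "mom2 g' = 0" and q: "norm q < 1"
    and d: "0 \<le> d" "d \<le> 1" and lo: "\<And>z. g' z \<le> g (conf q z)" and hi: "\<And>z. g (conf q z) \<le> (1 + d) * g' z"
    and M: "\<And>z. g z \<le> M * norm z" and k: "fourier k g' = 0"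
  shows "norm (fourier k g) \<le> 34 * pi * d * M"
proof -
  have M0: "0 \<le> M" using M[of 1] rnormD(1)[OF g(1), of 1] by simp
  have "(1 + d) ^ 4 - 1 = d * (4 + 6 * d + 4 * d\<^sup>2 + d ^ 3)"
    by (simp add: power2_eq_square power3_eq_cube power4_eq_xxxx algebra_simps)
  also have "\<dots> \<le> d * 15"
    using d power_le_one[of d 2] power_le_one[of d 3] by (intro mult_left_mono) auto
  finally have q15: "norm q \<le> 15 * d"
    using norm_conf_le_of_isotropic[OF g g' q d(1) lo hi] by simp
  have close: "\<bar>g z - g' z\<bar> \<le> 17 * d * M" if z: "norm z = 1" for z
  proof -
    have "\<bar>g (conf q z) - g z\<bar> \<le> g (conf q z - z)" by (rule rnorm_diff[OF g(1)])
    also have "\<dots> \<le> M * norm (conf q z - z)" by (rule M)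
    also have "\<dots> = M * norm q" using z by (simp add: conf_def norm_mult)
    also have "\<dots> \<le> M * (15 * d)" using q15 M0 by (intro mult_left_mono)
    finally have 1: "\<bar>g (conf q z) - g z\<bar> \<le> 15 * d * M" by (simp add: mult_ac)
    have "g' z \<le> g (conf q z)" by (rule lo)
    also have "\<dots> \<le> M * norm (conf q z)" by (rule M)
    also have "\<dots> \<le> M * 2"
      using norm_triangle_ineq[of z "q * cnj z"] z q M0
      by (intro mult_left_mono) (auto simp: conf_def norm_mult)
    finally have "d * g' z \<le> d * (M * 2)" using d by (intro mult_left_mono) auto
    then have "\<bar>g (conf q z) - g' z\<bar> \<le> 2 * d * M"
      using lo[of z] hi[of z] by (simp add: algebra_simps)
    with 1 show ?thesis by linarith
  qed
  have c1: "continuous_on (- {0}) (\<lambda>z. z ^ k * of_real (g z))"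
    by (intro continuous_on_mult continuous_on_power continuous_on_id continuous_on_of_real rnorm_continuous[OF g(1)])
  have c2: "continuous_on (- {0}) (\<lambda>z. (-1) * (z ^ k * of_real (g' z)))"
    by (intro continuous_on_mult continuous_on_power continuous_on_id continuous_on_of_real continuous_on_const rnorm_continuous[OF g'(1)])
  have "fourier k g = fourier k g + (-1) * fourier k g'" using k by simp
  also have "\<dots> = circ (\<lambda>z. z ^ k * of_real (g z) + (-1) * (z ^ k * of_real (g' z)))"
    unfolding fourier_def circ_mult[symmetric]
    by (rule circ_add[OF c1 c2, symmetric])
  also have "norm \<dots> \<le> integral {0..2*pi} (\<lambda>t. 17 * d * M)"
  proof (rule norm_circ_le)
    fix z :: complex assume z: "norm z = 1"
    have "z ^ k * of_real (g z) + (-1) * (z ^ k * of_real (g' z)) = z ^ k * of_real (g z - g' z)"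
      by (simp add: algebra_simps)
    then have "norm (z ^ k * of_real (g z) + (-1) * (z ^ k * of_real (g' z))) = \<bar>g z - g' z\<bar>"
      using z by (simp only: norm_mult norm_power norm_of_real) simp
    then show "norm (z ^ k * of_real (g z) + (-1) * (z ^ k * of_real (g' z))) \<le> 17 * d * M"
      using close[OF z] by simp
  qed (rule continuous_on_add[OF c1 c2], rule continuous_on_const)
  also have "\<dots> = 34 * pi * d * M" by simp
  finally show ?thesis .
qed

section \<open>A plane with vanishing Fourier coefficient\<close>

lemma continuous_circ_param:
  fixes F :: "'p::topological_space \<Rightarrow> complex \<Rightarrow> complex"
  assumes "continuous_on (UNIV \<times> (- {0})) (\<lambda>x. F (fst x) (snd x))"
  shows "continuous_on UNIV (\<lambda>p. circ (F p))"
proof -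
  have "continuous_on (UNIV \<times> cbox 0 (2*pi)) (\<lambda>x. F (fst (fst x, cis (snd x))) (snd (fst x, cis (snd x))))"
    by (rule continuous_on_compose2[OF assms])
       (auto intro!: continuous_on_Pair continuous_on_fst continuous_on_snd continuous_on_id continuous_on_cis)
  then have "continuous_on (UNIV \<times> cbox 0 (2*pi)) (\<lambda>(p, t). F p (cis t))"
    by (simp add: case_prod_unfold)
  then show ?thesis
    unfolding circ_def using integral_continuous_on_param[of UNIV 0 "2*pi" "\<lambda>p t. F p (cis t)"] by simp
qed

lemma continuous_moments:
  fixes g :: "'p::topological_space \<Rightarrow> complex \<Rightarrow> real"
  assumes c: "continuous_on UNIV (\<lambda>x. g (fst x) (snd x))" and g: "\<And>p. rnorm (g p)"
  shows "continuous_on UNIV (\<lambda>p. mom2 (g p))"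
    and "continuous_on UNIV (\<lambda>p. mom0 (g p))"
    and "continuous_on UNIV (\<lambda>p. isoq (g p))"
    and "continuous_on UNIV (\<lambda>p. fourier k (g p))"
proof -
  have c': "continuous_on S (\<lambda>x. g (fst x) (snd x))" for S
    by (rule continuous_on_subset[OF c]) simp
  have nz: "complex_of_real (g p z ^ 4) \<noteq> 0" if "z \<noteq> 0" for p z
    using rnorm_pos[OF g that, of p] by simp
  have q: "continuous_on (UNIV \<times> (- {0})) (\<lambda>x. (H (snd x) / of_real (g (fst x) (snd x) ^ 4) :: complex))"
    if "continuous_on UNIV H" for H
    using nz by (intro continuous_on_divide continuous_on_of_real continuous_on_power c'
       continuous_on_compose2[OF that continuous_on_snd[OF continuous_on_id]]) auto
  show m2: "continuous_on UNIV (\<lambda>p. mom2 (g p))"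
    unfolding mom2_def by (intro continuous_circ_param q continuous_intros)
  have "continuous_on UNIV (\<lambda>p. circ (\<lambda>z. 1 / of_real (g p z ^ 4)))"
    by (intro continuous_circ_param q[of "\<lambda>_. 1"] continuous_intros)
  then have "continuous_on UNIV (\<lambda>p. Re (of_real (mom0 (g p))))"
    unfolding circ_mom0[OF g] by (rule continuous_on_Re)
  then show m0: "continuous_on UNIV (\<lambda>p. mom0 (g p))" by simp
  have v: "norm (mom2 (g p)) / mom0 (g p) < 1" "0 \<le> norm (mom2 (g p)) / mom0 (g p)" for p
    using norm_mom2_less[OF g, of p] mom0_pos[OF g, of p] by auto
  have "complex_of_real (1 + sqrt (1 - (norm (mom2 (g p)) / mom0 (g p))\<^sup>2)) \<noteq> 0" for p
  proof -
    have "sqrt (1 - (norm (mom2 (g p)) / mom0 (g p))\<^sup>2) \<ge> 0"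
      using v[of p] power_le_one[of "norm (mom2 (g p)) / mom0 (g p)" 2] by simp
    then show ?thesis unfolding of_real_eq_0_iff by linarith
  qed
  then show "continuous_on UNIV (\<lambda>p. isoq (g p))"
    unfolding isoq_def using mom0_pos[OF g] less_irrefl
    by (intro continuous_intros m0 m2) (auto simp: less_le)
  show "continuous_on UNIV (\<lambda>p. fourier k (g p))"
    unfolding fourier_def by (intro continuous_circ_param continuous_intros c')
qed

text \<open>The values lie in the discrete set of integer multiples of \<open>2 pi i\<close>, so
  continuity forbids jumps. This serves both for the homotopy invariance of a winding number and for
  its computation.\<close>

lemma continuous_exp_one_constant:
  fixes e :: "real \<Rightarrow> complex"
  assumes e: "continuous_on UNIV e" and one: "\<And>t. exp (e t) = 1"
  shows "e s = e t"
proof -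
  have "\<exists>c. \<forall>x\<in>UNIV. e x = c"
  proof (rule continuous_discrete_range_constant[OF connected_UNIV e, unfolded constant_on_def])
    fix x :: real
    have "2 * pi \<le> norm (e y - e x)" if ne: "e y \<noteq> e x" for y
    proof -
      have "exp (e y - e x) = 1" by (simp add: exp_diff one)
      then obtain n :: int where n: "Re (e y - e x) = 0" "Im (e y - e x) = of_int (2 * n) * pi"
        unfolding exp_eq_1 by blast
      have "n \<noteq> 0" using ne n by (auto simp: complex_eq_iff)
      then have "1 \<le> \<bar>real_of_int n\<bar>" by linarith
      then have "2 * pi \<le> \<bar>Im (e y - e x)\<bar>" unfolding n(2) by (simp add: abs_mult)
      also have "\<dots> \<le> norm (e y - e x)" by (rule abs_Im_le_cmod)
      finally show ?thesis .
    qed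
    then show "\<exists>r>0. \<forall>y. y \<in> UNIV \<and> e y \<noteq> e x \<longrightarrow> r \<le> norm (e y - e x)"
      using pi_gt_zero by (intro exI[of _ "2 * pi"]) auto
  qed
  then show ?thesis by auto
qed

text \<open>The orthonormal tangent frame of the unit sphere at
  \<open>(cis \<phi> * sin \<theta>, cos \<theta>)\<close>: \<open>1\<close> goes to the polar and
  \<open>\<i>\<close> to the azimuthal unit vector. At the poles it still is a frame of the
  horizontal plane, depending on \<open>\<phi>\<close>, with opposite senses of rotation at the two
  poles.\<close>

definition frame :: "real \<Rightarrow> real \<Rightarrow> complex \<Rightarrow> complex \<times> real" where
  "frame \<theta> \<phi> z = (cis \<phi> * Complex (Re z * cos \<theta>) (Im z), - Re z * sin \<theta>)"

lemma linear_frame: "linear (frame \<theta> \<phi>)"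
  by (rule linearI) (auto simp: frame_def complex_eq_iff algebra_simps)

lemma frame_eq_0: "frame \<theta> \<phi> z = 0 \<Longrightarrow> z = 0"
proof -
  assume "frame \<theta> \<phi> z = 0"
  then have "Complex (Re z * cos \<theta>) (Im z) = 0" "Re z * sin \<theta> = 0"
    by (auto simp: frame_def zero_prod_def)
  then have "Re z * cos \<theta> = 0" "Im z = 0" "Re z * sin \<theta> = 0"
    by (simp_all add: complex_eq_iff)
  moreover have "cos \<theta> \<noteq> 0 \<or> sin \<theta> \<noteq> 0"
    using sin_cos_squared_add[of \<theta>] by force
  ultimately show "z = 0" by (auto simp: complex_eq_iff)
qed

text \<open>
  Rotating the parametrization of a plane by \<open>\<phi>\<close> multiplies the coefficient by \<open>cis (- k \<phi>)\<close>. The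
  family \<open>frame \<theta>\<close> turns this rotation (at \<open>\<theta> = 0\<close>) into the opposite one (at \<open>\<theta> = \<pi>\<close>) through
  closed loops, so a nowhere vanishing coefficient would have winding numbers \<open>- k = k\<close>.
\<close>

theorem exists_plane_fourier_eq_0:
  fixes G :: "complex \<times> real \<Rightarrow> real"
  assumes G: "rnorm G" and k: "k > 0"
  obtains L where "linear L" "\<And>z. L z = 0 \<Longrightarrow> z = 0" "mom2 (\<lambda>z. G (L z)) = 0" "fourier k (\<lambda>z. G (L z)) = 0"
proof -
  define g where "g p z = G (frame (fst p) (snd p) z)" for p z
  have g: "rnorm (g p)" for p
    unfolding g_def by (rule rnorm_compose[OF G linear_frame frame_eq_0])
  define f where "f p z = g p (conf (isoq (g p)) z)" for p z
  have f: "rnorm (f p)" for p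
    unfolding f_def by (rule rnorm_conf[OF g norm_isoq[OF g]])
  have cg: "continuous_on UNIV (\<lambda>x. g (fst x) (snd x))"
    unfolding g_def frame_def
    by (rule continuous_on_compose2[OF rnorm_continuous[OF G]])
       (auto intro!: continuous_intros simp: Complex_eq)
  have cf: "continuous_on UNIV (\<lambda>x. f (fst x) (snd x))"
  proof -
    have q: "continuous_on UNIV (\<lambda>x. isoq (g (fst x)))"
      by (rule continuous_on_compose2[OF continuous_moments(3)[OF cg g] continuous_on_fst[OF continuous_on_id]]) simp
    have "continuous_on UNIV (\<lambda>x. g (fst (fst x, conf (isoq (g (fst x))) (snd x))) (snd (fst x, conf (isoq (g (fst x))) (snd x))))"
      unfolding conf_def
      by (rule continuous_on_compose2[OF cg]) (auto intro!: continuous_intros q)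
    then show ?thesis by (simp add: f_def)
  qed
  define C where "C p = fourier k (f p)" for p
  have cC: "continuous_on UNIV C"
    unfolding C_def by (rule continuous_moments(4)[OF cf f])
  have "\<exists>p. C p = 0"
  proof (rule ccontr)
    assume "\<nexists>p. C p = 0"
    \<comment> \<open>The angles range over the contractible space of pairs of reals, so a nowhere
      vanishing \<open>C\<close> has a continuous logarithm there.\<close>
    then obtain h where h: "continuous_on UNIV h" "\<And>p. C p = exp (h p)"
      using continuous_logarithm_on_contractible[OF cC contractible_UNIV] by (metis UNIV_I)
    have ch: "continuous_on UNIV (\<lambda>t. h (a t, b t))" if "continuous_on UNIV a" "continuous_on UNIV b" for a b :: "real \<Rightarrow> real"
      by (rule continuous_on_compose2[OF h(1)]) (auto intro!: continuous_on_Pair that)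
    have per: "C (t, 2 * pi) = C (t, 0)" for t
    proof -
      have "g (t, 2 * pi) = g (t, 0)" by (simp add: g_def frame_def fun_eq_iff)
      then have "f (t, 2 * pi) = f (t, 0)" by (intro ext) (simp only: f_def)
      then show ?thesis by (simp add: C_def)
    qed
    \<comment> \<open>For fixed \<open>\<theta>\<close> this increment is \<open>2 pi i\<close>
      times the winding number of the loop \<open>\<phi> \<mapsto> C (\<theta>, \<phi>)\<close>; it
      cannot change from one pole to the other.\<close>
    have "h (0, 2 * pi) - h (0, 0) = h (pi, 2 * pi) - h (pi, 0)"
      by (rule continuous_exp_one_constant[of "\<lambda>t. h (t, 2 * pi) - h (t, 0)"])
         (auto intro!: continuous_intros ch simp: exp_diff h(2)[symmetric] per, simp add: h(2))
    have wind: "h (t, 2 * pi) - h (t, 0) = - (\<i> * of_real (s * real k * (2 * pi)))"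
      if "\<And>\<phi>. C (t, \<phi>) = cis (- (real k * (s * \<phi>))) * C (t, 0)" for t s
    proof -
      \<comment> \<open>\<open>e\<close> removes from the logarithm the linear phase predicted by
        the rotation rule. What is left has exponential 1 and must be constant.\<close>
      define e where "e \<phi> = h (t, \<phi>) - h (t, 0) + \<i> * of_real (s * real k * \<phi>)" for \<phi>
      have "e (2 * pi) = e 0"
      proof (rule continuous_exp_one_constant)
        show "continuous_on UNIV e" unfolding e_def by (auto intro!: continuous_intros ch)
        fix \<phi>
        have "exp (e \<phi>) = C (t, \<phi>) / C (t, 0) * cis (s * real k * \<phi>)"
          unfolding e_def exp_add exp_diff h(2) cis_conv_exp ..
        also have "\<dots> = cis (- (real k * (s * \<phi>))) * cis (s * real k * \<phi>)"
          unfolding that[of \<phi>] by (simp add: h(2))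
        also have "\<dots> = 1" by (simp add: cis_mult mult_ac)
        finally show "exp (e \<phi>) = 1" .
      qed
      then show ?thesis by (simp add: e_def algebra_simps eq_neg_iff_add_eq_0)
    qed
    have rot: "C (t, \<phi>) = cis (- (real k * (s * \<phi>))) * C (t, 0)"
      if r: "rnorm r" "\<And>\<phi>. g (t, \<phi>) = (\<lambda>z. r (cis (s * \<phi>) * z))" for t s r \<phi>
    proof -
      have "C (t, \<phi>) = cis (- (real k * (s * \<phi>))) * fourier k (\<lambda>z. r (conf (isoq r) z))" for \<phi>
        unfolding C_def f_def r(2) by (rule fourier_isoq_rotate[OF r(1)])
      from this[of \<phi>] this[of 0] show ?thesis by simp
    qed
    have r0: "rnorm (\<lambda>z. G (z, 0))"
      by (rule rnorm_compose[OF G]) (auto intro!: linearI simp: zero_prod_def)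
    have rpi: "rnorm (\<lambda>z. G (- cnj z, 0))"
      by (rule rnorm_compose[OF G]) (auto intro!: linearI simp: zero_prod_def)
    have "Complex (Re z) (Im z) = z" "Complex (- Re z) (Im z) = - cnj z" for z
      by (simp_all add: complex_eq_iff)
    \<comment> \<open>The sign \<open>s\<close> is \<open>1\<close> at \<open>\<theta> = 0\<close>
      and \<open>-1\<close> at \<open>\<theta> = pi\<close>, where the reflection
      \<open>z \<mapsto> - cnj z\<close> reverses the rotation.\<close>
    then have "g (0, \<phi>) = (\<lambda>z. G (cis (1 * \<phi>) * z, 0))" "g (pi, \<phi>) = (\<lambda>z. G (- cnj (cis ((-1) * \<phi>) * z), 0))" for \<phi>
      by (auto simp: g_def frame_def fun_eq_iff cis_cnj)
    then have "C (0, \<phi>) = cis (- (real k * (1 * \<phi>))) * C (0, 0)"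
       "C (pi, \<phi>) = cis (- (real k * ((-1) * \<phi>))) * C (pi, 0)" for \<phi>
      by (intro rot[OF r0] rot[OF rpi]; simp)+
    from wind[OF this(1)] wind[OF this(2)]
      \<open>h (0, 2 * pi) - h (0, 0) = h (pi, 2 * pi) - h (pi, 0)\<close>
    have "complex_of_real (real k) * (4 * of_real pi * \<i>) = 0" by simp
    then show False using k by simp
  qed
  then obtain p where p: "C p = 0" by blast
  show thesis
  proof
    show "linear (\<lambda>z. frame (fst p) (snd p) (conf (isoq (g p)) z))"
      using linear_compose[OF linear_conf linear_frame] by (simp add: o_def)
    show "frame (fst p) (snd p) (conf (isoq (g p)) z) = 0 \<Longrightarrow> z = 0" for z
      using frame_eq_0 conf_eq_0[OF norm_isoq[OF g]] by blast
    show "mom2 (\<lambda>z. G (frame (fst p) (snd p) (conf (isoq (g p)) z))) = 0"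
      using mom2_isoq[OF g, of p] by (simp add: g_def)
    show "fourier k (\<lambda>z. G (frame (fst p) (snd p) (conf (isoq (g p)) z))) = 0"
    proof -
      have "f p = (\<lambda>z. G (frame (fst p) (snd p) (conf (isoq (g p)) z)))"
        by (intro ext) (simp add: f_def g_def)
      then show ?thesis using p by (simp add: C_def)
    qed
  qed
qed

section \<open>Norms with small Fourier coefficients\<close>

lemma circ_power_eq_0:
  assumes "m > 0" shows "circ (\<lambda>z. z ^ m) = 0"
proof -
  have "circ (\<lambda>z. (cis (pi / real m) * z) ^ m) = circ (\<lambda>z. z ^ m)"
    by (rule circ_rotate) (intro continuous_intros)
  moreover have "(cis (pi / real m) * z) ^ m = (-1) * z ^ m" for z
    using assms by (simp add: power_mult_distrib Complex.DeMoivre)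
  ultimately have "(-1) * circ (\<lambda>z. z ^ m) = circ (\<lambda>z. z ^ m)"
    unfolding circ_mult[symmetric] by simp
  then show ?thesis by simp
qed

lemma circ_sum:
  assumes "finite A" "\<And>j. j \<in> A \<Longrightarrow> continuous_on (- {0}) (F j)"
  shows "circ (\<lambda>z. \<Sum>j\<in>A. F j z) = (\<Sum>j\<in>A. circ (F j))"
  unfolding circ_def by (intro integral_sum assms circ_integrable)

lemma unit_power_cnj:
  assumes "norm (z::complex) = 1" "j \<le> n"
  shows "z ^ (n + j) * cnj z ^ (n - j) = z ^ (2 * j)" "z ^ (n - j) * cnj z ^ (n + j) = cnj (z ^ (2 * j))"
proof -
  have z: "z * cnj z = 1" using assms by (simp add: complex_norm_square[symmetric])
  have e: "n + j = 2 * j + (n - j)" using assms(2) by simp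
  have u: "z ^ (n - j) * cnj z ^ (n - j) = 1" by (simp add: power_mult_distrib[symmetric] z)
  have "z ^ (n + j) * cnj z ^ (n - j) = z ^ (2 * j) * (z ^ (n - j) * cnj z ^ (n - j))"
    unfolding e power_add by (simp add: mult.assoc)
  then show "z ^ (n + j) * cnj z ^ (n - j) = z ^ (2 * j)" by (simp add: u)
  have "z ^ (n - j) * cnj z ^ (n + j) = (z ^ (n - j) * cnj z ^ (n - j)) * cnj z ^ (2 * j)"
    unfolding e power_add by (simp add: mult_ac)
  then show "z ^ (n - j) * cnj z ^ (n + j) = cnj (z ^ (2 * j))" by (simp add: u)
qed

text \<open>The mean value of \<open>cos ^ (2 n)\<close> over the circle, as
  \<open>integral_cos_power\<close> confirms.\<close>

definition central :: "nat \<Rightarrow> real" where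
  "central n = real (2 * n choose n) / 4 ^ n"

lemma central_Suc: "central (Suc n) = central n * ((2 * real n + 1) / (2 * real n + 2))"
proof -
  have b: "real (2 * m choose m) = fact (2 * m) / (fact m * fact m)" for m
    using binomial_fact[of m "2 * m", where 'a = real] by simp
  show ?thesis
    unfolding central_def b by (simp add: divide_simps) (simp add: algebra_simps)
qed

lemma central_pos: "central n > 0"
  by (simp add: central_def)

text \<open>The quantity \<open>n * (central n)^2\<close> is nondecreasing and equals
  \<open>1/4\<close> at \<open>n = 1\<close>. So the total mass \<open>2 * pi * central n\<close> of
  the kernel is at least \<open>pi / sqrt n\<close>.\<close>

lemma central_ge: "n \<ge> 1 \<Longrightarrow> 1 \<le> 4 * real n * (central n)\<^sup>2"
proof (induction n rule: nat_induct_at_least)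
  case base
  then show ?case by (simp add: central_def power2_eq_square)
next
  case (Suc n)
  have "4 * real n * ((2 * real n + 2)\<^sup>2) \<le> 4 * real (Suc n) * (2 * real n + 1)\<^sup>2"
    by (simp add: power2_eq_square algebra_simps)
  then have "4 * real n \<le> 4 * real (Suc n) * ((2 * real n + 1) / (2 * real n + 2))\<^sup>2"
    by (simp add: power_divide pos_le_divide_eq)
  then have "4 * real n * (central n)\<^sup>2 \<le> 4 * real (Suc n) * ((2 * real n + 1) / (2 * real n + 2))\<^sup>2 * (central n)\<^sup>2"
    by (intro mult_right_mono) auto
  with Suc.IH show ?case
    unfolding central_Suc power_mult_distrib[of "central n"] mult.commute[of "(central n)\<^sup>2"] mult.assoc[symmetric]
    by (rule order_trans)
qed

lemma circ_cos_power:
  assumes F: "continuous_on (- {0}) F"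
  shows "circ (\<lambda>z. of_real (Re z ^ (2 * n)) * F z)
    = (\<Sum>j\<le>2 * n. of_real (real (2 * n choose j) / 4 ^ n) * circ (\<lambda>z. z ^ j * cnj z ^ (2 * n - j) * F z))"
proof -
  have "circ (\<lambda>z. of_real (Re z ^ (2 * n)) * F z)
    = circ (\<lambda>z. \<Sum>j\<le>2 * n. of_real (real (2 * n choose j) / 4 ^ n) * (z ^ j * cnj z ^ (2 * n - j) * F z))"
  proof (rule circ_cong)
    fix z
    have "complex_of_real (Re z) = (z + cnj z) / 2" by (simp add: complex_add_cnj)
    then have "complex_of_real (Re z ^ (2 * n)) = ((z + cnj z) / 2) ^ (2 * n)"
      by (simp only: of_real_power)
    also have "\<dots> = (z + cnj z) ^ (2 * n) / 4 ^ n"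
      by (simp only: power_divide power_mult[of 2]) simp
    also have "\<dots> = (\<Sum>j\<le>2 * n. of_real (real (2 * n choose j) / 4 ^ n) * (z ^ j * cnj z ^ (2 * n - j)))"
      unfolding binomial_ring by (simp add: sum_divide_distrib mult.assoc)
    finally show "of_real (Re z ^ (2 * n)) * F z
      = (\<Sum>j\<le>2 * n. of_real (real (2 * n choose j) / 4 ^ n) * (z ^ j * cnj z ^ (2 * n - j) * F z))"
      by (simp add: sum_distrib_right mult.assoc)
  qed
  also have "\<dots> = (\<Sum>j\<le>2 * n. circ (\<lambda>z. of_real (real (2 * n choose j) / 4 ^ n) * (z ^ j * cnj z ^ (2 * n - j) * F z)))"
    by (intro circ_sum) (auto intro!: continuous_intros F)
  finally show ?thesis by (simp only: circ_mult)
qed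

text \<open>In the binomial expansion only the middle term has frequency zero; the others meet the
  assumed bounds at frequencies \<open>2 k\<close> and \<open>- 2 k\<close>. Their weights are
  nonnegative with sum at most 1, so the error stays \<open>eps\<close> however large
  \<open>n\<close> is.\<close>

lemma circ_cos_power_approx:
  assumes F: "continuous_on (- {0}) F" and eps: "eps \<ge> 0"
    and le: "\<And>k. 1 \<le> k \<Longrightarrow> k \<le> n \<Longrightarrow> norm (circ (\<lambda>z. z ^ (2 * k) * F z)) \<le> eps"
    and le': "\<And>k. 1 \<le> k \<Longrightarrow> k \<le> n \<Longrightarrow> norm (circ (\<lambda>z. cnj (z ^ (2 * k)) * F z)) \<le> eps"
  shows "norm (circ (\<lambda>z. of_real (Re z ^ (2 * n)) * F z) - of_real (central n) * circ F) \<le> eps"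
proof -
  define c where "c j = circ (\<lambda>z. z ^ j * cnj z ^ (2 * n - j) * F z)" for j
  define b where "b j = real (2 * n choose j) / 4 ^ n" for j
  have b: "b j \<ge> 0" for j by (simp add: b_def)
  have cn: "c n = circ F"
    unfolding c_def by (rule circ_cong) (use unit_power_cnj(1)[of _ 0 n] in simp)
  have small: "norm (c j) \<le> eps" if j: "j \<le> 2 * n" "j \<noteq> n" for j
  proof (cases "j > n")
    case True
    define k where "k = j - n"
    have k: "j = n + k" "2 * n - j = n - k" "1 \<le> k" "k \<le> n" using j True by (auto simp: k_def)
    have "c j = circ (\<lambda>z. z ^ (2 * k) * F z)"
      unfolding c_def k(2) unfolding k(1) by (rule circ_cong) (simp only: unit_power_cnj(1)[OF _ k(4)])
    then show ?thesis using le k by simp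
  next
    case False
    define k where "k = n - j"
    have k: "j = n - k" "2 * n - j = n + k" "1 \<le> k" "k \<le> n" using j False by (auto simp: k_def)
    have "c j = circ (\<lambda>z. cnj (z ^ (2 * k)) * F z)"
      unfolding c_def k(2) unfolding k(1) by (rule circ_cong) (simp only: unit_power_cnj(2)[OF _ k(4)])
    then show ?thesis using le' k by simp
  qed
  have n: "n \<in> {..2 * n}" by simp
  have "circ (\<lambda>z. of_real (Re z ^ (2 * n)) * F z) = (\<Sum>j\<le>2 * n. of_real (b j) * c j)"
    unfolding b_def c_def by (rule circ_cos_power[OF F])
  also have "\<dots> = of_real (b n) * c n + (\<Sum>j\<in>{..2 * n} - {n}. of_real (b j) * c j)"
    by (rule sum.remove[OF finite_atMost n])
  finally have "norm (circ (\<lambda>z. of_real (Re z ^ (2 * n)) * F z) - of_real (central n) * circ F)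
    = norm (\<Sum>j\<in>{..2 * n} - {n}. of_real (b j) * c j)"
    unfolding cn by (simp add: b_def central_def)
  also have "\<dots> \<le> (\<Sum>j\<in>{..2 * n} - {n}. norm (of_real (b j) * c j))" by (rule norm_sum)
  also have "\<dots> \<le> (\<Sum>j\<in>{..2 * n} - {n}. b j * eps)"
    using b small by (intro sum_mono) (auto simp: norm_mult intro: mult_left_mono)
  also have "\<dots> \<le> (\<Sum>j\<le>2 * n. b j * eps)"
    using b eps by (intro sum_mono2) auto
  also have "\<dots> = (\<Sum>j\<le>2 * n. real (2 * n choose j)) / 4 ^ n * eps"
    by (simp add: b_def sum_distrib_right sum_divide_distrib)
  also have "(\<Sum>j\<le>2 * n. real (2 * n choose j)) = real (\<Sum>j\<le>2 * n. 2 * n choose j)" by simp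
  also have "\<dots> = 4 ^ n" by (simp only: choose_row_sum) (simp add: power_mult)
  finally show ?thesis by simp
qed

lemma integral_cos_power: "integral {0..2*pi} (\<lambda>t. Re (cis t) ^ (2 * n)) = 2 * pi * central n"
proof -
  \<comment> \<open>For the constant function every coefficient of nonzero frequency vanishes, so
    the approximation holds with error 0.\<close>
  have "norm (circ (\<lambda>z. of_real (Re z ^ (2 * n)) * 1) - of_real (central n) * circ (\<lambda>_. 1)) \<le> 0"
    by (rule circ_cos_power_approx[where F = "\<lambda>_. 1"])
       (auto simp: circ_power_eq_0 circ_cnj[where F = "\<lambda>z. z ^ m" for m] simp flip: complex_cnj_power)
  then have "circ (\<lambda>z. of_real (Re z ^ (2 * n))) = of_real (central n) * circ (\<lambda>_. 1)" by simp
  also have "circ (\<lambda>z. of_real (Re z ^ (2 * n))) = of_real (integral {0..2*pi} (\<lambda>t. Re (cis t) ^ (2 * n)))"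
    by (rule circ_of_real) (intro continuous_intros)
  also have "circ (\<lambda>_. 1) = of_real (2 * pi)" by (simp add: circ_def scaleR_conv_of_real)
  finally have "complex_of_real (integral {0..2*pi} (\<lambda>t. Re (cis t) ^ (2 * n))) = of_real (central n * (2 * pi))"
    by simp
  then show ?thesis by (simp only: of_real_eq_iff) simp
qed

text \<open>The kernel peaks at both \<open>1\<close> and \<open>-1\<close>. Since \<open>f\<close>
  is even, the half-circle around \<open>-1\<close> reduces to that around \<open>1\<close>, where
  the chord to \<open>1\<close> has length at most \<open>2 * \<bar>Im z\<bar>\<close>.\<close>

lemma rnorm_diff_one_le:
  assumes f: "rnorm f" and M: "\<And>z. f z \<le> M * norm z" and z: "norm z = 1"
  shows "\<bar>f z - f 1\<bar> \<le> 2 * M * \<bar>Im z\<bar>"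
proof -
  have M0: "M \<ge> 0" using M[of 1] rnormD(1)[OF f, of 1] by simp
  have n1: "(Re z)\<^sup>2 + (Im z)\<^sup>2 = 1" using z by (simp add: cmod_power2[symmetric])
  have *: "\<bar>f w - f 1\<bar> \<le> 2 * M * \<bar>Im w\<bar>" if w: "(Re w)\<^sup>2 + (Im w)\<^sup>2 = 1" "Re w \<ge> 0" for w
  proof -
    have "(norm (w - 1))\<^sup>2 = 2 * (1 - Re w)"
      using w unfolding cmod_power2 by (simp add: power2_eq_square algebra_simps)
    also have "\<dots> \<le> 2 * ((1 - Re w) * (1 + Re w))"
    proof -
      have "(Re w)\<^sup>2 \<le> 1\<^sup>2" unfolding power_one using w(1) zero_le_power2[of "Im w"] by linarith
      then have "Re w \<le> 1" by (rule power2_le_imp_le) simp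
      then have "0 \<le> (1 - Re w) * Re w" using w by simp
      then show ?thesis by (simp add: algebra_simps)
    qed
    also have "\<dots> = 2 * (Im w)\<^sup>2" using w by (simp add: power2_eq_square algebra_simps)
    also have "\<dots> \<le> (2 * \<bar>Im w\<bar>)\<^sup>2" by (simp add: power_mult_distrib)
    finally have "norm (w - 1) \<le> 2 * \<bar>Im w\<bar>" by (rule power2_le_imp_le) simp
    then have "M * norm (w - 1) \<le> M * (2 * \<bar>Im w\<bar>)" using M0 by (intro mult_left_mono)
    then show ?thesis using rnorm_diff[OF f, of w 1] M[of "w - 1"] by (simp add: mult_ac)
  qed
  show ?thesis
  proof (cases "Re z \<ge> 0")
    case True then show ?thesis using * n1 by blast
  next
    case False
    then have "\<bar>f (- z) - f 1\<bar> \<le> 2 * M * \<bar>Im (- z)\<bar>" using n1 by (intro *) auto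
    then show ?thesis by (simp add: rnorm_minus[OF f])
  qed
qed

text \<open>The integral of \<open>f\<close> against the kernel is estimated twice: it is within
  \<open>eps\<close> of \<open>r * W\<close> because the coefficients are small, and close to
  \<open>W * f 1\<close> because the kernel concentrates where \<open>f\<close> is close to
  \<open>f 1\<close>. Division by the mass \<open>W\<close> finishes the proof.\<close>

lemma near_mean_at_one:
  assumes f: "rnorm f" and M: "\<And>z. f z \<le> M * norm z" and n: "n \<ge> 1" and eps: "eps \<ge> 0"
    and c: "\<And>k. 1 \<le> k \<Longrightarrow> norm (fourier k f) \<le> eps"
  shows "\<bar>f 1 - Re (fourier 0 f) / (2 * pi)\<bar> \<le> eps * sqrt (real n) / pi + 2 * M / sqrt (real n)"
proof -
  have M0: "M \<ge> 0" using M[of 1] rnormD(1)[OF f, of 1] by simp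
  have cont: "continuous_on S f" for S by (rule rnorm_continuous[OF f])
  have cF: "continuous_on (- {0}) (\<lambda>z. complex_of_real (f z))" by (intro continuous_intros cont)
  define r where "r = Re (fourier 0 f) / (2 * pi)"
  define K where "K z = Re z ^ (2 * n)" for z
  have K0: "K z \<ge> 0" for z by (simp add: K_def)
  have cK: "continuous_on S K" for S unfolding K_def by (intro continuous_intros)
  define W where "W = 2 * pi * central n"
  have W: "W > 0" using central_pos[of n] by (simp add: W_def)
  have IK: "((\<lambda>t. K (cis t)) has_integral W) {0..2*pi}"
    using integrable_integral[OF circ_integrable[OF cK, of 0 "2*pi"]] integral_cos_power[of n]
    unfolding K_def W_def by simp
  have f0: "circ (\<lambda>z. of_real (f z)) = of_real (2 * pi * r)"
    using circ_of_real[OF cont] by (simp add: r_def fourier_def)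
  have "norm (circ (\<lambda>z. of_real (Re z ^ (2 * n)) * of_real (f z)) - of_real (central n) * circ (\<lambda>z. of_real (f z))) \<le> eps"
  proof (rule circ_cos_power_approx[OF cF eps])
    fix k :: nat assume k: "1 \<le> k"
    show "norm (circ (\<lambda>z. z ^ (2 * k) * of_real (f z))) \<le> eps"
      using c[of "2 * k"] k by (simp add: fourier_def)
    have "circ (\<lambda>z. cnj (z ^ (2 * k)) * of_real (f z)) = cnj (fourier (2 * k) f)"
      unfolding fourier_def circ_cnj[symmetric] by simp
    then show "norm (circ (\<lambda>z. cnj (z ^ (2 * k)) * of_real (f z))) \<le> eps"
      using c[of "2 * k"] k by simp
  qed
  also have "circ (\<lambda>z. of_real (Re z ^ (2 * n)) * of_real (f z)) = circ (\<lambda>z. of_real (K z * f z))"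
    by (simp add: K_def)
  also have "circ (\<lambda>z. of_real (K z * f z)) = of_real (integral {0..2*pi} (\<lambda>t. K (cis t) * f (cis t)))"
    by (rule circ_of_real) (intro continuous_intros cK cont)
  also have "of_real (integral {0..2*pi} (\<lambda>t. K (cis t) * f (cis t))) - of_real (central n) * circ (\<lambda>z. of_real (f z))
     = complex_of_real (integral {0..2*pi} (\<lambda>t. K (cis t) * f (cis t)) - r * W)"
    unfolding f0 by (simp add: W_def mult_ac)
  finally have 1: "\<bar>integral {0..2*pi} (\<lambda>t. K (cis t) * f (cis t)) - r * W\<bar> \<le> eps"
    by (simp only: norm_of_real)
  define l where "l = sqrt (real n)"
  have l: "l > 0" "l * l = real n" using n by (simp_all add: l_def)
  \<comment> \<open>As \<open>sin^2 = 1 - cos^2\<close>, the second moment of the kernel is the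
    difference of two consecutive masses.\<close>
  have IK2: "((\<lambda>t. K (cis t) * (Im (cis t))\<^sup>2) has_integral W / (2 * real n + 2)) {0..2*pi}"
  proof -
    have "integral {0..2*pi} (\<lambda>t. Re (cis t) ^ (2 * Suc n)) = W * ((2 * real n + 1) / (2 * real n + 2))"
      unfolding integral_cos_power central_Suc W_def by simp
    then have "((\<lambda>t. Re (cis t) ^ (2 * Suc n)) has_integral W * ((2 * real n + 1) / (2 * real n + 2))) {0..2*pi}"
      using integrable_integral[OF circ_integrable[of "\<lambda>z. Re z ^ (2 * Suc n)", OF continuous_on_power[OF continuous_on_Re[OF continuous_on_id]]], of 0 "2*pi"]
      by (simp only:)
    from has_integral_diff[OF IK this]
    have "((\<lambda>t. K (cis t) - Re (cis t) ^ (2 * Suc n)) has_integral W - W * ((2 * real n + 1) / (2 * real n + 2))) {0..2*pi}" .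
    moreover have "K (cis t) - Re (cis t) ^ (2 * Suc n) = K (cis t) * (Im (cis t))\<^sup>2" for t
    proof -
      have "cos t ^ (2 * Suc n) = cos t ^ (2 * n) * (cos t)\<^sup>2" by (simp add: power_add power2_eq_square)
      moreover have "(sin t)\<^sup>2 = 1 - (cos t)\<^sup>2" by (rule sin_squared_eq)
      ultimately show ?thesis by (simp only: K_def cis.sel right_diff_distrib mult_1_right)
    qed
    moreover have "W - W * ((2 * real n + 1) / (2 * real n + 2)) = W / (2 * real n + 2)"
      by (simp add: field_simps)
    ultimately show ?thesis by (simp only:)
  qed
  have IF: "((\<lambda>t. K (cis t) * f (cis t)) has_integral integral {0..2*pi} (\<lambda>t. K (cis t) * f (cis t))) {0..2*pi}"
    by (intro integrable_integral circ_integrable[of "\<lambda>z. K z * f z"] continuous_intros cK cont)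
  have I2: "((\<lambda>t. K (cis t) * f 1 - K (cis t) * f (cis t)) has_integral
      W * f 1 - integral {0..2*pi} (\<lambda>t. K (cis t) * f (cis t))) {0..2*pi}"
    by (intro has_integral_diff has_integral_mult_left IK IF)
  have I3: "((\<lambda>t. M * (l * (K (cis t) * (Im (cis t))\<^sup>2) + (1 / l) * K (cis t))) has_integral
      M * (l * (W / (2 * real n + 2)) + (1 / l) * W)) {0..2*pi}"
    by (intro has_integral_mult_right has_integral_add IK IK2)
  have "norm (W * f 1 - integral {0..2*pi} (\<lambda>t. K (cis t) * f (cis t))) \<le> M * (l * (W / (2 * real n + 2)) + (1 / l) * W)"
    unfolding integral_unique[OF I2, symmetric] integral_unique[OF I3, symmetric]
  proof (rule integral_norm_bound_integral)
    fix t
    \<comment> \<open>The Lipschitz bound is traded for a quadratic one, whose integral against the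
      kernel is explicit; \<open>1 / l = 1 / sqrt n\<close> is the width of the kernel.\<close>
    have "2 * \<bar>Im (cis t)\<bar> \<le> l * (Im (cis t))\<^sup>2 + 1 / l"
    proof -
      have "0 \<le> (l * \<bar>Im (cis t)\<bar> - 1)\<^sup>2 / l" using l by simp
      also have "\<dots> = l * (Im (cis t))\<^sup>2 + 1 / l - 2 * \<bar>Im (cis t)\<bar>"
        using l by (simp add: power2_eq_square field_simps)
      finally show ?thesis by simp
    qed
    then have "M * (2 * \<bar>Im (cis t)\<bar>) \<le> M * (l * (Im (cis t))\<^sup>2 + 1 / l)" using M0 by (rule mult_left_mono)
    then have "\<bar>f (cis t) - f 1\<bar> \<le> M * (l * (Im (cis t))\<^sup>2 + 1 / l)"
      using rnorm_diff_one_le[OF f M, of "cis t"] by (simp add: mult_ac)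
    then have "K (cis t) * \<bar>f (cis t) - f 1\<bar> \<le> K (cis t) * (M * (l * (Im (cis t))\<^sup>2 + 1 / l))"
      using K0 by (rule mult_left_mono)
    moreover have "norm (K (cis t) * f 1 - K (cis t) * f (cis t)) = K (cis t) * \<bar>f (cis t) - f 1\<bar>"
      unfolding right_diff_distrib[symmetric] real_norm_def abs_mult using K0[of "cis t"] by (simp add: abs_minus_commute)
    ultimately show "norm (K (cis t) * f 1 - K (cis t) * f (cis t)) \<le> M * (l * (K (cis t) * (Im (cis t))\<^sup>2) + (1 / l) * K (cis t))"
      by (simp add: algebra_simps)
  qed (use I2 I3 in \<open>auto simp: has_integral_integrable\<close>)
  then have "\<bar>W * f 1 - r * W\<bar> \<le> eps + M * (l * (W / (2 * real n + 2)) + (1 / l) * W)"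
    using 1 by simp
  also have "M * (l * (W / (2 * real n + 2)) + (1 / l) * W) \<le> (2 * M / l) * W"
  proof -
    have "l / (2 * real n + 2) \<le> 1 / l"
      using l by (simp add: divide_simps)
    then have "l / (2 * real n + 2) + 1 / l \<le> 2 / l" by simp
    then have "M * W * (l / (2 * real n + 2) + 1 / l) \<le> M * W * (2 / l)"
      using M0 W by (intro mult_left_mono) auto
    then show ?thesis by (simp add: algebra_simps)
  qed
  also have "eps \<le> (eps * l / pi) * W"
  proof -
    have "(2 * l * central n)\<^sup>2 = 4 * (l * l) * (central n)\<^sup>2" by (simp add: power2_eq_square)
    then have "1 \<le> (2 * l * central n)\<^sup>2" using central_ge[OF n] unfolding l(2) by simp
    then have "1 \<le> 2 * l * central n"
      using power2_le_imp_le[of 1 "2 * l * central n"] l central_pos[of n] by simp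
    then have "eps * 1 \<le> eps * (2 * l * central n)" using eps by (rule mult_left_mono)
    then show ?thesis by (simp add: W_def mult_ac)
  qed
  finally have "\<bar>W * f 1 - r * W\<bar> \<le> eps * l / pi * W + 2 * M / l * W" by simp
  moreover have "W * f 1 - r * W = (f 1 - r) * W" by (simp add: algebra_simps)
  ultimately have "\<bar>f 1 - r\<bar> * W \<le> (eps * l / pi + 2 * M / l) * W"
    using W by (simp add: abs_mult distrib_right)
  then show ?thesis using W unfolding r_def l_def by (rule mult_right_le_imp_le)
qed

lemma near_mean:
  assumes f: "rnorm f" and M: "\<And>z. f z \<le> M * norm z" and n: "n \<ge> 1" and eps: "eps \<ge> 0"
    and c: "\<And>k. 1 \<le> k \<Longrightarrow> norm (fourier k f) \<le> eps" and z: "norm z = 1"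
  shows "\<bar>f z - Re (fourier 0 f) / (2 * pi)\<bar> \<le> eps * sqrt (real n) / pi + 2 * M / sqrt (real n)"
proof -
  obtain a where a: "z = cis a" using z by (metis cis_Arg norm_eq_zero sgn_div_norm div_by_1 scaleR_one inverse_1 zero_neq_one)
  define h where "h w = f (cis a * w)" for w
  have h: "rnorm h"
    unfolding h_def by (rule rnorm_compose[OF f]) (auto intro!: linearI simp: algebra_simps)
  have fh: "fourier k h = cis (- (real k * a)) * fourier k f" for k
    using fourier_rotate[OF f, of 1 k a] by (simp add: h_def[abs_def])
  have "\<bar>h 1 - Re (fourier 0 h) / (2 * pi)\<bar> \<le> eps * sqrt (real n) / pi + 2 * M / sqrt (real n)"
  proof (rule near_mean_at_one[OF h _ n eps])
    show "h w \<le> M * norm w" for w using M[of "cis a * w"] by (simp add: h_def norm_mult)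
    show "norm (fourier k h) \<le> eps" if "1 \<le> k" for k using c[OF that] by (simp add: fh norm_mult)
  qed
  then show ?thesis unfolding fh by (simp add: h_def a)
qed

section \<open>Transfer of vanishing coefficients between sections\<close>

lemma linear_complex_form:
  fixes A :: "complex \<Rightarrow> complex"
  assumes "linear A"
  obtains p q where "\<And>z. A z = p * z + q * cnj z"
proof
  fix z
  have "A z = A (Re z *\<^sub>R 1 + Im z *\<^sub>R \<i>)"
    by (rule arg_cong[where f = A]) (simp add: complex_eq_iff)
  also have "\<dots> = of_real (Re z) * A 1 + of_real (Im z) * A \<i>"
    unfolding linear_add[OF assms] linear_scale[OF assms] by (simp add: scaleR_conv_of_real)
  also have "\<dots> = (A 1 - \<i> * A \<i>) / 2 * z + (A 1 + \<i> * A \<i>) / 2 * cnj z"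
    by (auto simp: complex_eq_iff field_simps)
  finally show "A z = (A 1 - \<i> * A \<i>) / 2 * z + (A 1 + \<i> * A \<i>) / 2 * cnj z" .
qed

text \<open>Composing \<open>g'\<close> with division by \<open>p\<close> is conformal, hence
  preserves \<open>mom2 g' = 0\<close> and the vanishing coefficient, and it turns
  \<open>p z + q cnj z\<close> into \<open>conf (q / cnj p)\<close>.\<close>

lemma fourier_le_of_linear_close_aux:
  assumes g: "rnorm g" "mom2 g = 0" and g': "rnorm g'" "mom2 g' = 0" and q: "norm q < norm p"
    and d: "0 \<le> d" "d \<le> 1" and lo: "\<And>z. g' z \<le> g (p * z + q * cnj z)"
    and hi: "\<And>z. g (p * z + q * cnj z) \<le> (1 + d) * g' z"
    and M: "\<And>z. g z \<le> M * norm z" and k: "fourier k g' = 0"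
  shows "norm (fourier k g) \<le> 34 * pi * d * M"
proof -
  define r where "r = 1 / norm p"
  have p: "p \<noteq> 0" using q by auto
  have r: "r > 0" using p by (simp add: r_def)
  define h where "h w = g' (of_real r * (cis (- Arg p) * w))" for w
  have "of_real r * cis (- Arg p) = 1 / p"
  proof -
    have "p = of_real (norm p) * cis (Arg p)" using rcis_cmod_Arg[of p] by (simp add: rcis_def)
    then have "1 / p = 1 / (of_real (norm p) * cis (Arg p))" by simp
    also have "\<dots> = of_real r * cis (- Arg p)" by (simp add: r_def cis_inverse[symmetric] field_simps)
    finally show ?thesis by simp
  qed
  then have h_eq: "h w = g' (w / p)" for w unfolding h_def by (simp add: mult.assoc[symmetric])
  have h: "rnorm h"
    unfolding h_eq by (rule rnorm_compose[OF g'(1)]) (use p in \<open>auto intro!: linearI simp: add_divide_distrib scaleR_conv_of_real\<close>)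
  have m2: "mom2 h = 0" using mom2_rotate[OF g'(1) r, of "- Arg p"] by (simp add: h_def[abs_def] g'(2))
  have fh: "fourier k h = 0" using fourier_rotate[OF g'(1) r, of k "- Arg p"] by (simp add: h_def[abs_def] k)
  have e: "p * (w / p) + q * cnj (w / p) = conf (q / cnj p) w" for w
    using p by (simp add: conf_def)
  show ?thesis
  proof (rule fourier_le_of_isotropic[OF g h m2 _ d _ _ M fh])
    show "norm (q / cnj p) < 1" using q p by (simp add: norm_divide)
    show "h w \<le> g (conf (q / cnj p) w)" for w unfolding h_eq e[symmetric] by (rule lo)
    show "g (conf (q / cnj p) w) \<le> (1 + d) * h w" for w unfolding h_eq e[symmetric] by (rule hi)
  qed
qed

text \<open>The determinant of \<open>A\<close> is \<open>|p|^2 - |q|^2\<close>. A positive sign is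
  the normalized case, a negative one reduces to it by conjugation, and zero is excluded because
  \<open>lo\<close> makes \<open>A\<close> injective.\<close>

lemma fourier_le_of_linear_close:
  assumes g: "rnorm g" "mom2 g = 0" and g': "rnorm g'" "mom2 g' = 0" and A: "linear A"
    and d: "0 \<le> d" "d \<le> 1" and lo: "\<And>z. g' z \<le> g (A z)"
    and hi: "\<And>z. g (A z) \<le> (1 + d) * g' z"
    and M: "\<And>z. g z \<le> M * norm z" and k: "fourier k g' = 0"
  shows "norm (fourier k g) \<le> 34 * pi * d * M"
proof -
  obtain p q where pq: "\<And>z. A z = p * z + q * cnj z" using linear_complex_form[OF A] by blast
  have inj: "z = 0" if "A z = 0" for z
    using lo[of z] that rnormD(1)[OF g'(1), of z] rnormD(2)[OF g'(1), of z] rnorm_zero[OF g(1)] by simp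
  consider "norm q < norm p" | "norm p < norm q" | "norm p = norm q" by linarith
  then show ?thesis
  proof cases
    case 1
    then show ?thesis using lo hi unfolding pq by (intro fourier_le_of_linear_close_aux[OF g g' _ d _ _ M k])
  next
    case 2
    define h where "h z = g' (cnj z)" for z
    have h: "rnorm h"
      unfolding h_def by (rule rnorm_compose[OF g'(1)]) (auto intro!: linearI)
    have m2: "mom2 h = 0" using mom2_cnj[OF g'(1)] by (simp add: h_def[abs_def] g'(2))
    have fh: "fourier k h = 0" using fourier_cnj[OF g'(1)] by (simp add: h_def[abs_def] k)
    have e: "q * z + p * cnj z = A (cnj z)" for z by (simp add: pq)
    show ?thesis
      by (rule fourier_le_of_linear_close_aux[OF g h m2 2 d _ _ M fh]) (simp_all add: e h_def lo hi)
  next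
    case 3
    have "p \<noteq> 0"
    proof
      assume "p = 0"
      then have "A 1 = 0" using 3 by (simp add: pq)
      then show False using inj[of 1] by simp
    qed
    then have "q \<noteq> 0" using 3 by auto
    \<comment> \<open>A unit vector in the kernel: \<open>A z * z = p * z^2 + q = 0\<close> when
      \<open>z^2 = - q / p\<close>.\<close>
    define z where "z = csqrt (- q / p)"
    have z2: "z\<^sup>2 = - q / p" by (simp add: z_def)
    have "norm z ^ 2 = 1" unfolding norm_power[symmetric] z2 using 3 \<open>p \<noteq> 0\<close> \<open>q \<noteq> 0\<close> by (simp add: norm_divide)
    then have nz: "z * cnj z = 1" by (simp add: complex_norm_square[symmetric] flip: of_real_power)
    have "A z * z = p * z\<^sup>2 + q * (z * cnj z)" by (simp add: pq power2_eq_square algebra_simps)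
    also have "\<dots> = 0" unfolding z2 nz using \<open>p \<noteq> 0\<close> by simp
    finally have "A z * z = 0" .
    moreover have "z \<noteq> 0" using nz by auto
    ultimately show ?thesis using inj[of z] by simp
  qed
qed

text \<open>The plane \<open>L\<close> with vanishing coefficient depends on \<open>k\<close>, but
  each one is compared with the same section \<open>g\<close>. Undoing \<open>conf (isoq g)\<close>
  in the comparison map \<open>A\<close> puts \<open>g\<close> in isotropic position, as the
  comparison requires.\<close>

theorem fourier_le_of_close_sections:
  assumes G: "rnorm (G :: complex \<times> real \<Rightarrow> real)" and g: "rnorm g" and d: "0 \<le> d" "d \<le> 1"
    and close: "\<And>L :: complex \<Rightarrow> complex \<times> real. linear L \<Longrightarrow> (\<And>z. L z = 0 \<Longrightarrow> z = 0) \<Longrightarrow>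
      \<exists>A. linear A \<and> (\<forall>z. G (L z) \<le> g (A z) \<and> g (A z) \<le> (1 + d) * G (L z))"
    and M: "\<And>z. g (conf (isoq g) z) \<le> M * norm z" and k: "k \<ge> 1"
  shows "norm (fourier k (\<lambda>z. g (conf (isoq g) z))) \<le> 34 * pi * d * M"
proof -
  obtain L where L: "linear L" "\<And>z. L z = 0 \<Longrightarrow> z = 0" "mom2 (\<lambda>z. G (L z)) = 0" "fourier k (\<lambda>z. G (L z)) = 0"
    using exists_plane_fourier_eq_0[OF G, of k] k by auto
  then obtain A where A: "linear A" "\<And>z. G (L z) \<le> g (A z)" "\<And>z. g (A z) \<le> (1 + d) * G (L z)"
    using close[of L] by blast
  define q where "q = isoq g"
  have q: "norm q < 1" unfolding q_def by (rule norm_isoq[OF g])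
  define D where "D = 1 - (norm q)\<^sup>2"
  have D: "D > 0" unfolding D_def by (rule one_minus_norm_pos[OF q])
  define B where "B z = (1 / D) *\<^sub>R conf (- q) (A z)" for z
  have B: "linear B"
    unfolding B_def using linear_compose_scale_right[OF linear_compose[OF A(1) linear_conf], of "1 / D" "- q"]
    by (simp add: o_def)
  have AB: "conf q (B z) = A z" for z
    using conf_conf_inverse[of "- q" "A z"] D
    unfolding B_def linear_scale[OF linear_conf] by (simp add: D_def[symmetric] scaleR_conv_of_real)
  show ?thesis
  proof (rule fourier_le_of_linear_close[OF rnorm_conf[OF g norm_isoq[OF g]] mom2_isoq[OF g] _ L(3) B d _ _ M L(4)])
    show "rnorm (\<lambda>z. G (L z))" by (rule rnorm_compose[OF G L(1,2)])
  qed (use A AB in \<open>simp_all add: q_def\<close>)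
qed

text \<open>\<open>near_mean\<close> is applied with the maximum \<open>M\<close> of the norm on the
  circle as Lipschitz constant; the result is made relative to the mean radius \<open>r\<close> only
  afterwards.\<close>

theorem near_disc_of_close_sections:
  assumes G: "rnorm (G :: complex \<times> real \<Rightarrow> real)" and g: "rnorm g" and d: "0 < d" "204 * sqrt d \<le> 1"
    and close: "\<And>L :: complex \<Rightarrow> complex \<times> real. linear L \<Longrightarrow> (\<And>z. L z = 0 \<Longrightarrow> z = 0) \<Longrightarrow>
      \<exists>A. linear A \<and> (\<forall>z. G (L z) \<le> g (A z) \<and> g (A z) \<le> (1 + d) * G (L z))"
  obtains r where "r > 0" "\<And>z. norm z = 1 \<Longrightarrow> \<bar>g (conf (isoq g) z) - r\<bar> \<le> 102 * sqrt d * r"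
proof -
  define f where "f z = g (conf (isoq g) z)" for z
  have f: "rnorm f" unfolding f_def by (rule rnorm_conf[OF g norm_isoq[OF g]])
  have sd: "sqrt d \<le> 1 / 204" "sqrt d > 0" using d by auto
  have d1: "d \<le> 1"
    using sd real_sqrt_le_1_iff[of d] by linarith
  obtain z0 where z0: "norm z0 = 1" "\<And>z. norm z = 1 \<Longrightarrow> f z \<le> f z0"
    using continuous_attains_sup[of "sphere 0 1" f] rnorm_continuous[OF f] by auto
  define M where "M = f z0"
  have M0: "M > 0" unfolding M_def using z0 by (intro rnorm_pos[OF f]) auto
  have M: "f z \<le> M * norm z" for z
  proof (cases "z = 0")
    case False
    have "f (of_real (norm z) * (z / of_real (norm z))) = norm z * f (z / of_real (norm z))"
      using rnormD(3)[OF f, of "norm z" "z / of_real (norm z)"] by (simp only: scaleR_conv_of_real abs_norm_cancel)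
    then have "f z = norm z * f (z / of_real (norm z))" using False by simp
    also have "\<dots> \<le> norm z * M"
      unfolding M_def using False by (intro mult_left_mono z0) (auto simp: norm_divide)
    finally show ?thesis by (simp add: mult.commute)
  qed (simp add: rnorm_zero[OF f])
  \<comment> \<open>The choice that balances \<open>34 * d * sqrt n\<close> against
    \<open>2 / sqrt n\<close>; with \<open>n \<le> 2 / d\<close> they are at most
    \<open>49 * sqrt d\<close> and \<open>2 * sqrt d\<close>.\<close>
  define n where "n = nat \<lceil>1 / d\<rceil>"
  have n: "1 / d \<le> real n" "real n \<le> 2 / d"
  proof -
    show "1 / d \<le> real n" unfolding n_def by linarith
    have "1 \<le> 1 / d" using d d1 by simp
    moreover have "real n \<le> 1 / d + 1"
      using of_int_ceiling_le_add_one[of "1 / d"] \<open>1 \<le> 1 / d\<close> unfolding n_def by simp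
    ultimately show "real n \<le> 2 / d" by (simp add: field_simps)
  qed
  have n1: "n \<ge> 1"
  proof -
    have "0 < 1 / d" using d by simp
    then show ?thesis using n(1) by linarith
  qed
  define r where "r = Re (fourier 0 f) / (2 * pi)"
  have near: "\<bar>f z - r\<bar> \<le> 51 * sqrt d * M" if z: "norm z = 1" for z
  proof -
    have "\<bar>f z - r\<bar> \<le> 34 * pi * d * M * sqrt (real n) / pi + 2 * M / sqrt (real n)"
      unfolding r_def
    proof (rule near_mean[OF f M n1 _ _ z])
      show "0 \<le> 34 * pi * d * M" using d M0 by simp
      fix k :: nat assume "1 \<le> k"
      then show "norm (fourier k f) \<le> 34 * pi * d * M"
        unfolding f_def using d d1 M by (intro fourier_le_of_close_sections[OF G g _ _ close]) (auto simp: f_def)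
    qed
    also have "34 * pi * d * M * sqrt (real n) / pi = 34 * d * sqrt (real n) * M" by simp
    also have "34 * d * sqrt (real n) * M \<le> 49 * sqrt d * M"
    proof (rule mult_right_mono)
      have "sqrt (real n) \<le> sqrt 2 / sqrt d"
        using n(2) by (simp add: real_sqrt_divide[symmetric])
      also have "sqrt 2 \<le> (71 / 50)" by (rule real_le_lsqrt) (auto simp: power2_eq_square)
      finally have "sqrt (real n) \<le> (71 / 50) / sqrt d" using sd by (simp add: divide_right_mono)
      then have "34 * d * sqrt (real n) \<le> 34 * d * ((71 / 50) / sqrt d)" using d by (intro mult_left_mono) auto
      also have "\<dots> = 34 * (71 / 50) * (d / sqrt d)" by simp
      also have "d / sqrt d = sqrt d" using d by (simp add: real_div_sqrt)
      finally show "34 * d * sqrt (real n) \<le> 49 * sqrt d" using sd by linarith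
    qed (use M0 in simp)
    also have "2 * M / sqrt (real n) \<le> 2 * sqrt d * M"
    proof -
      have "1 / sqrt d \<le> sqrt (real n)"
        using real_sqrt_le_mono[OF n(1)] by (simp add: real_sqrt_divide)
      then have "1 / sqrt (real n) \<le> sqrt d" using sd n1 by (simp add: field_simps)
      then have "2 * M * (1 / sqrt (real n)) \<le> 2 * M * sqrt d" using M0 by (intro mult_left_mono) auto
      then show ?thesis by (simp add: mult_ac)
    qed
    finally show ?thesis by (simp add: algebra_simps)
  qed
  \<comment> \<open>The error bound contains \<open>M\<close> itself. At the maximum point it gives
    \<open>M - r \<le> M / 4\<close>, as \<open>51 * sqrt d \<le> 51 / 204\<close>, so
    \<open>M\<close> can be replaced by \<open>2 * r\<close>.\<close>
  have "M - r \<le> 51 * sqrt d * M" using near[OF z0(1)] unfolding M_def by linarith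
  also have "\<dots> \<le> 1 / 4 * M" using sd M0 by (intro mult_right_mono) auto
  finally have Mr: "M \<le> 2 * r" "r > 0" using M0 by linarith+
  show thesis
  proof
    fix z :: complex assume "norm z = 1"
    then have "\<bar>f z - r\<bar> \<le> 51 * sqrt d * M" by (rule near)
    also have "\<dots> \<le> 51 * sqrt d * (2 * r)" using Mr sd by (intro mult_left_mono) auto
    finally show "\<bar>g (conf (isoq g) z) - r\<bar> \<le> 102 * sqrt d * r" by (simp add: f_def)
  qed (rule Mr)
qed

theorem near_quadratic_of_close_sections:
  assumes G: "rnorm (G :: complex \<times> real \<Rightarrow> real)" and g: "rnorm g" and d: "0 < d" "204 * sqrt d \<le> 1"
    and close: "\<And>L :: complex \<Rightarrow> complex \<times> real. linear L \<Longrightarrow> (\<And>z. L z = 0 \<Longrightarrow> z = 0) \<Longrightarrow>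
      \<exists>A. linear A \<and> (\<forall>z. G (L z) \<le> g (A z) \<and> g (A z) \<le> (1 + d) * G (L z))"
  shows "\<exists>P B R. \<forall>s t. (1 - 255 * sqrt d) * quad P B R s t \<le> (g (Complex s t))\<^sup>2 \<and>
     (g (Complex s t))\<^sup>2 \<le> (1 + 255 * sqrt d) * quad P B R s t"
proof -
  obtain r where r: "r > 0" "\<And>z. norm z = 1 \<Longrightarrow> \<bar>g (conf (isoq g) z) - r\<bar> \<le> 102 * sqrt d * r"
    using near_disc_of_close_sections[OF G g d close] by blast
  define q where "q = isoq g"
  have q: "norm q < 1" unfolding q_def by (rule norm_isoq[OF g])
  define D where "D = 1 - (norm q)\<^sup>2"
  have D: "D > 0" unfolding D_def by (rule one_minus_norm_pos[OF q])
  define k where "k = 102 * sqrt d"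
  have k: "0 \<le> k" "k \<le> 1 / 2" using d by (simp_all add: k_def)
  have f: "rnorm (\<lambda>z. g (conf q z))" by (rule rnorm_conf[OF g q])
  have all: "(1 - k) * (r * norm z) \<le> g (conf q z) \<and> g (conf q z) \<le> (1 + k) * (r * norm z)" for z
  proof (cases "z = 0")
    case False
    define u where "u = z / of_real (norm z)"
    have u: "norm u = 1" "z = norm z *\<^sub>R u" using False by (auto simp: u_def norm_divide scaleR_conv_of_real)
    have "g (conf q z) = norm z * g (conf q u)"
      using rnormD(3)[OF f, of "norm z" u] u(2) by simp
    moreover have "\<bar>g (conf q u) - r\<bar> \<le> k * r" using r(2)[OF u(1)] unfolding q_def k_def .
    then have "(1 - k) * r \<le> g (conf q u)" "g (conf q u) \<le> (1 + k) * r"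
      by (auto simp: algebra_simps abs_le_iff)
    then have "norm z * ((1 - k) * r) \<le> norm z * g (conf q u)" "norm z * g (conf q u) \<le> norm z * ((1 + k) * r)"
      by (auto intro: mult_left_mono)
    ultimately show ?thesis by (simp add: mult_ac)
  qed (use rnorm_zero[OF f] in simp)
  define Q where "Q w = (r * norm ((1 / D) *\<^sub>R conf (- q) w))\<^sup>2" for w
  have sq: "(1 - 255 * sqrt d) * Q w \<le> (g w)\<^sup>2 \<and> (g w)\<^sup>2 \<le> (1 + 255 * sqrt d) * Q w" for w
  proof -
    define z where "z = (1 / D) *\<^sub>R conf (- q) w"
    have w: "conf q z = w"
      using conf_conf_inverse[of "- q" w] D
      unfolding z_def linear_scale[OF linear_conf] by (simp add: D_def[symmetric] scaleR_conv_of_real)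
    have Q: "Q w = (r * norm z)\<^sup>2" by (simp add: Q_def z_def)
    have Q0: "Q w \<ge> 0" by (simp add: Q_def)
    have "((1 - k) * (r * norm z))\<^sup>2 \<le> (g w)\<^sup>2"
      using all[of z] k r(1) unfolding w by (intro power_mono) auto
    moreover have "(g w)\<^sup>2 \<le> ((1 + k) * (r * norm z))\<^sup>2"
      using all[of z] rnormD(1)[OF g] unfolding w by (intro power_mono) auto
    ultimately have b: "(1 - k)\<^sup>2 * Q w \<le> (g w)\<^sup>2" "(g w)\<^sup>2 \<le> (1 + k)\<^sup>2 * Q w"
      unfolding Q by (simp_all add: power_mult_distrib)
    have kk: "k * k \<le> k / 2" using mult_left_mono[of k "1/2" k] k by simp
    \<comment> \<open>Squaring \<open>1 + k\<close> gives at most \<open>1 + 2 * k + k / 2\<close>,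
      because \<open>k \<le> 1 / 2\<close>; hence \<open>255 = 5/2 * 102\<close>.\<close>
    have e: "255 * sqrt d = 5/2 * k" by (simp add: k_def)
    have "1 - 255 * sqrt d \<le> (1 - k)\<^sup>2"
      unfolding e using k by (simp add: power2_eq_square algebra_simps)
    then have "(1 - 255 * sqrt d) * Q w \<le> (1 - k)\<^sup>2 * Q w" using Q0 by (rule mult_right_mono)
    moreover have "(1 + k)\<^sup>2 \<le> 1 + 255 * sqrt d"
      unfolding e using kk by (simp add: power2_eq_square algebra_simps)
    then have "(1 + k)\<^sup>2 * Q w \<le> (1 + 255 * sqrt d) * Q w" using Q0 by (rule mult_right_mono)
    ultimately show ?thesis using b by linarith
  qed
  \<comment> \<open>The images of \<open>1\<close> and \<open>\<i>\<close> under
    \<open>conf (- q)\<close>; their Gram matrix, scaled by \<open>c\<close>, gives the coefficients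
    of the quadratic form.\<close>
  define a b where "a = 1 - q" and "b = \<i> * (1 + q)"
  define c where "c = (r / D)\<^sup>2"
  have Qst: "Q (Complex s t) = (c * (norm a)\<^sup>2) * s\<^sup>2 + 2 * (c * (Re a * Re b + Im a * Im b)) * s * t + (c * (norm b)\<^sup>2) * t\<^sup>2" for s t
  proof -
    have "conf (- q) (Complex s t) = of_real s * a + of_real t * b"
      by (simp add: conf_def a_def b_def complex_eq_iff algebra_simps)
    then have "(norm (conf (- q) (Complex s t)))\<^sup>2 = (s * Re a + t * Re b)\<^sup>2 + (s * Im a + t * Im b)\<^sup>2"
      by (simp add: cmod_power2)
    moreover have "Q (Complex s t) = c * (norm (conf (- q) (Complex s t)))\<^sup>2"
      using D by (simp add: Q_def c_def power_mult_distrib power_divide)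
    ultimately show ?thesis unfolding cmod_power2 by (simp add: power2_eq_square algebra_simps)
  qed
  show ?thesis
    using sq[of "Complex _ _"] unfolding Qst by blast
qed

section \<open>Gauges of symmetric convex bodies\<close>

definition minkowski :: "'a::real_vector set \<Rightarrow> 'a \<Rightarrow> real" where
  "minkowski K x = Inf {t. t > 0 \<and> (1 / t) *\<^sub>R x \<in> K}"

text \<open>The nonempty relative interior is recorded as a ball of \<open>V\<close> around 0, which
  is what comparing the gauge with the ambient norm takes.\<close>

locale symmetric_body =
  fixes V K :: "'a::real_normed_vector set" and rad :: real
  assumes V: "subspace V" and KV: "K \<subseteq> V" and compact: "compact K" and conv: "convex K"
    and symm: "K = uminus ` K" and rad: "rad > 0" and ball: "\<And>x. x \<in> V \<Longrightarrow> norm x \<le> rad \<Longrightarrow> x \<in> K"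
begin

abbreviation N :: "'a \<Rightarrow> real" where "N \<equiv> minkowski K"

lemma zero_mem: "0 \<in> K"
  using ball[of 0] rad subspace_0[OF V] by simp

lemma minus_mem: "x \<in> K \<Longrightarrow> - x \<in> K"
  using symm by blast

lemma scale_mem:
  assumes "x \<in> K" "\<bar>c\<bar> \<le> 1" shows "c *\<^sub>R x \<in> K"
proof -
  have p: "c *\<^sub>R x \<in> K" if "x \<in> K" "0 \<le> c" "c \<le> 1" for c x
    using convexD[OF conv zero_mem that(1), of "1 - c" c] that by simp
  show ?thesis
  proof (cases "c \<ge> 0")
    case True then show ?thesis using p assms by simp
  next
    case False
    then show ?thesis using p[of "- x" "- c"] minus_mem assms by simp
  qed
qed

lemma half_diff_mem: "x \<in> K \<Longrightarrow> y \<in> K \<Longrightarrow> (1/2) *\<^sub>R (x - y) \<in> K"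
  using convexD[OF conv _ minus_mem, of x y "1/2" "1/2"] by (simp add: scaleR_diff_right)

lemma minkowski_set:
  assumes x: "x \<in> V"
  shows "bdd_below {t. t > 0 \<and> (1 / t) *\<^sub>R x \<in> K}"
    and "t \<ge> norm x / rad \<Longrightarrow> t > 0 \<Longrightarrow> (1 / t) *\<^sub>R x \<in> K"
    and "{t. t > 0 \<and> (1 / t) *\<^sub>R x \<in> K} \<noteq> {}"
proof -
  show "bdd_below {t. t > 0 \<and> (1 / t) *\<^sub>R x \<in> K}" by (rule bdd_belowI[of _ 0]) auto
  show *: "(1 / t) *\<^sub>R x \<in> K" if "t \<ge> norm x / rad" "t > 0" for t
  proof (rule ball)
    show "(1 / t) *\<^sub>R x \<in> V" by (rule subspace_scale[OF V x])
    show "norm ((1 / t) *\<^sub>R x) \<le> rad" using that rad by (simp add: field_simps)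
  qed
  have "(1 / (norm x / rad + 1)) *\<^sub>R x \<in> K" "norm x / rad + 1 > 0"
  proof -
    show pos: "norm x / rad + 1 > 0" using rad by (simp add: add_nonneg_pos)
    show "(1 / (norm x / rad + 1)) *\<^sub>R x \<in> K" by (rule *[OF _ pos]) simp
  qed
  then show "{t. t > 0 \<and> (1 / t) *\<^sub>R x \<in> K} \<noteq> {}" by blast
qed

lemma N_nonneg: "x \<in> V \<Longrightarrow> N x \<ge> 0"
  unfolding minkowski_def using minkowski_set(3) by (intro cInf_greatest) auto

text \<open>The infimum is attained in the sense needed because \<open>K\<close> is closed: the
  points \<open>(1 / s) x\<close> lie in \<open>K\<close> for all \<open>s > t\<close> and converge
  to \<open>(1 / t) x\<close>.\<close>

lemma N_le_iff:
  assumes x: "x \<in> V" and t: "t > 0"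
  shows "N x \<le> t \<longleftrightarrow> (1 / t) *\<^sub>R x \<in> K"
proof
  assume "(1 / t) *\<^sub>R x \<in> K"
  then show "N x \<le> t" unfolding minkowski_def using t by (intro cInf_lower minkowski_set x) auto
next
  assume le: "N x \<le> t"
  have ev: "(1 / s) *\<^sub>R x \<in> K" if "s > t" for s
  proof -
    have "N x < s" using le that by simp
    then obtain r where r: "r > 0" "(1 / r) *\<^sub>R x \<in> K" "r < s"
      unfolding minkowski_def using cInf_lessD[OF minkowski_set(3)[OF x]] by blast
    have "(1 / s) *\<^sub>R x = (r / s) *\<^sub>R ((1 / r) *\<^sub>R x)" using r by simp
    also have "\<dots> \<in> K" using r scale_mem[OF r(2), of "r / s"] by simp
    finally show ?thesis .
  qed
  have "((\<lambda>s. (1 / s) *\<^sub>R x) \<longlongrightarrow> (1 / t) *\<^sub>R x) (at_right t)"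
    using t by (intro tendsto_intros) auto
  moreover have "\<forall>\<^sub>F s in at_right t. (1 / s) *\<^sub>R x \<in> K"
    using ev by (auto simp: eventually_at_right_field intro!: exI[of _ "t + 1"])
  ultimately show "(1 / t) *\<^sub>R x \<in> K"
    using compact_imp_closed[OF compact] by (intro Lim_in_closed_set[of K _ "at_right t"]) auto
qed

lemma N_le_1_iff: "x \<in> V \<Longrightarrow> N x \<le> 1 \<longleftrightarrow> x \<in> K"
  using N_le_iff[of x 1] by simp

lemma N_eqI:
  assumes "a \<ge> 0" "x \<in> V" "\<And>t. t > 0 \<Longrightarrow> N x \<le> t \<longleftrightarrow> a \<le> t"
  shows "N x = a"
proof (rule antisym)
  show "N x \<le> a"
  proof (rule field_le_epsilon)
    fix e :: real assume "e > 0"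
    then show "N x \<le> a + e" using assms(1) assms(3)[of "a + e"] by simp
  qed
  show "a \<le> N x"
  proof (rule field_le_epsilon)
    fix e :: real assume "e > 0"
    then show "a \<le> N x + e" using N_nonneg[OF assms(2)] assms(3)[of "N x + e"] by simp
  qed
qed

lemma N_zero: "N 0 = 0"
  using subspace_0[OF V] by (intro N_eqI) (auto simp: N_le_iff zero_mem)

lemma N_scale:
  assumes x: "x \<in> V" shows "N (c *\<^sub>R x) = \<bar>c\<bar> * N x"
proof (cases "c = 0")
  case False
  show ?thesis
  proof (rule N_eqI)
    fix t :: real assume t: "t > 0"
    have "N (c *\<^sub>R x) \<le> t \<longleftrightarrow> (c / t) *\<^sub>R x \<in> K"
      using x t by (subst N_le_iff) (auto simp: subspace_scale[OF V])
    also have "\<dots> \<longleftrightarrow> (\<bar>c\<bar> / t) *\<^sub>R x \<in> K"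
      using minus_mem[of "(c / t) *\<^sub>R x"] minus_mem[of "- ((c / t) *\<^sub>R x)"] by (cases "c \<ge> 0") auto
    also have "\<dots> \<longleftrightarrow> N x \<le> t / \<bar>c\<bar>"
      using False t by (subst N_le_iff[OF x]) auto
    also have "\<dots> \<longleftrightarrow> \<bar>c\<bar> * N x \<le> t" using False by (simp add: field_simps)
    finally show "N (c *\<^sub>R x) \<le> t \<longleftrightarrow> \<bar>c\<bar> * N x \<le> t" .
  qed (use N_nonneg[OF x] subspace_scale[OF V x] in auto)
qed (simp add: N_zero)

lemma N_add:
  assumes x: "x \<in> V" and y: "y \<in> V" shows "N (x + y) \<le> N x + N y"
proof (rule field_le_epsilon)
  fix e :: real assume e: "e > 0"
  define s t where "s = N x + e / 2" and "t = N y + e / 2"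
  have st: "s > 0" "t > 0" using N_nonneg[OF x] N_nonneg[OF y] e by (auto simp: s_def t_def)
  have "(1 / s) *\<^sub>R x \<in> K" "(1 / t) *\<^sub>R y \<in> K"
    using N_le_iff[OF x st(1)] N_le_iff[OF y st(2)] e by (auto simp: s_def t_def)
  then have "(s / (s + t)) *\<^sub>R ((1 / s) *\<^sub>R x) + (t / (s + t)) *\<^sub>R ((1 / t) *\<^sub>R y) \<in> K"
    using st by (intro convexD[OF conv]) (auto simp: add_divide_distrib[symmetric])
  then have "(1 / (s + t)) *\<^sub>R (x + y) \<in> K"
    using st by (simp add: scaleR_add_right)
  then have "N (x + y) \<le> s + t" using N_le_iff[of "x + y" "s + t"] st subspace_add[OF V x y] by simp
  then show "N (x + y) \<le> N x + N y + e" by (simp add: s_def t_def)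
qed

lemma N_upper:
  assumes x: "x \<in> V" shows "N x \<le> norm x / rad"
proof (cases "x = 0")
  case False
  then have "norm x / rad > 0" using rad by simp
  then show ?thesis using N_le_iff[OF x] minkowski_set(2)[OF x order_refl] by blast
qed (simp add: N_zero)

lemma N_lower:
  obtains M where "M > 0" "\<And>x. x \<in> V \<Longrightarrow> norm x \<le> M * N x"
proof -
  obtain M where M: "M > 0" "\<And>x. x \<in> K \<Longrightarrow> norm x \<le> M"
    using compact_imp_bounded[OF compact] unfolding bounded_pos by blast
  have "norm x \<le> M * N x" if x: "x \<in> V" for x
  proof (rule field_le_epsilon)
    fix e :: real assume e: "e > 0"
    define t where "t = N x + e / M"
    have t: "t > 0" using N_nonneg[OF x] e M by (simp add: t_def add_nonneg_pos)
    have "(1 / t) *\<^sub>R x \<in> K" using N_le_iff[OF x t] e M by (simp add: t_def)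
    then have "norm ((1 / t) *\<^sub>R x) \<le> M" by (rule M)
    then have "norm x \<le> M * t" using t by (simp add: field_simps)
    then show "norm x \<le> M * N x + e" using M by (simp add: t_def algebra_simps)
  qed
  then show thesis using M by (intro that)
qed

lemma N_eq_0: assumes "x \<in> V" "N x = 0" shows "x = 0"
  using N_lower assms by (metis mult_zero_right norm_le_zero_iff)

lemma rnorm_N:
  fixes L :: "'b::euclidean_space \<Rightarrow> 'a"
  assumes L: "linear L" "\<And>z. L z \<in> V" "\<And>z. L z = 0 \<Longrightarrow> z = 0"
  shows "rnorm (\<lambda>z. N (L z))"
  unfolding rnorm_def
proof (intro conjI allI impI)
  show "N (L x) \<ge> 0" for x by (rule N_nonneg[OF L(2)])
  show "x = 0" if "N (L x) = 0" for x by (rule L(3)[OF N_eq_0[OF L(2) that]])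
  show "N (L (r *\<^sub>R x)) = \<bar>r\<bar> * N (L x)" for r x
    unfolding linear_scale[OF L(1)] by (rule N_scale[OF L(2)])
  show "N (L (x + y)) \<le> N (L x) + N (L y)" for x y
    unfolding linear_add[OF L(1)] by (rule N_add[OF L(2) L(2)])
qed

end

text \<open>If \<open>K\<close> contains a ball around \<open>a\<close>, then for small
  \<open>x\<close> it contains \<open>a + x\<close> and, by symmetry, \<open>x - a\<close>; their
  midpoint is \<open>x\<close>.\<close>

lemma symmetric_bodyI:
  assumes V: "subspace V" and K: "convex_body_in V K" and sym: "K = uminus ` K"
  obtains rad where "symmetric_body V K rad"
proof -
  have KV: "K \<subseteq> V" and cpt: "compact K" and conv: "convex K" and ne: "(top_of_set V) interior_of K \<noteq> {}"
    using K by (auto simp: convex_body_in_def)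
  obtain a U where a: "a \<in> U" "openin (top_of_set V) U" "U \<subseteq> K"
    using ne unfolding interior_of_def by blast
  then obtain e where e: "e > 0" "\<And>x. x \<in> V \<Longrightarrow> dist x a < e \<Longrightarrow> x \<in> U"
    unfolding openin_euclidean_subtopology_iff by meson
  have aV: "a \<in> V" using a KV by blast
  have "x \<in> K" if x: "x \<in> V" "norm x \<le> e / 2" for x
  proof -
    have "a + x \<in> K" "a - x \<in> K"
      using e(2)[of "a + x"] e(2)[of "a - x"] a x e(1) subspace_add[OF V aV x(1)] subspace_diff[OF V aV x(1)]
      by (auto simp: dist_norm)
    moreover have "- (a - x) \<in> K" using \<open>a - x \<in> K\<close> sym by blast
    ultimately have "(1/2) *\<^sub>R (a + x) + (1/2) *\<^sub>R (- (a - x)) \<in> K"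
      by (intro convexD[OF conv]) auto
    also have "(1/2) *\<^sub>R (a + x) + (1/2) *\<^sub>R (- (a - x)) = x"
      by (simp add: scaleR_diff_right scaleR_add_right scaleR_add_left[symmetric])
    finally show ?thesis .
  qed
  then show thesis
    using V KV cpt conv sym e by (intro that[of "e / 2"]) (unfold_locales, auto)
qed

section \<open>Plane sections and their Banach-Mazur distance\<close>

definition plane_map :: "'a::real_vector \<Rightarrow> 'a \<Rightarrow> complex \<Rightarrow> 'a" where
  "plane_map u v z = Re z *\<^sub>R u + Im z *\<^sub>R v"

lemma linear_plane_map: "linear (plane_map u v)"
  by (rule linearI) (simp_all add: plane_map_def algebra_simps)

lemma plane_map_mem: "subspace V \<Longrightarrow> u \<in> V \<Longrightarrow> v \<in> V \<Longrightarrow> plane_map u v z \<in> V"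
  unfolding plane_map_def by (intro subspace_add subspace_scale)

lemma subspace_range_plane_map: "subspace (range (plane_map u v))"
  by (rule linear_subspace_image[OF linear_plane_map subspace_UNIV])

lemma inj_plane_map: "(\<And>z. plane_map u v z = 0 \<Longrightarrow> z = 0) \<Longrightarrow> inj (plane_map u v)"
  using linear_injective_0[OF linear_plane_map] by blast

lemma dim_range_plane_map:
  assumes inj: "\<And>z. plane_map u v z = 0 \<Longrightarrow> z = 0"
  shows "dim (range (plane_map u v)) = 2"
proof -
  have "plane_map u v z \<in> span {u, v}" for z
    unfolding plane_map_def by (intro span_add span_scale span_base) auto
  moreover have "x \<in> range (plane_map u v)" if "x \<in> span {u, v}" for x
  proof -
    have "u = plane_map u v 1" "v = plane_map u v \<i>" by (simp_all add: plane_map_def)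
    then have "{u, v} \<subseteq> range (plane_map u v)" by blast
    then show ?thesis using span_minimal[OF _ subspace_range_plane_map] that by blast
  qed
  ultimately have "range (plane_map u v) = span {u, v}" by blast
  moreover have u: "u \<notin> span {v}"
  proof
    assume "u \<in> span {v}"
    then obtain k where "u = k *\<^sub>R v" unfolding span_singleton by blast
    then have "plane_map u v (Complex 1 (- k)) = 0" by (simp add: plane_map_def)
    then show False using inj[of "Complex 1 (- k)"] by (simp add: complex_eq_iff)
  qed
  moreover have "v \<noteq> 0" using inj[of \<i>] by (auto simp: plane_map_def)
  then have "independent {u, v}"
    using u span_base[of v "{v}"] by (auto simp: independent_insert dependent_single)
  moreover have "u \<noteq> v" using u span_base[of v "{v}"] by auto
  ultimately show ?thesis using dim_span_eq_card_independent[of "{u, v}"] by simp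
qed

text \<open>Affinity is given only for two-point combinations of points of \<open>W\<close>.
  Combining with 0 gives homogeneity, and the midpoint followed by doubling gives
  additivity.\<close>

lemma affine_map_on_linear_part:
  fixes T :: "'b::real_vector \<Rightarrow> 'a::real_vector"
  assumes T: "affine_map_on W V T" and W: "subspace W" and x: "x \<in> W"
  shows "T (c *\<^sub>R x) - T 0 = c *\<^sub>R (T x - T 0)"
    and "y \<in> W \<Longrightarrow> T (x + y) - T 0 = (T x - T 0) + (T y - T 0)"
proof -
  have aff: "T ((1 - u) *\<^sub>R x + u *\<^sub>R y) = (1 - u) *\<^sub>R T x + u *\<^sub>R T y" if "x \<in> W" "y \<in> W" for x y u
    using T that unfolding affine_map_on_def by blast
  have sc: "T (c *\<^sub>R x) - T 0 = c *\<^sub>R (T x - T 0)" if "x \<in> W" for c x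
    using aff[OF subspace_0[OF W] that, of c] by (simp add: algebra_simps)
  then show "T (c *\<^sub>R x) - T 0 = c *\<^sub>R (T x - T 0)" using x by blast
  assume y: "y \<in> W"
  define m where "m = (1 - 1/2) *\<^sub>R x + (1/2) *\<^sub>R y"
  have m: "m \<in> W" unfolding m_def by (intro subspace_add subspace_scale W x y)
  have Tm: "T m = (1/2) *\<^sub>R T x + (1/2) *\<^sub>R T y" unfolding m_def using aff[OF x y, of "1/2"] by simp
  have "x + y = 2 *\<^sub>R m" by (simp add: m_def scaleR_add_right)
  then have "T (x + y) - T 0 = 2 *\<^sub>R (T m - T 0)" using sc[OF m, of 2] by simp
  also have "\<dots> = (T x - T 0) + (T y - T 0)" unfolding Tm by (simp add: algebra_simps scaleR_2)
  finally show "T (x + y) - T 0 = (T x - T 0) + (T y - T 0)" .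
qed

lemma rnorm_lower:
  fixes g :: "complex \<Rightarrow> real"
  assumes g: "rnorm g"
  obtains m where "m > 0" "\<And>z. m * norm z \<le> g z"
proof -
  obtain z0 where z0: "norm z0 = 1" "\<And>z. norm z = 1 \<Longrightarrow> g z0 \<le> g z"
    using continuous_attains_inf[of "sphere 0 1 :: complex set" g] rnorm_continuous[OF g] by auto
  have "g z0 * norm z \<le> g z" for z
  proof (cases "z = 0")
    case False
    define u where "u = z / of_real (norm z)"
    have u: "norm u = 1" "z = norm z *\<^sub>R u" using False by (auto simp: u_def norm_divide scaleR_conv_of_real)
    have "g z = norm z * g u" using rnormD(3)[OF g, of "norm z" u] u(2) by simp
    then show ?thesis using mult_left_mono[OF z0(2)[OF u(1)], of "norm z"] by (simp add: mult.commute)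
  qed (simp add: rnorm_zero[OF g])
  moreover have "g z0 > 0" using z0 by (intro rnorm_pos[OF g]) auto
  ultimately show thesis by (intro that)
qed

context symmetric_body
begin

text \<open>An upper bound on \<open>Inf\<close> yields an admissible element only if the set is
  nonempty. Any two planar norms are comparable, so some linear map and some ratio always
  work.\<close>

lemma banach_mazur_sections_nonempty:
  assumes uv: "u \<in> V" "v \<in> V" "\<And>z. plane_map u v z = 0 \<Longrightarrow> z = 0"
    and uv': "u' \<in> V" "v' \<in> V" "\<And>z. plane_map u' v' z = 0 \<Longrightarrow> z = 0"
    and E: "E = range (plane_map u' v')" and F: "F = range (plane_map u v)"
  shows "{l. l > 0 \<and> (\<exists>T z. affine_map_on F E T \<and> z \<in> E \<and>
     K \<inter> E \<subseteq> T ` (K \<inter> F) \<and> T ` (K \<inter> F) \<subseteq> (\<lambda>x. l *\<^sub>R x + z) ` (K \<inter> E))} \<noteq> {}"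
proof -
  note mem = plane_map_mem[OF V uv(1,2)] plane_map_mem[OF V uv'(1,2)]
  have g: "rnorm (\<lambda>z. N (plane_map u v z))"
    by (rule rnorm_N[OF linear_plane_map mem(1)]) (rule uv(3))
  have g': "rnorm (\<lambda>z. N (plane_map u' v' z))"
    by (rule rnorm_N[OF linear_plane_map mem(2)]) (rule uv'(3))
  obtain M1 where M1: "M1 > 0" "\<And>z. N (plane_map u' v' z) \<le> M1 * norm z" using rnorm_upper[OF g'] by blast
  obtain M2 where M2: "M2 > 0" "\<And>z. N (plane_map u v z) \<le> M2 * norm z" using rnorm_upper[OF g] by blast
  obtain m1 where m1: "m1 > 0" "\<And>z. m1 * norm z \<le> N (plane_map u' v' z)" using rnorm_lower[OF g'] by blast
  obtain m2 where m2: "m2 > 0" "\<And>z. m2 * norm z \<le> N (plane_map u v z)" using rnorm_lower[OF g] by blast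
  \<comment> \<open>Large enough for the image of \<open>K \<inter> F\<close> to cover
    \<open>K \<inter> E\<close>; then \<open>l\<close> is chosen to cover that image in
    turn.\<close>
  define c where "c = M2 / m1"
  define l where "l = c * M1 / m2"
  have c: "c > 0" and l: "l > 0" using M1 M2 m1 m2 by (simp_all add: c_def l_def)
  define T where "T x = c *\<^sub>R plane_map u' v' (inv_into UNIV (plane_map u v) x)" for x
  have T: "T (plane_map u v z) = plane_map u' v' (c *\<^sub>R z)" for z
  proof -
    have "inv_into UNIV (plane_map u v) (plane_map u v z) = z"
      by (rule inv_into_f_f[OF inj_plane_map[OF uv(3)] UNIV_I])
    then show ?thesis unfolding T_def linear_scale[OF linear_plane_map] by (rule arg_cong)
  qed
  have "affine_map_on F E T"
    unfolding affine_map_on_def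
  proof (intro conjI ballI allI)
    show "T ` F \<subseteq> E" unfolding F E image_image T by blast
    fix x y t assume "x \<in> F" "y \<in> F"
    then obtain a b where ab: "x = plane_map u v a" "y = plane_map u v b" unfolding F by blast
    have "(1 - t) *\<^sub>R x + t *\<^sub>R y = plane_map u v ((1 - t) *\<^sub>R a + t *\<^sub>R b)"
      unfolding ab linear_add[OF linear_plane_map] linear_scale[OF linear_plane_map] ..
    then have "T ((1 - t) *\<^sub>R x + t *\<^sub>R y) = plane_map u' v' (c *\<^sub>R ((1 - t) *\<^sub>R a + t *\<^sub>R b))"
      by (simp only: T)
    also have "c *\<^sub>R ((1 - t) *\<^sub>R a + t *\<^sub>R b) = (1 - t) *\<^sub>R (c *\<^sub>R a) + t *\<^sub>R (c *\<^sub>R b)"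
      by (simp add: scaleR_add_right mult.commute)
    also have "plane_map u' v' \<dots> = (1 - t) *\<^sub>R T x + t *\<^sub>R T y"
      unfolding ab T linear_add[OF linear_plane_map] linear_scale[OF linear_plane_map, of _ _ "1 - t"]
        linear_scale[OF linear_plane_map, of _ _ t] ..
    finally show "T ((1 - t) *\<^sub>R x + t *\<^sub>R y) = (1 - t) *\<^sub>R T x + t *\<^sub>R T y" .
  qed
  moreover have "K \<inter> E \<subseteq> T ` (K \<inter> F)"
  proof
    fix x assume x: "x \<in> K \<inter> E"
    then obtain w where w: "x = plane_map u' v' w" unfolding E by blast
    have Nx: "N x \<le> 1" using x unfolding w by (simp add: N_le_1_iff[OF mem(2)])
    have "N (plane_map u v ((1 / c) *\<^sub>R w)) = N (plane_map u v w) / c"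
      unfolding linear_scale[OF linear_plane_map] N_scale[OF mem(1)] using c by simp
    also have "\<dots> \<le> M2 * norm w / c" using M2 c by (intro divide_right_mono) auto
    also have "\<dots> = m1 * norm w" using M2 m1 by (simp add: c_def)
    also have "\<dots> \<le> N x" unfolding w by (rule m1)
    finally have "plane_map u v ((1 / c) *\<^sub>R w) \<in> K"
      using iffD1[OF N_le_1_iff[OF mem(1)]] order_trans Nx by blast
    moreover have "T (plane_map u v ((1 / c) *\<^sub>R w)) = x" unfolding T w using c by simp
    ultimately have "x = T (plane_map u v ((1 / c) *\<^sub>R w))" "plane_map u v ((1 / c) *\<^sub>R w) \<in> K \<inter> F"
      unfolding F by simp_all
    then show "x \<in> T ` (K \<inter> F)" by (rule image_eqI)
  qed
  moreover have "T ` (K \<inter> F) \<subseteq> (\<lambda>x. l *\<^sub>R x + 0) ` (K \<inter> E)"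
  proof
    fix x assume "x \<in> T ` (K \<inter> F)"
    then obtain y where y: "y \<in> K" "y \<in> F" "x = T y" by blast
    then obtain w where "y = plane_map u v w" unfolding F by blast
    with y have w: "plane_map u v w \<in> K" "x = plane_map u' v' (c *\<^sub>R w)" by (simp_all only: T)
    have le: "N (plane_map u v w) \<le> 1" by (rule iffD2[OF N_le_1_iff[OF mem(1)] w(1)])
    have "N (plane_map u' v' ((c / l) *\<^sub>R w)) = (c / l) * N (plane_map u' v' w)"
      unfolding linear_scale[OF linear_plane_map] N_scale[OF mem(2)] using c l by simp
    also have "\<dots> \<le> (c / l) * (M1 * norm w)" using M1 c l by (intro mult_left_mono) auto
    also have "\<dots> = m2 * norm w" using c M1 m2 by (simp add: l_def)
    also have "\<dots> \<le> 1" using m2(2)[of w] le by (rule order_trans)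
    finally have "plane_map u' v' ((c / l) *\<^sub>R w) \<in> K" by (rule iffD1[OF N_le_1_iff[OF mem(2)]])
    moreover have "x = l *\<^sub>R plane_map u' v' ((c / l) *\<^sub>R w) + 0"
      unfolding w linear_scale[OF linear_plane_map, symmetric] using l by simp
    ultimately show "x \<in> (\<lambda>x. l *\<^sub>R x + 0) ` (K \<inter> E)" unfolding E by blast
  qed
  moreover have "0 \<in> E" unfolding E by (rule subspace_0[OF subspace_range_plane_map])
  ultimately have "l \<in> {l. l > 0 \<and> (\<exists>T z. affine_map_on F E T \<and> z \<in> E \<and>
     K \<inter> E \<subseteq> T ` (K \<inter> F) \<and> T ` (K \<inter> F) \<subseteq> (\<lambda>x. l *\<^sub>R x + z) ` (K \<inter> E))}"
    using l by (intro CollectI conjI exI[of _ T] exI[of _ 0])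
  then show ?thesis by (metis empty_iff)
qed

text \<open>The symmetry of \<open>K\<close> removes translations: averaging an affine comparison
  with its reflection through 0 leaves the linear part \<open>S\<close>, which satisfies the same
  two inclusions with ratio \<open>l\<close> and centre 0. In coordinates \<open>S\<close> becomes
  \<open>A\<close>.\<close>

lemma sections_close:
  assumes uv: "u \<in> V" "v \<in> V" "\<And>z. plane_map u v z = 0 \<Longrightarrow> z = 0"
    and uv': "u' \<in> V" "v' \<in> V" "\<And>z. plane_map u' v' z = 0 \<Longrightarrow> z = 0"
    and E: "E = range (plane_map u' v')" and F: "F = range (plane_map u v)"
    and bm: "banach_mazur E (K \<inter> E) F (K \<inter> F) < 1 + d"
  shows "\<exists>A. linear A \<and> (\<forall>z. N (plane_map u v z) \<le> N (plane_map u' v' (A z)) \<and>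
     N (plane_map u' v' (A z)) \<le> (1 + d) * N (plane_map u v z))"
proof -
  note mem = plane_map_mem[OF V uv(1,2)] plane_map_mem[OF V uv'(1,2)]
  have sE: "subspace E" and sF: "subspace F" unfolding E F by (rule subspace_range_plane_map)+
  have EV: "E \<subseteq> V" and FV: "F \<subseteq> V" unfolding E F using mem by auto
  obtain l T z where l: "l > 0" "l < 1 + d" and T: "affine_map_on F E T" and z: "z \<in> E"
    and in1: "K \<inter> E \<subseteq> T ` (K \<inter> F)" and in2: "T ` (K \<inter> F) \<subseteq> (\<lambda>x. l *\<^sub>R x + z) ` (K \<inter> E)"
    using cInf_lessD[OF banach_mazur_sections_nonempty[OF uv uv' E F] bm[unfolded banach_mazur_def]] by blast
  define S where "S x = T x - T 0" for x
  note lin = affine_map_on_linear_part[OF T sF, folded S_def]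
  have TE: "T x \<in> E" if "x \<in> F" for x using T that unfolding affine_map_on_def by blast
  have SE: "S x \<in> E" if "x \<in> F" for x
    unfolding S_def by (intro subspace_diff[OF sE] TE that subspace_0[OF sF])
  have Sdiff: "(1/2) *\<^sub>R (T a - T b) = S ((1/2) *\<^sub>R (a - b))" if "a \<in> F" "b \<in> F" for a b
  proof -
    have "S ((1/2) *\<^sub>R (a - b)) = (1/2) *\<^sub>R S (a - b)" by (rule lin(1)[OF subspace_diff[OF sF that]])
    also have "S (a - b) = S (a + (-1) *\<^sub>R b)" by simp
    also have "\<dots> = S a + S ((-1) *\<^sub>R b)"
      by (rule lin(2)[OF that(1) subspace_scale[OF sF that(2)]])
    also have "\<dots> = T a - T b" unfolding lin(1)[OF that(2)] by (simp add: S_def)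
    finally show ?thesis by simp
  qed
  \<comment> \<open>If \<open>x = T a\<close> and \<open>- x = T b\<close>, then \<open>x\<close> is
    half the difference, that is \<open>S\<close> of the point \<open>(a - b) / 2\<close> of
    \<open>K \<inter> F\<close>.\<close>
  have out: "\<exists>a\<in>K \<inter> F. S a = x" if x: "x \<in> K \<inter> E" for x
  proof -
    have "- x \<in> K \<inter> E" using x minus_mem subspace_neg[OF sE] by blast
    with x obtain a b where ab: "a \<in> K \<inter> F" "b \<in> K \<inter> F" "x = T a" "- x = T b"
      using in1 by blast
    have "x = (1/2) *\<^sub>R (T a - T b)" unfolding ab(3,4)[symmetric] by (simp add: scaleR_add_right scaleR_add_left[symmetric])
    also have "\<dots> = S ((1/2) *\<^sub>R (a - b))" using ab by (intro Sdiff) auto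
    finally have "S ((1/2) *\<^sub>R (a - b)) = x" by (rule sym)
    moreover have "(1/2) *\<^sub>R (a - b) \<in> K \<inter> F"
      using half_diff_mem[of a b] subspace_scale[OF sF subspace_diff[OF sF, of a b], of "1/2"] ab(1,2) by simp
    ultimately show ?thesis by blast
  qed
  \<comment> \<open>Applying \<open>T\<close> to \<open>a\<close> and \<open>- a\<close> and taking
    half the difference cancels the translation \<open>z\<close>.\<close>
  have into: "\<exists>k\<in>K. S a = l *\<^sub>R k" if a: "a \<in> K \<inter> F" for a
  proof -
    have ma: "- a \<in> K \<inter> F" using a minus_mem subspace_neg[OF sF] by blast
    obtain k1 k2 where k: "k1 \<in> K" "k2 \<in> K" "T a = l *\<^sub>R k1 + z" "T (- a) = l *\<^sub>R k2 + z"
      using in2 a ma by blast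
    have "S a = S ((1/2) *\<^sub>R (a - (- a)))" by (simp add: scaleR_add_left[symmetric] scaleR_add_right)
    also have "\<dots> = (1/2) *\<^sub>R (T a - T (- a))" using a ma by (intro Sdiff[symmetric]) auto
    also have "\<dots> = l *\<^sub>R ((1/2) *\<^sub>R (k1 - k2))" unfolding k by (simp add: algebra_simps)
    finally show ?thesis using half_diff_mem[OF k(1,2)] by blast
  qed
  have S0: "S 0 = 0" by (simp add: S_def)
  define A where "A w = inv_into UNIV (plane_map u' v') (S (plane_map u v w))" for w
  have PA: "plane_map u' v' (A w) = S (plane_map u v w)" for w
    unfolding A_def using SE[of "plane_map u v w"] unfolding E F by (simp add: f_inv_into_f)
  have inj': "plane_map u' v' a = plane_map u' v' b \<Longrightarrow> a = b" for a b
    using inj_plane_map[OF uv'(3)] by (auto dest: injD)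
  have memF: "plane_map u v w \<in> F" for w unfolding F by blast
  have memE: "plane_map u' v' w \<in> E" for w unfolding E by blast
  have A: "linear A"
  proof (rule linearI)
    show "A (a + b) = A a + A b" for a b
      by (rule inj') (simp only: PA linear_add[OF linear_plane_map] lin(2)[OF memF memF])
    show "A (c *\<^sub>R a) = c *\<^sub>R A a" for a c
      by (rule inj') (simp only: PA linear_scale[OF linear_plane_map] lin(1)[OF memF])
  qed
  \<comment> \<open>Every direction of the plane meets \<open>K \<inter> E\<close> after
    normalization by the gauge, so \<open>out\<close> makes \<open>A\<close> onto; in dimension two
    it is then injective.\<close>
  have sur: "\<exists>y. A y = w" for w
    proof (cases "w = 0")
      case True then show ?thesis using linear_0[OF A] by blast
    next
      case False
      define x where "x = plane_map u' v' w"
      have "N x \<noteq> 0" using N_eq_0[OF mem(2)[of w]] uv'(3)[of w] False unfolding x_def by blast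
      then have Nx: "N x > 0"
        using N_nonneg[OF mem(2)[of w]] unfolding x_def by linarith
      have "(1 / N x) *\<^sub>R x \<in> K \<inter> E"
        using iffD1[OF N_le_iff[OF mem(2)[of w]] order_refl] Nx subspace_scale[OF sE memE[of w], of "1 / N x"]
        unfolding x_def by blast
      then obtain a where a: "a \<in> F" "S a = (1 / N x) *\<^sub>R x" using out by blast
      then obtain y where y: "a = plane_map u v y" unfolding F by blast
      have "plane_map u' v' (A (N x *\<^sub>R y)) = N x *\<^sub>R S a"
        unfolding linear_scale[OF A] linear_scale[OF linear_plane_map] PA y ..
      also have "\<dots> = plane_map u' v' w" unfolding a(2) using Nx by (simp add: x_def)
      finally have "A (N x *\<^sub>R y) = w" by (rule inj')
      then show ?thesis ..
    qed
  have "surj A" unfolding surj_def using sur by metis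
  then have injA: "inj A" by (rule linear_surjective_imp_injective[OF A _ refl])
  have main: "N (plane_map u v w) \<le> N (plane_map u' v' (A w)) \<and>
     N (plane_map u' v' (A w)) \<le> (1 + d) * N (plane_map u v w)" for w
  proof (cases "w = 0")
    case True
    then show ?thesis using linear_0[OF A] by (simp add: plane_map_def N_zero)
  next
    case False
    have Aw: "A w \<noteq> 0" using injD[OF injA, of w 0] False linear_0[OF A] by auto
    have "N (plane_map u v w) \<noteq> 0" using N_eq_0[OF mem(1)[of w]] uv(3)[of w] False by blast
    moreover have "N (plane_map u' v' (A w)) \<noteq> 0" using N_eq_0[OF mem(2)[of "A w"]] uv'(3)[of "A w"] Aw by blast
    ultimately have pos: "N (plane_map u v w) > 0" "N (plane_map u' v' (A w)) > 0"
      using N_nonneg[OF mem(1)[of w]] N_nonneg[OF mem(2)[of "A w"]] by linarith+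
    define t where "t = N (plane_map u v w)"
    define s where "s = N (plane_map u' v' (A w))"
    have t: "t > 0" and s: "s > 0" using pos by (simp_all add: t_def s_def)
    have "(1 / t) *\<^sub>R plane_map u v w \<in> K \<inter> F"
      using iffD1[OF N_le_iff[OF mem(1)[of w] pos(1)] order_refl] subspace_scale[OF sF memF[of w], of "1 / t"]
      unfolding t_def by blast
    then obtain k where k: "k \<in> K" "S ((1 / t) *\<^sub>R plane_map u v w) = l *\<^sub>R k" using into by blast
    have "plane_map u' v' (A w) = t *\<^sub>R S ((1 / t) *\<^sub>R plane_map u v w)"
      unfolding PA lin(1)[OF memF] using t by simp
    then have "plane_map u' v' (A w) = (t * l) *\<^sub>R k" unfolding k(2) by simp
    then have "s = (t * l) * N k" unfolding s_def using N_scale[OF subsetD[OF KV k(1)]] t l by simp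
    also have "\<dots> \<le> (t * l) * 1"
      using iffD2[OF N_le_1_iff[OF subsetD[OF KV k(1)]] k(1)] t l by (intro mult_left_mono) simp_all
    also have "\<dots> \<le> (1 + d) * t" using t l by (simp add: mult.commute)
    finally have up: "s \<le> (1 + d) * t" .
    have "(1 / s) *\<^sub>R plane_map u' v' (A w) \<in> K \<inter> E"
      using iffD1[OF N_le_iff[OF mem(2)[of "A w"] pos(2)] order_refl] subspace_scale[OF sE memE[of "A w"], of "1 / s"]
      unfolding s_def by blast
    then obtain a where a: "a \<in> K" "a \<in> F" "S a = (1 / s) *\<^sub>R plane_map u' v' (A w)" using out by blast
    then obtain y where y: "a = plane_map u v y" unfolding F by blast
    have "plane_map u' v' (A (s *\<^sub>R y)) = s *\<^sub>R S a"
      unfolding linear_scale[OF A] linear_scale[OF linear_plane_map] PA y ..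
    also have "\<dots> = plane_map u' v' (A w)" unfolding a(3) using s by simp
    finally have "A (s *\<^sub>R y) = A w" by (rule inj')
    then have "w = s *\<^sub>R y" using injD[OF injA, of "s *\<^sub>R y" w] by simp
    then have "t = s * N a" unfolding t_def y using s by (simp add: linear_scale[OF linear_plane_map] N_scale[OF mem(1)])
    also have "\<dots> \<le> s * 1" using iffD2[OF N_le_1_iff[OF subsetD[OF KV a(1)]] a(1)] s by (intro mult_left_mono) simp_all
    finally show ?thesis using up unfolding t_def s_def by simp
  qed
  show ?thesis using A main by blast
qed

end

section \<open>Coordinates\<close>

definition vec_pm :: "nat \<Rightarrow> real Matrix.vec \<Rightarrow> (nat \<Rightarrow>\<^sub>0 real)" where
  "vec_pm n a = Abs_poly_mapping (\<lambda>i. if i < n then vec_index a i else 0)"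

definition pm_vec :: "nat \<Rightarrow> (nat \<Rightarrow>\<^sub>0 real) \<Rightarrow> real Matrix.vec" where
  "pm_vec n x = Matrix.vec n (Poly_Mapping.lookup x)"

lemma lookup_vec_pm: "Poly_Mapping.lookup (vec_pm n a) i = (if i < n then vec_index a i else 0)"
proof -
  have "finite {i. (if i < n then vec_index a i else 0) \<noteq> 0}"
    by (rule finite_subset[of _ "{..<n}"]) auto
  then show ?thesis unfolding vec_pm_def by simp
qed

lemma lookup_scaleR_pm: "Poly_Mapping.lookup (r *\<^sub>R x) i = r * Poly_Mapping.lookup (x :: nat \<Rightarrow>\<^sub>0 real) i"
proof -
  have "finite {i. r *\<^sub>R Poly_Mapping.lookup x i \<noteq> 0}"
    by (rule finite_subset[of _ "Poly_Mapping.keys x"]) (auto simp: in_keys_iff)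
  then show ?thesis unfolding scaleR_poly_mapping_def by simp
qed

lemma mem_Rn_iff: "x \<in> Rn n \<longleftrightarrow> (\<forall>i\<ge>n. Poly_Mapping.lookup x i = 0)"
  unfolding Rn_def by (auto simp: in_keys_iff subset_iff) (metis not_less)

lemma subspace_Rn: "subspace (Rn n)"
  by (rule subspaceI) (auto simp: mem_Rn_iff lookup_add lookup_scaleR_pm)

lemma vec_pm_mem: "vec_pm n a \<in> Rn n"
  by (simp add: mem_Rn_iff lookup_vec_pm)

lemma vec_pm_add: "a \<in> carrier_vec n \<Longrightarrow> b \<in> carrier_vec n \<Longrightarrow> vec_pm n (a + b) = vec_pm n a + vec_pm n b"
  by (rule poly_mapping_eqI) (auto simp: lookup_vec_pm lookup_add)

lemma vec_pm_smult: "a \<in> carrier_vec n \<Longrightarrow> vec_pm n (c \<cdot>\<^sub>v a) = c *\<^sub>R vec_pm n a"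
  by (rule poly_mapping_eqI) (auto simp: lookup_vec_pm lookup_scaleR_pm)

lemma pm_vec_carrier: "pm_vec n x \<in> carrier_vec n"
  by (simp add: pm_vec_def)

lemma vec_pm_pm_vec: "x \<in> Rn n \<Longrightarrow> vec_pm n (pm_vec n x) = x"
  by (rule poly_mapping_eqI) (auto simp: lookup_vec_pm pm_vec_def mem_Rn_iff)

lemma pm_vec_vec_pm: "a \<in> carrier_vec n \<Longrightarrow> pm_vec n (vec_pm n a) = a"
  by (rule eq_vecI) (auto simp: lookup_vec_pm pm_vec_def)

lemma pm_vec_lincomb: "pm_vec n (s *\<^sub>R x + t *\<^sub>R y) = s \<cdot>\<^sub>v pm_vec n x + t \<cdot>\<^sub>v pm_vec n y"
  by (rule eq_vecI) (auto simp: pm_vec_def lookup_add lookup_scaleR_pm)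

lemma scalar_prod_vec_pm:
  assumes "a \<in> carrier_vec n"
  shows "scalar_prod a a = (\<Sum>i<n. (Poly_Mapping.lookup (vec_pm n a) i)\<^sup>2)"
  using assms by (simp add: scalar_prod_def lookup_vec_pm power2_eq_square atLeast0LessThan)

lemma norm_vec_pm: "norm (vec_pm n a) = (\<Sum>i<n. \<bar>Poly_Mapping.lookup (vec_pm n a) i\<bar>)"
proof -
  have "norm (vec_pm n a) = (\<Sum>i\<in>Poly_Mapping.keys (vec_pm n a). \<bar>Poly_Mapping.lookup (vec_pm n a) i\<bar>)"
    by (simp add: norm_poly_mapping_def dist_poly_mapping_def)
  also have "\<dots> = (\<Sum>i<n. \<bar>Poly_Mapping.lookup (vec_pm n a) i\<bar>)"
    using vec_pm_mem[of n a] by (intro sum.mono_neutral_left) (auto simp: Rn_def in_keys_iff)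
  finally show ?thesis .
qed

lemma norm_vec_pm_bounds:
  assumes "a \<in> carrier_vec n"
  shows "scalar_prod a a \<le> (norm (vec_pm n a))\<^sup>2" "(norm (vec_pm n a))\<^sup>2 \<le> real n * scalar_prod a a"
proof -
  let ?l = "\<lambda>i. \<bar>Poly_Mapping.lookup (vec_pm n a) i\<bar>"
  have "scalar_prod a a = (L2_set ?l {..<n})\<^sup>2"
    unfolding scalar_prod_vec_pm[OF assms] L2_set_def by (simp add: sum_nonneg)
  also have "\<dots> \<le> (\<Sum>i<n. ?l i)\<^sup>2"
    by (intro power_mono L2_set_le_sum L2_set_nonneg) auto
  finally show "scalar_prod a a \<le> (norm (vec_pm n a))\<^sup>2" by (simp add: norm_vec_pm)
  have "(\<Sum>i<n. ?l i * 1)\<^sup>2 \<le> (\<Sum>i<n. (?l i)\<^sup>2) * (\<Sum>i<n. 1\<^sup>2)"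
    by (rule Cauchy_Schwarz_ineq_sum)
  then show "(norm (vec_pm n a))\<^sup>2 \<le> real n * scalar_prod a a"
    unfolding norm_vec_pm scalar_prod_vec_pm[OF assms] by (simp add: mult.commute)
qed

lemma mem_euclidean_ball_iff:
  assumes "a \<in> carrier_vec n"
  shows "vec_pm n a \<in> euclidean_ball n \<longleftrightarrow> scalar_prod a a \<le> 1"
  unfolding euclidean_ball_def L2_set_def scalar_prod_vec_pm[OF assms] using vec_pm_mem[of n a] by simp

locale symmetric_body_Rn = symmetric_body "Rn n" K rad for n K rad

text \<open>The constants \<open>kl\<close> and \<open>ku\<close> depend on the body through
  \<open>M\<close> and \<open>rad\<close>. This is harmless, since the conclusions about inscribed
  ellipsoids do not mention them.\<close>

lemma (in symmetric_body_Rn) vec_gauge_minkowski: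
  assumes n: "n > 0"
  shows "\<exists>kl ku. vec_gauge n (\<lambda>a. N (vec_pm n a)) kl ku"
proof -
  note mem = vec_pm_mem[of n]
  obtain M where M: "M > 0" "\<And>x. x \<in> Rn n \<Longrightarrow> norm x \<le> M * N x" using N_lower by blast
  have "vec_gauge n (\<lambda>a. N (vec_pm n a)) (1 / M\<^sup>2) (real n / rad\<^sup>2)"
  proof
    show "0 < n" by fact
    show "0 < 1 / M\<^sup>2" "0 < real n / rad\<^sup>2" using M rad n by simp_all
    fix a :: "real Matrix.vec" assume a: "a \<in> carrier_vec n"
    show "0 \<le> N (vec_pm n a)" by (rule N_nonneg[OF mem])
    show "N (vec_pm n (c \<cdot>\<^sub>v a)) = \<bar>c\<bar> * N (vec_pm n a)" for c
      unfolding vec_pm_smult[OF a] by (rule N_scale[OF mem])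
    show "N (vec_pm n (a + b)) \<le> N (vec_pm n a) + N (vec_pm n b)" if "b \<in> carrier_vec n" for b
      unfolding vec_pm_add[OF a that] by (rule N_add[OF mem mem])
    have "scalar_prod a a \<le> (M * N (vec_pm n a))\<^sup>2"
      using norm_vec_pm_bounds(1)[OF a] power_mono[OF M(2)[OF mem[of a]] norm_ge_zero, of 2] by linarith
    then show "1 / M\<^sup>2 * scalar_prod a a \<le> (N (vec_pm n a))\<^sup>2"
      using M(1) by (simp add: power_mult_distrib field_simps)
    have "(N (vec_pm n a))\<^sup>2 \<le> (norm (vec_pm n a) / rad)\<^sup>2"
      by (rule power_mono[OF N_upper[OF mem] N_nonneg[OF mem]])
    also have "\<dots> = (norm (vec_pm n a))\<^sup>2 / rad\<^sup>2" by (rule power_divide)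
    also have "\<dots> \<le> real n * scalar_prod a a / rad\<^sup>2"
      using norm_vec_pm_bounds(2)[OF a] by (rule divide_right_mono) simp
    finally show "(N (vec_pm n a))\<^sup>2 \<le> real n / rad\<^sup>2 * scalar_prod a a" by simp
  qed
  then show ?thesis by blast
qed

text \<open>By \<open>up\<close> the ellipsoid \<open>A B\<close> lies in \<open>K\<close>, by
  \<open>lo\<close> it contains \<open>sqrt C\<close> times \<open>K\<close>. Enlarging it by
  \<open>1 / sqrt C\<close> places it between \<open>K\<close> and \<open>(1 / sqrt C) K\<close>,
  with no translation.\<close>

lemma (in symmetric_body_Rn) banach_mazur_ball_le:
  assumes A: "A \<in> carrier_mat n n" "Determinant.det A \<noteq> 0"
    and up: "\<And>a. a \<in> carrier_vec n \<Longrightarrow> (N (vec_pm n (A *\<^sub>v a)))\<^sup>2 \<le> scalar_prod a a"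
    and C: "C > 0" and lo: "\<And>a. a \<in> carrier_vec n \<Longrightarrow> C * scalar_prod a a \<le> (N (vec_pm n (A *\<^sub>v a)))\<^sup>2"
  shows "banach_mazur (Rn n) K (Rn n) (euclidean_ball n) \<le> 1 / sqrt C"
proof -
  note mem = vec_pm_mem[of n]
  define l where "l = 1 / sqrt C"
  have l: "l > 0" "l * sqrt C = 1" using C by (simp_all add: l_def)
  define T where "T x = l *\<^sub>R vec_pm n (A *\<^sub>v pm_vec n x)" for x
  have "affine_map_on (Rn n) (Rn n) T"
    unfolding affine_map_on_def
  proof (intro conjI ballI allI)
    show "T ` Rn n \<subseteq> Rn n" unfolding T_def using subspace_scale[OF subspace_Rn vec_pm_mem] by blast
    fix x y u
    have "A *\<^sub>v pm_vec n ((1 - u) *\<^sub>R x + u *\<^sub>R y) = (1 - u) \<cdot>\<^sub>v (A *\<^sub>v pm_vec n x) + u \<cdot>\<^sub>v (A *\<^sub>v pm_vec n y)"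
      unfolding pm_vec_lincomb using A(1) pm_vec_carrier[of n x] pm_vec_carrier[of n y]
      by (simp add: mult_add_distrib_mat_vec[of _ n n] mult_mat_vec[of _ n n])
    moreover have "vec_pm n ((1 - u) \<cdot>\<^sub>v (A *\<^sub>v pm_vec n x) + u \<cdot>\<^sub>v (A *\<^sub>v pm_vec n y))
      = (1 - u) *\<^sub>R vec_pm n (A *\<^sub>v pm_vec n x) + u *\<^sub>R vec_pm n (A *\<^sub>v pm_vec n y)"
      using A(1) pm_vec_carrier[of n x] pm_vec_carrier[of n y] by (simp add: vec_pm_add vec_pm_smult)
    ultimately show "T ((1 - u) *\<^sub>R x + u *\<^sub>R y) = (1 - u) *\<^sub>R T x + u *\<^sub>R T y"
      unfolding T_def by (simp add: scaleR_add_right mult.commute)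
  qed
  moreover have "K \<subseteq> T ` euclidean_ball n"
  proof
    fix x assume x: "x \<in> K"
    then have xV: "x \<in> Rn n" using KV by blast
    obtain B where B: "B \<in> carrier_mat n n" "A * B = 1\<^sub>m n"
      using det_non_zero_imp_unit[OF A] unfolding Units_def by (auto simp: ring_mat_def)
    define a where "a = B *\<^sub>v pm_vec n x"
    have a: "a \<in> carrier_vec n" using B pm_vec_carrier by (simp add: a_def)
    have Aa: "A *\<^sub>v a = pm_vec n x"
      unfolding a_def using A(1) B pm_vec_carrier[of n x]
      by (simp add: assoc_mult_mat_vec[of A n n B n, symmetric])
    have "N x \<le> 1" using x N_le_1_iff[OF xV] by simp
    then have "(N x)\<^sup>2 \<le> 1" using N_nonneg[OF xV] by (intro power_le_one)
    then have le1: "C * scalar_prod a a \<le> 1"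
      using lo[OF a] unfolding Aa vec_pm_pm_vec[OF xV] by simp
    define b where "b = sqrt C \<cdot>\<^sub>v a"
    have b: "b \<in> carrier_vec n" using a by (simp add: b_def)
    have "scalar_prod b b = C * scalar_prod a a"
      using a C unfolding b_def by (simp add: mult.assoc[symmetric])
    then have "vec_pm n b \<in> euclidean_ball n" using mem_euclidean_ball_iff[OF b] le1 by simp
    moreover have "x = T (vec_pm n b)"
    proof -
      have "A *\<^sub>v b = sqrt C \<cdot>\<^sub>v pm_vec n x"
        unfolding b_def Aa[symmetric] using A(1) a by (simp add: mult_mat_vec[of _ n n])
      then have "T (vec_pm n b) = (l * sqrt C) *\<^sub>R x"
        unfolding T_def pm_vec_vec_pm[OF b] using vec_pm_smult[OF pm_vec_carrier, of n "sqrt C" x] vec_pm_pm_vec[OF xV] by simp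
      then show ?thesis using l by simp
    qed
    ultimately show "x \<in> T ` euclidean_ball n" by blast
  qed
  moreover have "T ` euclidean_ball n \<subseteq> (\<lambda>x. l *\<^sub>R x + 0) ` K"
  proof
    fix y assume "y \<in> T ` euclidean_ball n"
    then obtain x where x: "x \<in> euclidean_ball n" "y = T x" by blast
    have xV: "x \<in> Rn n" using x by (simp add: euclidean_ball_def)
    have "scalar_prod (pm_vec n x) (pm_vec n x) \<le> 1"
      using mem_euclidean_ball_iff[OF pm_vec_carrier, of n x] x vec_pm_pm_vec[OF xV] by simp
    then have "(N (vec_pm n (A *\<^sub>v pm_vec n x)))\<^sup>2 \<le> 1\<^sup>2"
      using up[OF pm_vec_carrier, of x] by simp
    then have "N (vec_pm n (A *\<^sub>v pm_vec n x)) \<le> 1" by (rule power2_le_imp_le) simp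
    then have "vec_pm n (A *\<^sub>v pm_vec n x) \<in> K" by (rule iffD1[OF N_le_1_iff[OF mem]])
    moreover have "y = l *\<^sub>R vec_pm n (A *\<^sub>v pm_vec n x) + 0" by (simp add: x(2) T_def)
    ultimately show "y \<in> (\<lambda>x. l *\<^sub>R x + 0) ` K" by (rule image_eqI[rotated])
  qed
  moreover have "0 \<in> Rn n" by (rule subspace_0[OF subspace_Rn])
  ultimately have "l \<in> {l. l > 0 \<and> (\<exists>T z. affine_map_on (Rn n) (Rn n) T \<and> z \<in> Rn n \<and>
                K \<subseteq> T ` euclidean_ball n \<and> T ` euclidean_ball n \<subseteq> (\<lambda>x. l *\<^sub>R x + z) ` K)}"
    using l(1) by (intro CollectI conjI exI[of _ T] exI[of _ 0])
  then show ?thesis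
    unfolding banach_mazur_def l_def by (rule cInf_lower) (auto intro!: bdd_belowI[of _ 0])
qed

text \<open>A fixed 3-dimensional coordinate subspace, the ambient space of the planes used in the
  winding argument; \<open>n \<ge> 3\<close> enters as the injectivity of this map.\<close>

definition embed3 :: "nat \<Rightarrow> complex \<times> real \<Rightarrow> (nat \<Rightarrow>\<^sub>0 real)" where
  "embed3 n x = vec_pm n (Matrix.vec n (\<lambda>i. if i = 0 then Re (fst x) else if i = 1 then Im (fst x)
     else if i = 2 then snd x else 0))"

lemma linear_embed3: "linear (embed3 n)"
  unfolding embed3_def
  by (rule linearI; rule poly_mapping_eqI) (auto simp: lookup_vec_pm lookup_add lookup_scaleR_pm)

lemma embed3_eq_0:
  assumes "n \<ge> 3" "embed3 n x = 0" shows "x = 0"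
proof -
  have "Poly_Mapping.lookup (embed3 n x) i = 0" for i using assms(2) by simp
  from this[of 0] this[of 1] this[of 2] show ?thesis
    using assms(1) by (cases x) (auto simp: embed3_def lookup_vec_pm zero_prod_def complex_eq_iff)
qed

text \<open>An arbitrary section is compared only with planes inside the image of
  \<open>embed3\<close>. For every \<open>k\<close> one of these has vanishing coefficient, so the
  section itself need not share a 3-space with them.\<close>

lemma (in symmetric_body_Rn) planes_near_quadratic:
  assumes n: "n \<ge> 3" and d: "0 < d" "204 * sqrt d \<le> 1"
    and bm: "\<And>E F. subspace E \<Longrightarrow> E \<subseteq> Rn n \<Longrightarrow> dim E = 2 \<Longrightarrow> subspace F \<Longrightarrow> F \<subseteq> Rn n \<Longrightarrow> dim F = 2 \<Longrightarrow>
          banach_mazur E (K \<inter> E) F (K \<inter> F) < 1 + d"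
    and u: "u \<in> carrier_vec n" and v: "v \<in> carrier_vec n"
    and indep: "\<And>s t. N (vec_pm n (s \<cdot>\<^sub>v u + t \<cdot>\<^sub>v v)) = 0 \<Longrightarrow> s = 0 \<and> t = 0"
  shows "\<exists>P B R. \<forall>s t. (1 - 255 * sqrt d) * quad P B R s t \<le> (N (vec_pm n (s \<cdot>\<^sub>v u + t \<cdot>\<^sub>v v)))\<^sup>2 \<and>
         (N (vec_pm n (s \<cdot>\<^sub>v u + t \<cdot>\<^sub>v v)))\<^sup>2 \<le> (1 + 255 * sqrt d) * quad P B R s t"
proof -
  note mem = vec_pm_mem[of n]
  define u' v' where "u' = vec_pm n u" and "v' = vec_pm n v"
  have pm: "plane_map u' v' z = vec_pm n (Re z \<cdot>\<^sub>v u + Im z \<cdot>\<^sub>v v)" for z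
    using u v by (simp add: plane_map_def u'_def v'_def vec_pm_add vec_pm_smult)
  have inj': "z = 0" if "plane_map u' v' z = 0" for z
  proof -
    have "Re z = 0 \<and> Im z = 0" by (rule indep) (simp only: pm[symmetric] that N_zero)
    then show ?thesis by (simp add: complex_eq_iff)
  qed
  have mem': "u' \<in> Rn n" "v' \<in> Rn n" unfolding u'_def v'_def by (rule mem)+
  have e3: "embed3 n x \<in> Rn n" for x unfolding embed3_def by (rule mem)
  define G where "G x = N (embed3 n x)" for x
  have G: "rnorm G"
    unfolding G_def by (rule rnorm_N[OF linear_embed3 e3]) (rule embed3_eq_0[OF n])
  have g: "rnorm (\<lambda>z. N (plane_map u' v' z))"
    by (rule rnorm_N[OF linear_plane_map plane_map_mem[OF V mem']]) (rule inj')
  have "\<exists>P B R. \<forall>s t. (1 - 255 * sqrt d) * quad P B R s t \<le> (N (plane_map u' v' (Complex s t)))\<^sup>2 \<and>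
     (N (plane_map u' v' (Complex s t)))\<^sup>2 \<le> (1 + 255 * sqrt d) * quad P B R s t"
  proof (rule near_quadratic_of_close_sections[OF G g d])
    fix L :: "complex \<Rightarrow> complex \<times> real"
    assume L: "linear L" "\<And>z. L z = 0 \<Longrightarrow> z = 0"
    define p q where "p = embed3 n (L 1)" and "q = embed3 n (L \<i>)"
    have pq: "plane_map p q z = embed3 n (L z)" for z
    proof -
      have "z = Re z *\<^sub>R 1 + Im z *\<^sub>R \<i>" by (simp add: complex_eq_iff)
      then have "L z = Re z *\<^sub>R L 1 + Im z *\<^sub>R L \<i>"
        using linear_add[OF L(1), of "Re z *\<^sub>R 1" "Im z *\<^sub>R \<i>"] by (simp add: linear_scale[OF L(1)])
      then show ?thesis
        unfolding plane_map_def p_def q_def by (simp add: linear_add[OF linear_embed3] linear_scale[OF linear_embed3])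
    qed
    have injpq: "z = 0" if "plane_map p q z = 0" for z
      using L(2)[OF embed3_eq_0[OF n]] that unfolding pq .
    have pqV: "p \<in> Rn n" "q \<in> Rn n" unfolding p_def q_def by (rule e3)+
    have "banach_mazur (range (plane_map u' v')) (K \<inter> range (plane_map u' v'))
        (range (plane_map p q)) (K \<inter> range (plane_map p q)) < 1 + d"
      using plane_map_mem[OF V mem'] plane_map_mem[OF V pqV]
      by (intro bm subspace_range_plane_map dim_range_plane_map[OF inj'] dim_range_plane_map[OF injpq]) auto
    from sections_close[OF pqV injpq mem' inj' refl refl this]
    show "\<exists>A. linear A \<and> (\<forall>z. G (L z) \<le> N (plane_map u' v' (A z)) \<and> N (plane_map u' v' (A z)) \<le> (1 + d) * G (L z))"
      unfolding pq G_def .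
  qed
  then show ?thesis unfolding pm by simp
qed

lemma quadratic_growth:
  fixes x :: real
  assumes "x \<ge> 3"
  shows "6 * (x + 1) \<le> (4 * x)\<^sup>2" "4 * x \<le> 48960 * x\<^sup>2"
proof -
  have "3 * x \<le> x\<^sup>2" using mult_right_mono[OF assms, of x] assms by (simp add: power2_eq_square)
  then show "6 * (x + 1) \<le> (4 * x)\<^sup>2" "4 * x \<le> 48960 * x\<^sup>2"
    using assms by (simp_all add: power_mult_distrib)
qed

lemma sqrt_le_cuberoot: "0 < d \<Longrightarrow> d \<le> 1 \<Longrightarrow> sqrt d \<le> d powr (1 / 3)"
  using powr_mono'[of "1/3" "1/2" d] by (simp add: powr_half_sqrt)

theorem corollary1p10:
  shows "\<exists>c::real. c > 0 \<and>
    (\<forall>(n::nat) (\<delta>::real) K :: (nat \<Rightarrow>\<^sub>0 real) set.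
       n \<ge> 3 \<longrightarrow> \<delta> > 0 \<longrightarrow>
       convex_body_in (Rn n) K \<longrightarrow> K = uminus ` K \<longrightarrow>
       (\<forall>E F. subspace E \<and> E \<subseteq> Rn n \<and> dim E = 2 \<and> subspace F \<and> F \<subseteq> Rn n \<and> dim F = 2 \<longrightarrow>
          banach_mazur E (K \<inter> E) F (K \<inter> F) < 1 + \<delta>) \<longrightarrow>
       banach_mazur (Rn n) K (Rn n) (euclidean_ball n)
         < 1 + c * (real n)\<^sup>2 * \<delta> powr (1 / 3))"
\<comment> \<open>The constant is \<open>4 * 12240\<close> with \<open>12240 = 2 * 24 * 255\<close>:
  24 comes from the volume argument, 255 from the planar estimate, 2 from inverting
  \<open>C\<close>, and 4 from the bound \<open>4 * n\<close> in the other regime.\<close>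
proof (intro exI[of _ 48960] conjI allI impI)
  show "(0::real) < 48960" by simp
  fix n :: nat and d :: real and K :: "(nat \<Rightarrow>\<^sub>0 real) set"
  assume n: "n \<ge> 3" and d: "d > 0" and body: "convex_body_in (Rn n) K" and sy: "K = uminus ` K"
    and bm: "\<forall>E F. subspace E \<and> E \<subseteq> Rn n \<and> dim E = 2 \<and> subspace F \<and> F \<subseteq> Rn n \<and> dim F = 2 \<longrightarrow>
          banach_mazur E (K \<inter> E) F (K \<inter> F) < 1 + d"
  obtain rad where "symmetric_body (Rn n) K rad" using symmetric_bodyI[OF subspace_Rn body sy] by blast
  then interpret symmetric_body_Rn n K rad by (rule symmetric_body_Rn.intro)
  obtain kl ku where "vec_gauge n (\<lambda>a. N (vec_pm n a)) kl ku" using vec_gauge_minkowski n by auto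
  then interpret vg: vec_gauge n "\<lambda>a. N (vec_pm n a)" kl ku .
  define s where "s = sqrt d"
  have s: "s > 0" using d by (simp add: s_def)
  have n3: "real n \<ge> 3" using n by simp
  show "banach_mazur (Rn n) K (Rn n) (euclidean_ball n) < 1 + 48960 * (real n)\<^sup>2 * d powr (1 / 3)"
  \<comment> \<open>The condition under which the planar estimate, applied with
    \<open>eta = 255 * s\<close>, keeps \<open>C\<close> at least \<open>1/2\<close>; it also forces
    \<open>d \<le> 1\<close>.\<close>
  proof (cases "24 * real n * (255 * s) \<le> 1/2")
    case True
    have "3 * s \<le> real n * s" using n3 s by (intro mult_right_mono) auto
    moreover have "24 * real n * (255 * s) = 6120 * (real n * s)" by simp
    ultimately have s1: "204 * s \<le> 1" "s \<le> 1" using True s by linarith+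
    then have d1: "d \<le> 1" by (simp add: s_def)
    obtain A where A: "vg.inscribed A" "Determinant.det A \<noteq> 0"
      "\<And>a. a \<in> carrier_vec n \<Longrightarrow> (1 - 24 * real n * (255 * s)) * scalar_prod a a \<le> (N (vec_pm n (A *\<^sub>v a)))\<^sup>2"
    proof (rule vg.ellipsoid_of_planar_closeness)
      show "0 < 255 * s" using s by simp
      show "24 * real n * (255 * s) \<le> 1 / 2" by (rule True)
      fix u v :: "real Matrix.vec"
      assume uv: "u \<in> carrier_vec n" "v \<in> carrier_vec n"
        and indep: "\<And>s t. N (vec_pm n (s \<cdot>\<^sub>v u + t \<cdot>\<^sub>v v)) = 0 \<Longrightarrow> s = 0 \<and> t = 0"
      show "\<exists>P B R. \<forall>s' t. (1 - 255 * s) * quad P B R s' t \<le> (N (vec_pm n (s' \<cdot>\<^sub>v u + t \<cdot>\<^sub>v v)))\<^sup>2 \<and>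
         (N (vec_pm n (s' \<cdot>\<^sub>v u + t \<cdot>\<^sub>v v)))\<^sup>2 \<le> (1 + 255 * s) * quad P B R s' t"
        unfolding s_def
      proof (rule planes_near_quadratic[OF n d s1(1)[unfolded s_def] _ uv])
        fix E F :: "(nat \<Rightarrow>\<^sub>0 real) set"
        assume "subspace E" "E \<subseteq> Rn n" "dim E = 2" "subspace F" "F \<subseteq> Rn n" "dim F = 2"
        then show "banach_mazur E (K \<inter> E) F (K \<inter> F) < 1 + d" using bm by blast
      qed (rule indep)
    qed (rule that)
    define C where "C = 1 - 24 * real n * (255 * s)"
    have C: "1/2 \<le> C" "C \<le> 1" using True s by (simp_all add: C_def)
    have "banach_mazur (Rn n) K (Rn n) (euclidean_ball n) \<le> 1 / sqrt C"
      using A C unfolding vg.inscribed_def by (intro banach_mazur_ball_le[of A]) (auto simp: C_def)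
    also have "1 / sqrt C \<le> 1 / C"
    proof -
      have "C \<le> sqrt C" using C by (intro real_le_rsqrt) (auto simp: power2_eq_square mult_left_le)
      then show ?thesis using C by (intro divide_left_mono) auto
    qed
    \<comment> \<open>The chord of the convex function \<open>1 / C\<close> over the interval from
      \<open>1/2\<close> to \<open>1\<close>.\<close>
    also have "1 / C \<le> 1 + 2 * (1 - C)"
    proof -
      have "0 \<le> (1 - C) * (2 * C - 1)" using C by simp
      then have "1 \<le> (1 + 2 * (1 - C)) * C" by (simp add: algebra_simps)
      then show ?thesis using C by (simp add: divide_le_eq)
    qed
    also have "2 * (1 - C) = 12240 * (real n * s)" by (simp add: C_def)
    also have "real n * s \<le> (real n)\<^sup>2 * d powr (1 / 3)"
    proof (rule mult_mono)
      show "real n \<le> (real n)\<^sup>2" using n3 by (simp add: power2_eq_square)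
      show "s \<le> d powr (1 / 3)" unfolding s_def by (rule sqrt_le_cuberoot[OF d d1])
    qed (use s in auto)
    also have "1 + 12240 * ((real n)\<^sup>2 * d powr (1 / 3)) < 1 + 48960 * (real n)\<^sup>2 * d powr (1 / 3)"
    proof -
      have "(real n)\<^sup>2 * d powr (1 / 3) > 0" using n3 d by simp
      then show ?thesis by (simp only: mult.assoc)
    qed
    finally show ?thesis by simp
  next
    case False
    obtain A where A: "vg.inscribed A" "Determinant.det A \<noteq> 0"
      "\<And>a. a \<in> carrier_vec n \<Longrightarrow> scalar_prod a a \<le> 6 * (real n + 1) * (N (vec_pm n (A *\<^sub>v a)))\<^sup>2"
      using vg.ellipsoid_sqrt_dim by blast
    define C where "C = 1 / (6 * (real n + 1))"
    have C: "C > 0" by (simp add: C_def)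
    have "banach_mazur (Rn n) K (Rn n) (euclidean_ball n) \<le> 1 / sqrt C"
    proof (rule banach_mazur_ball_le[OF _ A(2) _ C])
      show "A \<in> carrier_mat n n" using A(1) by (simp add: vg.inscribed_def)
      fix a :: "real Matrix.vec" assume a: "a \<in> carrier_vec n"
      show "(N (vec_pm n (A *\<^sub>v a)))\<^sup>2 \<le> scalar_prod a a" using A(1) a by (simp add: vg.inscribed_def)
      show "C * scalar_prod a a \<le> (N (vec_pm n (A *\<^sub>v a)))\<^sup>2"
        using A(3)[OF a] by (simp add: C_def divide_le_eq mult.commute)
    qed
    also have "1 / sqrt C = sqrt (6 * (real n + 1))" by (simp add: C_def real_sqrt_divide)
    also have "\<dots> \<le> 4 * real n"
    proof (rule real_le_lsqrt)
      show "6 * (real n + 1) \<le> (4 * real n)\<^sup>2" using quadratic_growth[OF n3] by simp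
    qed auto
    also have "4 * real n \<le> 48960 * (real n)\<^sup>2 * d powr (1 / 3)"
    \<comment> \<open>For \<open>d \<le> 1\<close> the failed smallness condition gives
      \<open>1 \<le> 12240 * n * s\<close>, and \<open>s\<close> is below the cube root. For
      \<open>d > 1\<close> the cube root exceeds 1, and \<open>n^2\<close> alone dominates.\<close>
    proof (cases "d \<le> 1")
      case True
      have "s \<le> d powr (1 / 3)" unfolding s_def by (rule sqrt_le_cuberoot[OF d True])
      then have "48960 * (real n)\<^sup>2 * s \<le> 48960 * (real n)\<^sup>2 * d powr (1 / 3)" by (intro mult_left_mono) auto
      moreover have "1 \<le> 12240 * (real n * s)" using False by simp
      then have "(4 * real n) * 1 \<le> (4 * real n) * (12240 * (real n * s))" by (intro mult_left_mono) auto
      ultimately show ?thesis by (simp add: power2_eq_square mult_ac)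
    next
      case False
      then have "1 \<le> d powr (1 / 3)" by (intro ge_one_powr_ge_zero) auto
      then have "48960 * (real n)\<^sup>2 * 1 \<le> 48960 * (real n)\<^sup>2 * d powr (1 / 3)" by (intro mult_left_mono) auto
      then show ?thesis using quadratic_growth(2)[OF n3] by linarith
    qed
    finally show ?thesis by simp
  qed
qed

end
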